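(* Let $p,q>1$ be integers with $\frac{\log p}{\log q}$ irrational. A representation $\pi:C(S_{pq})\rtimes\mathbb{Z}^2\to B(H)$ on a Hilbert space $H$ is induced by a finitely supported ergodic $\times p,\times q$-invariant Borel probability measure $\mu$ on $\mathbb{T}$ (i.e. is unitarily equivalent to $\pi_\mu$ for such a $\mu$) if and only if the following three conditions hold: (1) $\pi$ is irreducible; (2) $H_{\mathbb{Z}^2}\neq 0$; (3) there exists a nonzero $N\in\mathbb{Z}\subset\mathbb{Z}[\frac1{pq}]$ such that $\pi(z^N)x=x$ for every $x\in H_{\mathbb{Z}^2}$.
   Context: $\mathbb{T}$ is the unit circle; $T_p(z)=z^p$, $T_q(z)=z^q$ on $\mathbb{T}$. A Borel probability measure $\mu$ on $\mathbb{T}$ is $\times p,\times q$-invariant if $\mu(T_p^{-1}E)=\mu(T_q^{-1}E)=\mu(E)$ for all Borel $E$; it is ergodic if every Borel $E$ with $T_p^{-1}E=E=T_q^{-1}E$ has $\mu(E)\in\{0,1\}$. $S_{pq}$ is the Pontryagin dual of the discrete abelian group $\mathbb{Z}[\frac1{pq}]$, so $C(S_{pq})=C^*(\mathbb{Z}[\frac1{pq}])$; for $k\in\mathbb{Z}[\frac1{pq}]$, $z^k\in C(S_{pq})$ denotes the corresponding unitary (character). $\mathbb{Z}^2$ acts on $C(S_{pq})$ by automorphisms with $(m,n)\cdot z^k=z^{kp^mq^n}$, and $C(S_{pq})\rtimes\mathbb{Z}^2$ is the full crossed product, with canonical unitaries $u_{(m,n)}$ satisfying $u_{(m,n)}z^ku_{(m,n)}^*=z^{kp^mq^n}$.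 For a representation $\pi$ of it on $H$, $H_{\mathbb{Z}^2}=\{x\in H:\pi(u_{(m,n)})x=x\text{ for all }(m,n)\in\mathbb{Z}^2\}$. A representation is a $*$-homomorphism into $B(H)$; it is irreducible if its commutant consists of scalars. For a finitely supported $\times p,\times q$-invariant measure $\mu$ on $\mathbb{T}$, the operators $V_pf=f\circ T_p$ and $V_qf=f\circ T_q$ on $L^2(\mathbb{T},\mu)$ are commuting unitaries, and with $(M_zf)(z)=zf(z)$ one has $V_pM_z=M_z^pV_p$, $V_qM_z=M_z^qV_q$. The representation $\pi_\mu$ of $C(S_{pq})\rtimes\mathbb{Z}^2$ on $L^2(\mathbb{T},\mu)$ is the unique one with $\pi_\mu(u_{(1,0)})=V_p$, $\pi_\mu(u_{(0,1)})=V_q$, $\pi_\mu(z^1)=M_z$. (This uses that $C(S_{pq})\rtimes\mathbb{Z}^2$ is isomorphic to the universal unital $C^*$-algebra generated by unitaries $s,t,z$ with $st=ts$, $sz=z^ps$, $tz=z^qt$.) *)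

theory Defs
  imports "HOL-Probability.Probability"
begin

section \<open>Hilbert spaces\<close>

text \<open>
  Hilbert spaces and algebras are records with an explicit carrier, because the spaces
  \<open>L\<^sup>2(\<mu>)\<close> and the algebras over \<open>\<int>[1/pq]\<close> depend on values (\<open>\<mu>\<close>, \<open>p\<close>, \<open>q\<close>) and are not types.
\<close>

record 'a cspace =
  carr :: "'a set"
  vzero :: 'a
  vadd :: "'a \<Rightarrow> 'a \<Rightarrow> 'a"
  vscale :: "complex \<Rightarrow> 'a \<Rightarrow> 'a"

record 'a hilb = "'a cspace" +
  ip :: "'a \<Rightarrow> 'a \<Rightarrow> complex"

definition vdiff :: "('a, 'm) cspace_scheme \<Rightarrow> 'a \<Rightarrow> 'a \<Rightarrow> 'a" where
  "vdiff V x y = vadd V x (vscale V (-1) y)"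

locale complex_space =
  fixes V :: "('a, 'm) cspace_scheme"
  assumes zero_closed: "vzero V \<in> carr V"
    and add_closed: "x \<in> carr V \<Longrightarrow> y \<in> carr V \<Longrightarrow> vadd V x y \<in> carr V"
    and scale_closed: "x \<in> carr V \<Longrightarrow> vscale V c x \<in> carr V"
    and add_assoc: "x \<in> carr V \<Longrightarrow> y \<in> carr V \<Longrightarrow> z \<in> carr V \<Longrightarrow>
          vadd V (vadd V x y) z = vadd V x (vadd V y z)"
    and add_comm: "x \<in> carr V \<Longrightarrow> y \<in> carr V \<Longrightarrow> vadd V x y = vadd V y x"
    and add_zero: "x \<in> carr V \<Longrightarrow> vadd V x (vzero V) = x"
    and add_neg: "x \<in> carr V \<Longrightarrow> vadd V x (vscale V (-1) x) = vzero V"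
    and scale_one: "x \<in> carr V \<Longrightarrow> vscale V 1 x = x"
    and scale_scale: "x \<in> carr V \<Longrightarrow> vscale V c (vscale V d x) = vscale V (c * d) x"
    and scale_add_left: "x \<in> carr V \<Longrightarrow>
          vscale V (c + d) x = vadd V (vscale V c x) (vscale V d x)"
    and scale_add_right: "x \<in> carr V \<Longrightarrow> y \<in> carr V \<Longrightarrow>
          vscale V c (vadd V x y) = vadd V (vscale V c x) (vscale V c y)"

definition hnorm :: "('a, 'm) hilb_scheme \<Rightarrow> 'a \<Rightarrow> real" where
  "hnorm H x = sqrt (Re (ip H x x))"

text \<open>The inner product is linear in its first argument.\<close>

locale hilbert_space = complex_space H for H :: "('a, 'm) hilb_scheme" +
  assumes ip_add: "x \<in> carr H \<Longrightarrow> y \<in> carr H \<Longrightarrow> z \<in> carr H \<Longrightarrow>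
          ip H (vadd H x y) z = ip H x z + ip H y z"
    and ip_scale: "x \<in> carr H \<Longrightarrow> y \<in> carr H \<Longrightarrow> ip H (vscale H c x) y = c * ip H x y"
    and ip_commute: "x \<in> carr H \<Longrightarrow> y \<in> carr H \<Longrightarrow> ip H y x = cnj (ip H x y)"
    and ip_nonneg: "x \<in> carr H \<Longrightarrow> 0 \<le> Re (ip H x x)"
    and ip_definite: "x \<in> carr H \<Longrightarrow> ip H x x = 0 \<Longrightarrow> x = vzero H"
    and complete: "(\<And>n::nat. X n \<in> carr H) \<Longrightarrow>
          (\<And>e. e > 0 \<Longrightarrow> \<exists>M. \<forall>m\<ge>M. \<forall>n\<ge>M. hnorm H (vdiff H (X m) (X n)) < e) \<Longrightarrow>
          \<exists>x\<in>carr H. (\<lambda>n. hnorm H (vdiff H (X n) x)) \<longlonglongrightarrow> 0"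

definition bounded_ops :: "('a, 'm) hilb_scheme \<Rightarrow> ('a \<Rightarrow> 'a) set" where
  "bounded_ops H = {T.
     (\<forall>x\<in>carr H. T x \<in> carr H) \<and>
     (\<forall>x\<in>carr H. \<forall>y\<in>carr H. T (vadd H x y) = vadd H (T x) (T y)) \<and>
     (\<forall>c. \<forall>x\<in>carr H. T (vscale H c x) = vscale H c (T x)) \<and>
     (\<exists>K. \<forall>x\<in>carr H. hnorm H (T x) \<le> K * hnorm H x)}"

definition op_norm :: "('a, 'm) hilb_scheme \<Rightarrow> ('a \<Rightarrow> 'a) \<Rightarrow> real" where
  "op_norm H T = Sup {hnorm H (T x) | x. x \<in> carr H \<and> hnorm H x \<le> 1}"


section \<open>Representations of *-algebras\<close>

record 'a star_alg = "'a cspace" +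
  amult :: "'a \<Rightarrow> 'a \<Rightarrow> 'a"
  astar :: "'a \<Rightarrow> 'a"

text \<open>
  A *-homomorphism into \<open>B(H)\<close>; it need not be unital.  Only the values on \<^term>\<open>carr A\<close> and
  \<^term>\<open>carr H\<close> matter.  The last clause says that \<open>\<pi>(a\<^sup>*)\<close> is the adjoint of \<open>\<pi>(a)\<close>.
\<close>

definition star_rep ::
    "('a, 'm) star_alg_scheme \<Rightarrow> ('h, 'n) hilb_scheme \<Rightarrow> ('a \<Rightarrow> 'h \<Rightarrow> 'h) \<Rightarrow> bool" where
  "star_rep A H \<pi> \<longleftrightarrow>
     (\<forall>a\<in>carr A. \<pi> a \<in> bounded_ops H) \<and>
     (\<forall>a\<in>carr A. \<forall>b\<in>carr A. \<forall>x\<in>carr H. \<pi> (vadd A a b) x = vadd H (\<pi> a x) (\<pi> b x)) \<and>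
     (\<forall>c. \<forall>a\<in>carr A. \<forall>x\<in>carr H. \<pi> (vscale A c a) x = vscale H c (\<pi> a x)) \<and>
     (\<forall>a\<in>carr A. \<forall>b\<in>carr A. \<forall>x\<in>carr H. \<pi> (amult A a b) x = \<pi> a (\<pi> b x)) \<and>
     (\<forall>a\<in>carr A. \<forall>x\<in>carr H. \<forall>y\<in>carr H. ip H (\<pi> a x) y = ip H x (\<pi> (astar A a) y))"

definition commutant ::
    "('a, 'm) star_alg_scheme \<Rightarrow> ('h, 'n) hilb_scheme \<Rightarrow> ('a \<Rightarrow> 'h \<Rightarrow> 'h) \<Rightarrow> ('h \<Rightarrow> 'h) set" where
  "commutant A H \<pi> = {T \<in> bounded_ops H. \<forall>a\<in>carr A. \<forall>x\<in>carr H. T (\<pi> a x) = \<pi> a (T x)}"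

definition irreducible_rep ::
    "('a, 'm) star_alg_scheme \<Rightarrow> ('h, 'n) hilb_scheme \<Rightarrow> ('a \<Rightarrow> 'h \<Rightarrow> 'h) \<Rightarrow> bool" where
  "irreducible_rep A H \<pi> \<longleftrightarrow> (\<forall>T\<in>commutant A H \<pi>. \<exists>c. \<forall>x\<in>carr H. T x = vscale H c x)"

definition unitary_map ::
    "('h, 'm) hilb_scheme \<Rightarrow> ('k, 'n) hilb_scheme \<Rightarrow> ('h \<Rightarrow> 'k) \<Rightarrow> bool" where
  "unitary_map H K W \<longleftrightarrow>
     bij_betw W (carr H) (carr K) \<and>
     (\<forall>x\<in>carr H. \<forall>y\<in>carr H. W (vadd H x y) = vadd K (W x) (W y)) \<and>
     (\<forall>c. \<forall>x\<in>carr H. W (vscale H c x) = vscale K c (W x)) \<and>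
     (\<forall>x\<in>carr H. \<forall>y\<in>carr H. ip K (W x) (W y) = ip H x y)"

definition unitarily_equivalent ::
    "('a, 'm) star_alg_scheme \<Rightarrow> ('h, 'n) hilb_scheme \<Rightarrow> ('a \<Rightarrow> 'h \<Rightarrow> 'h) \<Rightarrow>
     ('k, 'l) hilb_scheme \<Rightarrow> ('a \<Rightarrow> 'k \<Rightarrow> 'k) \<Rightarrow> bool" where
  "unitarily_equivalent A H \<pi> K \<rho> \<longleftrightarrow>
     (\<exists>W. unitary_map H K W \<and> (\<forall>a\<in>carr A. \<forall>x\<in>carr H. W (\<pi> a x) = \<rho> a (W x)))"


section \<open>Completion of a *-algebra in a norm\<close>

definition cauchy_seqs :: "('a, 'm) star_alg_scheme \<Rightarrow> ('a \<Rightarrow> real) \<Rightarrow> (nat \<Rightarrow> 'a) set" where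
  "cauchy_seqs A N = {X. (\<forall>n. X n \<in> carr A) \<and>
     (\<forall>e>0. \<exists>M. \<forall>m\<ge>M. \<forall>n\<ge>M. N (vdiff A (X m) (X n)) < e)}"

definition null_rel ::
    "('a, 'm) star_alg_scheme \<Rightarrow> ('a \<Rightarrow> real) \<Rightarrow> ((nat \<Rightarrow> 'a) \<times> (nat \<Rightarrow> 'a)) set" where
  "null_rel A N = {(X, Y). X \<in> cauchy_seqs A N \<and> Y \<in> cauchy_seqs A N \<and>
     (\<lambda>n. N (vdiff A (X n) (Y n))) \<longlonglongrightarrow> 0}"

definition seq_class ::
    "('a, 'm) star_alg_scheme \<Rightarrow> ('a \<Rightarrow> real) \<Rightarrow> (nat \<Rightarrow> 'a) \<Rightarrow> (nat \<Rightarrow> 'a) set" where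
  "seq_class A N X = null_rel A N `` {X}"

definition rep_of :: "'b set \<Rightarrow> 'b" where
  "rep_of C = (SOME x. x \<in> C)"

definition completion ::
    "('a, 'm) star_alg_scheme \<Rightarrow> ('a \<Rightarrow> real) \<Rightarrow> (nat \<Rightarrow> 'a) set star_alg" where
  "completion A N = \<lparr>
     carr = cauchy_seqs A N // null_rel A N,
     vzero = seq_class A N (\<lambda>n. vzero A),
     vadd = (\<lambda>C D. seq_class A N (\<lambda>n. vadd A (rep_of C n) (rep_of D n))),
     vscale = (\<lambda>c C. seq_class A N (\<lambda>n. vscale A c (rep_of C n))),
     amult = (\<lambda>C D. seq_class A N (\<lambda>n. amult A (rep_of C n) (rep_of D n))),
     astar = (\<lambda>C. seq_class A N (\<lambda>n. astar A (rep_of C n)))\<rparr>"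


section \<open>The solenoid and the crossed product\<close>

definition Zloc :: "nat \<Rightarrow> nat \<Rightarrow> rat set" where
  "Zloc p q = {of_int a / of_nat (p * q) ^ n | (a::int) (n::nat). True}"

text \<open>
  The Pontryagin dual of the discrete group \<open>\<int>[1/pq]\<close>.  Its topology, pointwise convergence, is the
  subspace topology of the product topology on \<^typ>\<open>rat \<Rightarrow> complex\<close>; the values off \<open>\<int>[1/pq]\<close>
  are fixed.
\<close>

definition solenoid :: "nat \<Rightarrow> nat \<Rightarrow> (rat \<Rightarrow> complex) set" where
  "solenoid p q = {\<xi> \<in> Zloc p q \<rightarrow>\<^sub>E sphere 0 1.
     \<forall>k\<in>Zloc p q. \<forall>l\<in>Zloc p q. \<xi> (k + l) = \<xi> k * \<xi> l}"

text \<open>Continuous functions on the solenoid are extended by 0 off the solenoid.\<close>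

definition C_solenoid :: "nat \<Rightarrow> nat \<Rightarrow> ((rat \<Rightarrow> complex) \<Rightarrow> complex) set" where
  "C_solenoid p q = {f. continuous_on (solenoid p q) f \<and> (\<forall>\<xi>. \<xi> \<notin> solenoid p q \<longrightarrow> f \<xi> = 0)}"

definition character_fun :: "nat \<Rightarrow> nat \<Rightarrow> rat \<Rightarrow> (rat \<Rightarrow> complex) \<Rightarrow> complex" where
  "character_fun p q k = (\<lambda>\<xi>. if \<xi> \<in> solenoid p q then \<xi> k else 0)"

text \<open>
  The action of \<open>\<int>\<^sup>2\<close> is dual to multiplication by \<open>p\<^sup>m q\<^sup>n\<close> on \<open>\<int>[1/pq]\<close>, so it sends \<open>z\<^sup>k\<close> to the
  character \<open>\<xi> \<mapsto> \<xi> (k p\<^sup>m q\<^sup>n)\<close>.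
\<close>

definition act ::
    "nat \<Rightarrow> nat \<Rightarrow> int \<times> int \<Rightarrow> ((rat \<Rightarrow> complex) \<Rightarrow> complex) \<Rightarrow> (rat \<Rightarrow> complex) \<Rightarrow> complex" where
  "act p q s f = (\<lambda>\<xi>. if \<xi> \<in> solenoid p q
     then f (\<lambda>k\<in>Zloc p q. \<xi> (k * of_nat p powi fst s * of_nat q powi snd s)) else 0)"

type_synonym conv_elt = "int \<times> int \<Rightarrow> (rat \<Rightarrow> complex) \<Rightarrow> complex"

text \<open>
  The convolution *-algebra \<open>C\<^sub>c(\<int>\<^sup>2, C(S\<^sub>p\<^sub>q))\<close>; \<open>F\<close> stands for the finite sum of the \<open>F(s) u\<^sub>s\<close>.
\<close>

definition conv_alg :: "nat \<Rightarrow> nat \<Rightarrow> conv_elt star_alg" where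
  "conv_alg p q = \<lparr>
     carr = {F. (\<forall>s. F s \<in> C_solenoid p q) \<and> finite {s. F s \<noteq> (\<lambda>\<xi>. 0)}},
     vzero = (\<lambda>s \<xi>. 0),
     vadd = (\<lambda>F G s \<xi>. F s \<xi> + G s \<xi>),
     vscale = (\<lambda>c F s \<xi>. c * F s \<xi>),
     amult = (\<lambda>F G s \<xi>. \<Sum>t | F t \<noteq> (\<lambda>\<xi>. 0). F t \<xi> * act p q t (G (s - t)) \<xi>),
     astar = (\<lambda>F s. act p q s (\<lambda>\<xi>. cnj (F (- s) \<xi>)))\<rparr>"

text \<open>
  The universal norm, a supremum over *-representations of the convolution algebra.  It is enough
  to consider cyclic representations.  As \<open>\<int>[1/pq]\<close> is countable, \<open>C(S\<^sub>p\<^sub>q)\<close> is separable and cyclic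
  representations act on separable Hilbert spaces, which are all isomorphic to closed subspaces of
  \<open>\<ell>\<^sup>2\<close>; so Hilbert spaces with carrier in \<^typ>\<open>nat \<Rightarrow> complex\<close> realise the supremum over all of them.
\<close>

definition full_norm :: "nat \<Rightarrow> nat \<Rightarrow> conv_elt \<Rightarrow> real" where
  "full_norm p q F = Sup {op_norm H (\<pi> F) | (H :: (nat \<Rightarrow> complex) hilb) \<pi>.
     hilbert_space H \<and> star_rep (conv_alg p q) H \<pi>}"

type_synonym crossed_elt = "(nat \<Rightarrow> conv_elt) set"

definition crossed_product :: "nat \<Rightarrow> nat \<Rightarrow> crossed_elt star_alg" where
  "crossed_product p q = completion (conv_alg p q) (full_norm p q)"

definition conv_embed :: "nat \<Rightarrow> nat \<Rightarrow> conv_elt \<Rightarrow> crossed_elt" where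
  "conv_embed p q F = seq_class (conv_alg p q) (full_norm p q) (\<lambda>n. F)"

definition zpow :: "nat \<Rightarrow> nat \<Rightarrow> rat \<Rightarrow> crossed_elt" where
  "zpow p q k = conv_embed p q (\<lambda>s. if s = 0 then character_fun p q k else (\<lambda>\<xi>. 0))"

definition ucan :: "nat \<Rightarrow> nat \<Rightarrow> int \<times> int \<Rightarrow> crossed_elt" where
  "ucan p q s = conv_embed p q (\<lambda>t. if t = s then character_fun p q 0 else (\<lambda>\<xi>. 0))"

definition fixed_vectors ::
    "nat \<Rightarrow> nat \<Rightarrow> ('h, 'm) hilb_scheme \<Rightarrow> (crossed_elt \<Rightarrow> 'h \<Rightarrow> 'h) \<Rightarrow> 'h set" where
  "fixed_vectors p q H \<pi> = {x \<in> carr H. \<forall>s. \<pi> (ucan p q s) x = x}"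


section \<open>Invariant measures on the circle\<close>

definition circle_prob :: "complex measure \<Rightarrow> bool" where
  "circle_prob \<mu> \<longleftrightarrow> prob_space \<mu> \<and> sets \<mu> = sets (restrict_space borel (sphere 0 1))"

definition times_invariant :: "nat \<Rightarrow> complex measure \<Rightarrow> bool" where
  "times_invariant p \<mu> \<longleftrightarrow>
     (\<forall>E\<in>sets \<mu>. emeasure \<mu> {z \<in> space \<mu>. z ^ p \<in> E} = emeasure \<mu> E)"

definition times_ergodic :: "nat \<Rightarrow> nat \<Rightarrow> complex measure \<Rightarrow> bool" where
  "times_ergodic p q \<mu> \<longleftrightarrow>
     (\<forall>E\<in>sets \<mu>. {z \<in> space \<mu>. z ^ p \<in> E} = E \<and> {z \<in> space \<mu>. z ^ q \<in> E} = E \<longrightarrow>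
        measure \<mu> E \<in> {0, 1})"

definition msupport :: "complex measure \<Rightarrow> complex set" where
  "msupport \<mu> = {x \<in> space \<mu>. \<forall>U. open U \<and> x \<in> U \<longrightarrow> emeasure \<mu> (U \<inter> space \<mu>) > 0}"

definition l2_funs :: "complex measure \<Rightarrow> (complex \<Rightarrow> complex) set" where
  "l2_funs \<mu> = {f \<in> borel_measurable \<mu>. integrable \<mu> (\<lambda>z. (cmod (f z))\<^sup>2)}"

definition ae_rel :: "complex measure \<Rightarrow> ((complex \<Rightarrow> complex) \<times> (complex \<Rightarrow> complex)) set" where
  "ae_rel \<mu> = {(f, g). f \<in> l2_funs \<mu> \<and> g \<in> l2_funs \<mu> \<and> (AE z in \<mu>. f z = g z)}"

definition ae_class :: "complex measure \<Rightarrow> (complex \<Rightarrow> complex) \<Rightarrow> (complex \<Rightarrow> complex) set" where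
  "ae_class \<mu> f = ae_rel \<mu> `` {f}"

definition L2 :: "complex measure \<Rightarrow> (complex \<Rightarrow> complex) set hilb" where
  "L2 \<mu> = \<lparr>
     carr = l2_funs \<mu> // ae_rel \<mu>,
     vzero = ae_class \<mu> (\<lambda>z. 0),
     vadd = (\<lambda>C D. ae_class \<mu> (\<lambda>z. rep_of C z + rep_of D z)),
     vscale = (\<lambda>c C. ae_class \<mu> (\<lambda>z. c * rep_of C z)),
     ip = (\<lambda>C D. integral\<^sup>L \<mu> (\<lambda>z. rep_of C z * cnj (rep_of D z)))\<rparr>"

text \<open>
  \<open>\<rho>\<close> is the representation \<open>\<pi>\<^sub>\<mu>\<close>: for finitely supported invariant \<open>\<mu>\<close> these conditions determine
  \<open>\<rho>\<close> on the crossed product.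
\<close>

definition measure_rep ::
    "nat \<Rightarrow> nat \<Rightarrow> complex measure \<Rightarrow>
     (crossed_elt \<Rightarrow> (complex \<Rightarrow> complex) set \<Rightarrow> (complex \<Rightarrow> complex) set) \<Rightarrow> bool" where
  "measure_rep p q \<mu> \<rho> \<longleftrightarrow> star_rep (crossed_product p q) (L2 \<mu>) \<rho> \<and>
     (\<forall>f\<in>l2_funs \<mu>.
        \<rho> (ucan p q (1, 0)) (ae_class \<mu> f) = ae_class \<mu> (\<lambda>z. f (z ^ p)) \<and>
        \<rho> (ucan p q (0, 1)) (ae_class \<mu> f) = ae_class \<mu> (\<lambda>z. f (z ^ q)) \<and>
        \<rho> (zpow p q 1) (ae_class \<mu> f) = ae_class \<mu> (\<lambda>z. z * f z))"

definition induced_by ::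
    "nat \<Rightarrow> nat \<Rightarrow> ('h, 'm) hilb_scheme \<Rightarrow> (crossed_elt \<Rightarrow> 'h \<Rightarrow> 'h) \<Rightarrow> complex measure \<Rightarrow> bool" where
  "induced_by p q H \<pi> \<mu> \<longleftrightarrow>
     (\<exists>\<rho>. measure_rep p q \<mu> \<rho> \<and> unitarily_equivalent (crossed_product p q) H \<pi> (L2 \<mu>) \<rho>)"

end

theory Submission
  imports Defs
begin

text \<open>
  A finitely supported ergodic \<open>\<mu>\<close> lives on a finite set of roots of unity which both power maps
  permute, so the invariant vectors of \<open>L\<^sup>2(\<mu>)\<close> are the constants, and an operator in the commutant,
  which sends \<open>1\<close> to a multiple of \<open>1\<close>, is scalar because polynomials in \<open>z\<close> exhaust \<open>L\<^sup>2(\<mu>)\<close>.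

  Conversely, let \<open>x\<close> be an invariant unit vector with \<open>\<pi>(z\<^sup>n) x = x\<close>, and split \<open>x\<close> into the
  eigenvectors \<open>x\<^sub>w\<close> of \<open>\<pi>(z\<^sup>1)\<close>, \<open>w\<close> ranging over the \<open>n\<close>-th roots of unity.  The unitary
  \<open>\<pi>(u\<^bsub>(1,0)\<^esub>)\<close> sends \<open>x\<^sub>w\<close> to the sum of the \<open>x\<^sub>v\<close> with \<open>v\<^sup>p = w\<close>, so \<open>\<mu>{w} = \<parallel>x\<^sub>w\<parallel>\<^sup>2\<close> is an
  invariant measure.  For every invariant set \<open>B\<close> of atoms the projection onto the span of the
  \<open>x\<^sub>w\<close>, \<open>w \<in> B\<close>, lies in the commutant, hence is \<open>0\<close> or \<open>1\<close>: this gives ergodicity and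
  \<open>H \<cong> L\<^sup>2(\<mu>)\<close>.  That commuting with the generators suffices for lying in the commutant rests on the
  Stone-Weierstrass theorem and on the automatic continuity of *-representations of a completion.
\<close>

section \<open>Geometry of Hilbert spaces\<close>

text \<open>\<open>star_rep\<close> demands no continuity, and \<open>full_norm\<close> ranges only
  over Hilbert spaces with carrier in \<open>nat \<Rightarrow> complex\<close>, so by definition it
  does not bound a representation on a space of another type. Both gaps are closed by producing
  positivity inside the algebra. A function f of sup norm at most c acts with norm at most c because
  c^2 - f* f has the form g* g with g continuous. A small element a of the completion acts as a
  contraction because 1 - a* a has the form (1 - b)* (1 - b), with b the class of one explicit
  Cauchy sequence. The factor 2 lost in the resulting bound is harmless: what counts is that small
  elements act by small operators.

  Representations may be non-unital. Irreducibility repairs this: \<open>U 0\<close> lies in the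
  commutant and fixes a nonzero vector, so it is the identity.

  For an n-periodic vector the spectral theorem becomes the discrete Fourier transform on Z/n. A
  priori a power map merges eigenvalues; invariance of the masses makes it surjective on the finite
  set of eigenvalues that occur, hence a permutation, and then the unitaries merely permute the
  eigenvectors.\<close>

context hilbert_space
begin

lemma ip_add_right:
  assumes "x \<in> carr H" "y \<in> carr H" "z \<in> carr H"
  shows "ip H z (vadd H x y) = ip H z x + ip H z y"
  by (metis assms add_closed complex_cnj_add ip_add ip_commute)

lemma ip_scale_right:
  assumes "x \<in> carr H" "y \<in> carr H"
  shows "ip H y (vscale H c x) = cnj c * ip H y x"
  by (metis assms scale_closed complex_cnj_mult ip_scale ip_commute)

lemma vdiff_closed: "x \<in> carr H \<Longrightarrow> y \<in> carr H \<Longrightarrow> vdiff H x y \<in> carr H"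
  by (simp add: vdiff_def add_closed scale_closed)

lemma ip_vdiff:
  assumes "x \<in> carr H" "y \<in> carr H" "z \<in> carr H"
  shows "ip H (vdiff H x y) z = ip H x z - ip H y z"
  using assms by (simp add: vdiff_def ip_add ip_scale scale_closed)

lemma ip_vdiff_right:
  assumes "x \<in> carr H" "y \<in> carr H" "z \<in> carr H"
  shows "ip H z (vdiff H x y) = ip H z x - ip H z y"
  using assms by (simp add: vdiff_def ip_add_right ip_scale_right scale_closed)

lemma scale_zero: "x \<in> carr H \<Longrightarrow> vscale H 0 x = vzero H"
  using scale_add_left[of x 1 "-1"] by (simp add: scale_one add_neg)

lemma ip_zero: "x \<in> carr H \<Longrightarrow> ip H (vzero H) x = 0"
  using ip_scale[of x x 0] by (simp add: scale_zero)

lemma ip_zero_right: "x \<in> carr H \<Longrightarrow> ip H x (vzero H) = 0"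
  using ip_scale_right[of x x 0] by (simp add: scale_zero)

lemma vdiff_eq_zero:
  assumes "x \<in> carr H" "y \<in> carr H" "vdiff H x y = vzero H"
  shows "x = y"
proof -
  have c: "vscale H (-1) y \<in> carr H" using assms by (simp add: scale_closed)
  have "vadd H (vadd H x (vscale H (-1) y)) y = vadd H x (vadd H (vscale H (-1) y) y)"
    using assms c by (intro add_assoc)
  also have "vadd H (vscale H (-1) y) y = vzero H"
    using add_comm[OF c assms(2)] add_neg[OF assms(2)] by simp
  finally have "vadd H (vzero H) y = x"
    using assms by (simp add: vdiff_def add_zero)
  moreover have "vadd H (vzero H) y = y"
    using add_comm[OF zero_closed assms(2)] add_zero[OF assms(2)] by simp
  ultimately show ?thesis by simp
qed

text \<open>The difference of x and y is orthogonal to itself, hence zero. Identities involving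
  \<open>vsum\<close>, adjoints and projections are reduced to complex numbers in this way.\<close>

lemma vec_eqI:
  assumes "x \<in> carr H" "y \<in> carr H" "\<And>v. v \<in> carr H \<Longrightarrow> ip H x v = ip H y v"
  shows "x = y"
proof (rule vdiff_eq_zero[OF assms(1,2)], rule ip_definite)
  show "vdiff H x y \<in> carr H" using assms by (simp add: vdiff_closed)
  then show "ip H (vdiff H x y) (vdiff H x y) = 0"
    using assms by (simp add: ip_vdiff)
qed

lemma Im_ip_self: "x \<in> carr H \<Longrightarrow> Im (ip H x x) = 0"
  using ip_commute[of x x] by (simp add: complex_eq_iff)

lemma hnorm_sq: "x \<in> carr H \<Longrightarrow> (hnorm H x)\<^sup>2 = Re (ip H x x)"
  by (simp add: hnorm_def ip_nonneg)

lemma ip_self: "x \<in> carr H \<Longrightarrow> ip H x x = of_real ((hnorm H x)\<^sup>2)"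
  by (simp add: hnorm_sq complex_eq_iff Im_ip_self)

lemma hnorm_nonneg: "x \<in> carr H \<Longrightarrow> 0 \<le> hnorm H x"
  by (simp add: hnorm_def ip_nonneg)

lemma hnorm_eq_zero: "x \<in> carr H \<Longrightarrow> hnorm H x = 0 \<longleftrightarrow> x = vzero H"
  using ip_self[of x] ip_definite[of x] ip_zero[of x] by auto

lemma hnorm_zero: "hnorm H (vzero H) = 0"
  using hnorm_eq_zero zero_closed by blast

lemma hnorm_scale: "x \<in> carr H \<Longrightarrow> hnorm H (vscale H c x) = cmod c * hnorm H x"
proof -
  assume x: "x \<in> carr H"
  have "of_real ((hnorm H (vscale H c x))\<^sup>2) = c * cnj c * ip H x x"
    using x by (simp add: ip_self[symmetric] ip_scale ip_scale_right scale_closed del: of_real_power)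
  also have "\<dots> = of_real ((cmod c * hnorm H x)\<^sup>2)"
    using x by (simp add: ip_self complex_norm_square[symmetric] power_mult_distrib)
  finally have "(hnorm H (vscale H c x))\<^sup>2 = (cmod c * hnorm H x)\<^sup>2"
    by (simp only: of_real_eq_iff)
  then show ?thesis
    using x by (simp add: hnorm_nonneg scale_closed)
qed

lemma cauchy_schwarz:
  assumes "x \<in> carr H" "y \<in> carr H"
  shows "cmod (ip H x y) \<le> hnorm H x * hnorm H y"
proof (cases "y = vzero H")
  case True
  then show ?thesis using assms by (simp add: ip_zero_right hnorm_zero)
next
  case False
  define s where "s = (hnorm H y)\<^sup>2"
  have s: "s > 0" using False assms by (simp add: s_def hnorm_eq_zero)
  \<comment> \<open>\<open>c\<close> is the coefficient of the orthogonal projection of x onto y, so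
    the residual \<open>d\<close> is orthogonal to y and the claim is 0 \<le>
    \<open>ip H d d\<close>.\<close>
  define c where "c = ip H x y / of_real s"
  define d where "d = vdiff H x (vscale H c y)"
  have d: "d \<in> carr H" using assms by (simp add: d_def vdiff_closed scale_closed)
  have cs: "c * of_real s = ip H x y" using s by (simp add: c_def)
  have yy: "ip H y y = of_real s" using assms by (simp add: ip_self s_def)
  have "ip H d y = 0" using assms by (simp add: d_def ip_vdiff ip_scale scale_closed yy cs)
  moreover have "ip H d d = ip H d x - cnj c * ip H d y"
    using ip_vdiff_right[OF assms(1) scale_closed[OF assms(2), of c] d]
    by (simp add: d_def[symmetric] ip_scale_right[OF assms(2) d])
  ultimately have "ip H d d = ip H d x"
    by simp
  also have "\<dots> = ip H x x - c * cnj (ip H x y)"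
    using assms by (simp add: d_def ip_vdiff ip_scale scale_closed ip_commute[of x y])
  also have "\<dots> = of_real ((hnorm H x)\<^sup>2 - (cmod (ip H x y))\<^sup>2 / s)"
    using assms s by (simp add: ip_self c_def complex_norm_square[symmetric])
  finally have "0 \<le> (hnorm H x)\<^sup>2 - (cmod (ip H x y))\<^sup>2 / s"
    using ip_nonneg[OF d] by simp
  then have "(cmod (ip H x y))\<^sup>2 \<le> (hnorm H x * hnorm H y)\<^sup>2"
    using s by (simp add: field_simps s_def power_mult_distrib)
  then show ?thesis
    using assms by (meson hnorm_nonneg mult_nonneg_nonneg power2_le_imp_le)
qed

lemma hnorm_add:
  assumes "x \<in> carr H" "y \<in> carr H"
  shows "hnorm H (vadd H x y) \<le> hnorm H x + hnorm H y"
proof (rule power2_le_imp_le)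
  have "(hnorm H (vadd H x y))\<^sup>2 = Re (ip H x x + ip H y y + (ip H x y + cnj (ip H x y)))"
    using assms by (simp add: hnorm_sq add_closed ip_add ip_add_right ip_commute[of x y])
  also have "\<dots> = (hnorm H x)\<^sup>2 + (hnorm H y)\<^sup>2 + 2 * Re (ip H x y)"
    using assms by (simp add: hnorm_sq)
  also have "\<dots> \<le> (hnorm H x)\<^sup>2 + (hnorm H y)\<^sup>2 + 2 * (hnorm H x * hnorm H y)"
    using cauchy_schwarz[OF assms] complex_Re_le_cmod[of "ip H x y"] by linarith
  finally show "(hnorm H (vadd H x y))\<^sup>2 \<le> (hnorm H x + hnorm H y)\<^sup>2"
    by (simp add: power2_sum)
  show "0 \<le> hnorm H x + hnorm H y" using assms by (simp add: hnorm_nonneg)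
qed

text \<open>A finite sum is pinned down by its inner products: no order of summation enters, and
  computing with it means computing with sums of complex numbers. Uniqueness of the described vector
  is \<open>vec_eqI\<close>.\<close>

definition vsum :: "('i \<Rightarrow> 'a) \<Rightarrow> 'i set \<Rightarrow> 'a" where
  "vsum f I = (THE y. y \<in> carr H \<and> (\<forall>v\<in>carr H. ip H y v = (\<Sum>i\<in>I. ip H (f i) v)))"

lemma vsum:
  assumes "finite I" "\<And>i. i \<in> I \<Longrightarrow> f i \<in> carr H"
  shows "vsum f I \<in> carr H" and "v \<in> carr H \<Longrightarrow> ip H (vsum f I) v = (\<Sum>i\<in>I. ip H (f i) v)"
proof -
  have "\<exists>y. y \<in> carr H \<and> (\<forall>v\<in>carr H. ip H y v = (\<Sum>i\<in>I. ip H (f i) v))"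
    using assms
  proof (induction I rule: finite_induct)
    case empty
    show ?case using zero_closed ip_zero by auto
  next
    case (insert i I)
    then obtain y where "y \<in> carr H" "\<forall>v\<in>carr H. ip H y v = (\<Sum>i\<in>I. ip H (f i) v)"
      by auto
    with insert show ?case
      by (intro exI[of _ "vadd H (f i) y"]) (auto simp: add_closed ip_add)
  qed
  then have "\<exists>!y. y \<in> carr H \<and> (\<forall>v\<in>carr H. ip H y v = (\<Sum>i\<in>I. ip H (f i) v))"
    by (auto intro: vec_eqI)
  from theI'[OF this] show "vsum f I \<in> carr H"
    and "v \<in> carr H \<Longrightarrow> ip H (vsum f I) v = (\<Sum>i\<in>I. ip H (f i) v)"
    unfolding vsum_def[symmetric] by auto
qed

end

section \<open>Bounded operators and *-representations\<close>

lemma bounded_opsD: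
  assumes "T \<in> bounded_ops H"
  shows "x \<in> carr H \<Longrightarrow> T x \<in> carr H"
    and "x \<in> carr H \<Longrightarrow> y \<in> carr H \<Longrightarrow> T (vadd H x y) = vadd H (T x) (T y)"
    and "x \<in> carr H \<Longrightarrow> T (vscale H c x) = vscale H c (T x)"
  using assms by (auto simp: bounded_ops_def)

lemma (in hilbert_space) bounded_ops_bound:
  assumes "T \<in> bounded_ops H"
  obtains K where "K \<ge> 0" "\<And>x. x \<in> carr H \<Longrightarrow> hnorm H (T x) \<le> K * hnorm H x"
proof -
  obtain K where K: "\<forall>x\<in>carr H. hnorm H (T x) \<le> K * hnorm H x"
    using assms by (auto simp: bounded_ops_def)
  show ?thesis
  proof (rule that[of "max K 0"])
    fix x assume x: "x \<in> carr H"
    have "K * hnorm H x \<le> max K 0 * hnorm H x"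
      using hnorm_nonneg[OF x] by (intro mult_right_mono) auto
    with K x show "hnorm H (T x) \<le> max K 0 * hnorm H x" by force
  qed simp
qed

context hilbert_space
begin

lemma op_norm_upper:
  assumes "T \<in> bounded_ops H" "x \<in> carr H"
  shows "hnorm H (T x) \<le> op_norm H T * hnorm H x"
proof (cases "x = vzero H")
  case True
  then have "T x = vzero H"
    using bounded_opsD(3)[OF assms, of 0] assms
    by (simp add: scale_zero bounded_opsD(1)[OF assms(1)])
  then show ?thesis
    using True hnorm_eq_zero[OF zero_closed] by simp
next
  case False
  define r where "r = hnorm H x"
  have r: "r > 0" using False assms hnorm_nonneg hnorm_eq_zero by (force simp: r_def less_le)
  obtain K where K: "K \<ge> 0" "\<And>x. x \<in> carr H \<Longrightarrow> hnorm H (T x) \<le> K * hnorm H x"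
    using bounded_ops_bound[OF assms(1)] by blast
  have bdd: "bdd_above {hnorm H (T x) | x. x \<in> carr H \<and> hnorm H x \<le> 1}"
  proof (rule bdd_aboveI[of _ K], clarify)
    fix x assume x: "x \<in> carr H" "hnorm H x \<le> 1"
    have "hnorm H (T x) \<le> K * hnorm H x" using K x by simp
    also have "\<dots> \<le> K" using mult_left_mono[OF x(2) K(1)] by simp
    finally show "hnorm H (T x) \<le> K" .
  qed
  define e where "e = vscale H (of_real (1 / r)) x"
  have e: "e \<in> carr H" "hnorm H e = 1"
    using assms r by (simp_all add: e_def scale_closed hnorm_scale r_def norm_divide)
  have "hnorm H (T e) \<le> op_norm H T"
    unfolding op_norm_def using e by (intro cSup_upper[OF _ bdd]) auto
  moreover have "hnorm H (T e) = hnorm H (T x) / r"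
    using assms r by (simp add: e_def bounded_opsD[OF assms(1)] hnorm_scale norm_divide)
  ultimately show ?thesis using r by (simp add: field_simps r_def)
qed

lemma op_norm_least:
  assumes "0 \<le> C" "\<And>x. x \<in> carr H \<Longrightarrow> hnorm H (T x) \<le> C * hnorm H x"
  shows "op_norm H T \<le> C"
  unfolding op_norm_def
proof (rule cSup_least)
  show "{hnorm H (T x) |x. x \<in> carr H \<and> hnorm H x \<le> 1} \<noteq> {}"
    using zero_closed hnorm_eq_zero[OF zero_closed] by (auto intro!: exI[of _ "vzero H"])
next
  fix r assume "r \<in> {hnorm H (T x) |x. x \<in> carr H \<and> hnorm H x \<le> 1}"
  then obtain x where x: "r = hnorm H (T x)" "x \<in> carr H" "hnorm H x \<le> 1" by auto
  have "r \<le> C * hnorm H x" using assms x by simp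
  also have "\<dots> \<le> C" using mult_left_mono[OF x(3) assms(1)] by simp
  finally show "r \<le> C" .
qed

end

lemma star_repD:
  assumes "star_rep A H \<pi>"
  shows "a \<in> carr A \<Longrightarrow> \<pi> a \<in> bounded_ops H"
    and "a \<in> carr A \<Longrightarrow> x \<in> carr H \<Longrightarrow> \<pi> a x \<in> carr H"
    and "a \<in> carr A \<Longrightarrow> b \<in> carr A \<Longrightarrow> x \<in> carr H \<Longrightarrow> \<pi> (vadd A a b) x = vadd H (\<pi> a x) (\<pi> b x)"
    and "a \<in> carr A \<Longrightarrow> x \<in> carr H \<Longrightarrow> \<pi> (vscale A c a) x = vscale H c (\<pi> a x)"
    and "a \<in> carr A \<Longrightarrow> b \<in> carr A \<Longrightarrow> x \<in> carr H \<Longrightarrow> \<pi> (amult A a b) x = \<pi> a (\<pi> b x)"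
    and "a \<in> carr A \<Longrightarrow> x \<in> carr H \<Longrightarrow> y \<in> carr H \<Longrightarrow> ip H (\<pi> a x) y = ip H x (\<pi> (astar A a) y)"
  using assms by (auto simp: star_rep_def bounded_ops_def)

text \<open>The C*-identity, vector by vector. Through it \<open>rep_contractive\<close>,
  \<open>CC_fun_le\<close> and \<open>CC_mono_le\<close> turn algebraic identities between elements
  a* a into equations between squared norms.\<close>

lemma (in hilbert_space) star_rep_norm_sq:
  assumes "star_rep A H \<pi>" "a \<in> carr A" "astar A a \<in> carr A" "y \<in> carr H"
  shows "ip H (\<pi> (amult A (astar A a) a) y) y = of_real ((hnorm H (\<pi> a y))\<^sup>2)"
proof -
  note rep = star_repD[OF assms(1)]
  have "ip H (\<pi> (amult A (astar A a) a) y) y = cnj (ip H y (\<pi> (astar A a) (\<pi> a y)))"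
    using assms rep(2) by (subst ip_commute[symmetric]) (simp_all add: rep(5))
  also have "\<dots> = cnj (ip H (\<pi> a y) (\<pi> a y))"
    using assms by (simp add: rep(6)[OF assms(2,4)] rep(2))
  finally show ?thesis using assms by (simp add: ip_self rep(2) del: of_real_power)
qed

section \<open>Completions of seminormed *-algebras and automatic continuity\<close>

text \<open>Besides closure, \<open>add_diff\<close> and \<open>diff_self\<close>, the algebra laws
  enter only as inequalities for the distance \<open>N (vdiff A x y)\<close>, which is what the
  definition of \<open>completion\<close> refers to.\<close>

locale seminormed_star_alg =
  fixes A :: "('a, 'm) star_alg_scheme" and N :: "'a \<Rightarrow> real"
  assumes zero_closed: "vzero A \<in> carr A"
    and add_closed: "x \<in> carr A \<Longrightarrow> y \<in> carr A \<Longrightarrow> vadd A x y \<in> carr A"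
    and scale_closed: "x \<in> carr A \<Longrightarrow> vscale A c x \<in> carr A"
    and mult_closed: "x \<in> carr A \<Longrightarrow> y \<in> carr A \<Longrightarrow> amult A x y \<in> carr A"
    and star_closed: "x \<in> carr A \<Longrightarrow> astar A x \<in> carr A"
    and add_diff: "x \<in> carr A \<Longrightarrow> y \<in> carr A \<Longrightarrow> vadd A y (vdiff A x y) = x"
    and N_nonneg: "x \<in> carr A \<Longrightarrow> 0 \<le> N x"
    and N_zero: "N (vzero A) = 0"
    and N_add: "x \<in> carr A \<Longrightarrow> y \<in> carr A \<Longrightarrow> N (vadd A x y) \<le> N x + N y"
    and N_scale: "x \<in> carr A \<Longrightarrow> N (vscale A c x) \<le> cmod c * N x"
    and N_mult: "x \<in> carr A \<Longrightarrow> y \<in> carr A \<Longrightarrow> N (amult A x y) \<le> N x * N y"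
    and N_star: "x \<in> carr A \<Longrightarrow> N (astar A x) \<le> N x"
    and diff_self: "x \<in> carr A \<Longrightarrow> vdiff A x x = vzero A"
    and diff_sym: "x \<in> carr A \<Longrightarrow> y \<in> carr A \<Longrightarrow> N (vdiff A x y) = N (vdiff A y x)"
    and diff_tri: "x \<in> carr A \<Longrightarrow> y \<in> carr A \<Longrightarrow> z \<in> carr A \<Longrightarrow>
          N (vdiff A x z) \<le> N (vdiff A x y) + N (vdiff A y z)"
    and diff_add: "x \<in> carr A \<Longrightarrow> y \<in> carr A \<Longrightarrow> x' \<in> carr A \<Longrightarrow> y' \<in> carr A \<Longrightarrow>
          N (vdiff A (vadd A x y) (vadd A x' y')) \<le> N (vdiff A x x') + N (vdiff A y y')"
    and diff_scale: "x \<in> carr A \<Longrightarrow> y \<in> carr A \<Longrightarrow>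
          N (vdiff A (vscale A c x) (vscale A c y)) \<le> cmod c * N (vdiff A x y)"
    and diff_mult: "x \<in> carr A \<Longrightarrow> y \<in> carr A \<Longrightarrow> x' \<in> carr A \<Longrightarrow> y' \<in> carr A \<Longrightarrow>
          N (vdiff A (amult A x y) (amult A x' y')) \<le> N x * N (vdiff A y y') + N (vdiff A x x') * N y'"
    and diff_star: "x \<in> carr A \<Longrightarrow> y \<in> carr A \<Longrightarrow>
          N (vdiff A (astar A x) (astar A y)) \<le> N (vdiff A x y)"
begin

abbreviation d :: "'a \<Rightarrow> 'a \<Rightarrow> real" where "d x y \<equiv> N (vdiff A x y)"
abbreviation CS :: "(nat \<Rightarrow> 'a) set" where "CS \<equiv> cauchy_seqs A N"
abbreviation cls :: "(nat \<Rightarrow> 'a) \<Rightarrow> (nat \<Rightarrow> 'a) set" where "cls \<equiv> seq_class A N"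
abbreviation CA :: "(nat \<Rightarrow> 'a) set star_alg" where "CA \<equiv> completion A N"

lemma vdiff_closed: "x \<in> carr A \<Longrightarrow> y \<in> carr A \<Longrightarrow> vdiff A x y \<in> carr A"
  by (simp add: vdiff_def add_closed scale_closed)

lemma d_nonneg: "x \<in> carr A \<Longrightarrow> y \<in> carr A \<Longrightarrow> 0 \<le> d x y"
  by (simp add: vdiff_closed N_nonneg)

lemma d_le_N: "x \<in> carr A \<Longrightarrow> y \<in> carr A \<Longrightarrow> d x y \<le> N x + N y"
  using N_add[of x "vscale A (-1) y"] N_scale[of y "-1"] by (simp add: vdiff_def scale_closed)

lemma N_le: "x \<in> carr A \<Longrightarrow> y \<in> carr A \<Longrightarrow> N x \<le> N y + d x y"
  using N_add[of y "vdiff A x y"] by (simp add: add_diff vdiff_closed)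

lemma CS_closed: "X \<in> CS \<Longrightarrow> X n \<in> carr A"
  by (simp add: cauchy_seqs_def)

lemma CS_D: "X \<in> CS \<Longrightarrow> e > 0 \<Longrightarrow> \<exists>M. \<forall>m\<ge>M. \<forall>n\<ge>M. d (X m) (X n) < e"
  by (simp add: cauchy_seqs_def)

lemma CS_I:
  assumes "\<And>n. X n \<in> carr A" "\<And>e. e > 0 \<Longrightarrow> \<exists>M. \<forall>m\<ge>M. \<forall>n\<ge>M. d (X m) (X n) < e"
  shows "X \<in> CS"
  using assms by (simp add: cauchy_seqs_def)

text \<open>One criterion for sums, scalings, adjoints and products: each of them satisfies a
  Lipschitz estimate in terms of the distances of its arguments.\<close>

lemma CS_dominated:
  assumes "\<And>n. Z n \<in> carr A" "X \<in> CS" "Y \<in> CS" "0 \<le> a" "0 \<le> b"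
    and "\<And>m n. d (Z m) (Z n) \<le> a * d (X m) (X n) + b * d (Y m) (Y n)"
  shows "Z \<in> CS"
proof (rule CS_I[OF assms(1)])
  fix e :: real assume e: "e > 0"
  \<comment> \<open>The summand 1 keeps the denominator positive when a = b = 0.\<close>
  define r where "r = e / (2 * (a + b + 1))"
  have r: "r > 0" using e assms by (simp add: r_def)
  obtain M1 where M1: "\<forall>m\<ge>M1. \<forall>n\<ge>M1. d (X m) (X n) < r"
    using CS_D[OF assms(2) r] by blast
  obtain M2 where M2: "\<forall>m\<ge>M2. \<forall>n\<ge>M2. d (Y m) (Y n) < r"
    using CS_D[OF assms(3) r] by blast
  have "d (Z m) (Z n) < e" if "m \<ge> max M1 M2" "n \<ge> max M1 M2" for m n
  proof -
    have "d (Z m) (Z n) \<le> a * d (X m) (X n) + b * d (Y m) (Y n)" by (rule assms)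
    also have "\<dots> \<le> a * r + b * r"
      using M1 M2 that assms by (intro add_mono mult_left_mono) (auto intro: less_imp_le)
    also have "\<dots> < 2 * (a + b + 1) * r"
      using r assms by (simp add: algebra_simps add_pos_nonneg add_strict_increasing)
    also have "\<dots> = e" using assms by (simp add: r_def)
    finally show ?thesis .
  qed
  then show "\<exists>M. \<forall>m\<ge>M. \<forall>n\<ge>M. d (Z m) (Z n) < e" by blast
qed

text \<open>Multiplication is Lipschitz only on bounded sets; these bounds supply the constants in
  \<open>CS_mult\<close> and \<open>cls_mult\<close>.\<close>

lemma CS_bounded:
  assumes "X \<in> CS"
  obtains C where "C > 0" "\<And>n. N (X n) \<le> C"
proof -
  obtain M where M: "\<forall>m\<ge>M. \<forall>n\<ge>M. d (X m) (X n) < 1"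
    using CS_D[OF assms, of 1] by auto
  define C where "C = 1 + (\<Sum>n\<le>M. N (X n))"
  have *: "N (X n) \<le> (\<Sum>n\<le>M. N (X n))" if "n \<le> M" for n
    using that by (intro member_le_sum) (auto simp: N_nonneg CS_closed[OF assms])
  have "N (X n) \<le> C" for n
  proof (cases "n \<le> M")
    case True
    then show ?thesis using *[of n] by (simp add: C_def)
  next
    case False
    then have "N (X n) \<le> N (X M) + 1"
      using N_le[OF CS_closed[OF assms, of n] CS_closed[OF assms, of M]] M
      by (smt (verit) nle_le order_refl)
    then show ?thesis using *[of M] by (simp add: C_def)
  qed
  moreover have "C > 0"
    using sum_nonneg[of "{..M}" "\<lambda>n. N (X n)"] by (simp add: C_def N_nonneg CS_closed[OF assms])
  ultimately show ?thesis using that by blast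
qed

lemma CS_const: "x \<in> carr A \<Longrightarrow> (\<lambda>n. x) \<in> CS"
  by (rule CS_I) (auto simp: diff_self N_zero)

lemma CS_add: "X \<in> CS \<Longrightarrow> Y \<in> CS \<Longrightarrow> (\<lambda>n. vadd A (X n) (Y n)) \<in> CS"
  by (rule CS_dominated[of _ X Y 1 1]) (auto simp: add_closed CS_closed intro: diff_add)

lemma CS_scale: "X \<in> CS \<Longrightarrow> (\<lambda>n. vscale A c (X n)) \<in> CS"
  by (rule CS_dominated[of _ X X "cmod c" 0]) (auto simp: scale_closed CS_closed intro: diff_scale)

lemma CS_star: "X \<in> CS \<Longrightarrow> (\<lambda>n. astar A (X n)) \<in> CS"
  by (rule CS_dominated[of _ X X 1 0]) (auto simp: star_closed CS_closed intro: diff_star)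

lemma CS_mult:
  assumes "X \<in> CS" "Y \<in> CS"
  shows "(\<lambda>n. amult A (X n) (Y n)) \<in> CS"
proof -
  obtain C where C: "C > 0" "\<And>n. N (X n) \<le> C" using CS_bounded[OF assms(1)] by blast
  obtain D where D: "D > 0" "\<And>n. N (Y n) \<le> D" using CS_bounded[OF assms(2)] by blast
  note cl = CS_closed[OF assms(1)] CS_closed[OF assms(2)]
  show ?thesis
  proof (rule CS_dominated[of _ X Y D C])
    fix m n
    have "d (amult A (X m) (Y m)) (amult A (X n) (Y n))
        \<le> N (X m) * d (Y m) (Y n) + d (X m) (X n) * N (Y n)"
      by (intro diff_mult cl)
    also have "\<dots> \<le> C * d (Y m) (Y n) + d (X m) (X n) * D"
      using C D by (intro add_mono mult_right_mono mult_left_mono) (auto simp: d_nonneg cl)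
    finally show "d (amult A (X m) (Y m)) (amult A (X n) (Y n)) \<le> D * d (X m) (X n) + C * d (Y m) (Y n)"
      by (simp add: mult.commute)
  qed (simp_all add: assms mult_closed cl less_imp_le C D)
qed

lemma CS_shift: "X \<in> CS \<Longrightarrow> (\<lambda>n. X (n + k)) \<in> CS"
  unfolding cauchy_seqs_def by (auto intro: trans_le_add1) (meson trans_le_add1)

section \<open>Classes of Cauchy sequences and the operations on them\<close>

lemma equiv_null: "equiv CS (null_rel A N)"
proof (rule equivI)
  show "null_rel A N \<subseteq> CS \<times> CS"
    by (auto simp: null_rel_def)
  show "refl_on CS (null_rel A N)"
    by (auto simp: refl_on_def null_rel_def diff_self N_zero CS_closed)
  show "sym (null_rel A N)"
    by (auto simp: sym_def null_rel_def) (subst diff_sym; simp add: CS_closed)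
  show "trans (null_rel A N)"
  proof (rule transI)
    fix X Y Z assume *: "(X, Y) \<in> null_rel A N" "(Y, Z) \<in> null_rel A N"
    then have cs: "X \<in> CS" "Y \<in> CS" "Z \<in> CS" by (auto simp: null_rel_def)
    have "(\<lambda>n. d (X n) (Y n) + d (Y n) (Z n)) \<longlonglongrightarrow> 0"
      using * tendsto_add[of _ 0 _ _ 0] by (force simp: null_rel_def)
    then have "(\<lambda>n. d (X n) (Z n)) \<longlonglongrightarrow> 0"
    proof (rule Lim_null_comparison[rotated])
      show "\<forall>\<^sub>F n in sequentially. norm (d (X n) (Z n)) \<le> d (X n) (Y n) + d (Y n) (Z n)"
        using cs by (auto intro!: always_eventually diff_tri simp: d_nonneg CS_closed)
    qed
    with cs show "(X, Z) \<in> null_rel A N" by (simp add: null_rel_def)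
  qed
qed

lemma cls_eqI: "(X, Y) \<in> null_rel A N \<Longrightarrow> cls X = cls Y"
  unfolding seq_class_def by (rule equiv_class_eq[OF equiv_null])

text \<open>Well-definedness of the operations: \<open>completion\<close> computes with the
  arbitrary representative chosen by \<open>rep_of\<close>, and this lemma replaces it by a given
  one.\<close>

lemma cls_dominated:
  assumes "Z \<in> CS" "Z' \<in> CS" "(X, X') \<in> null_rel A N" "(Y, Y') \<in> null_rel A N"
    and "\<And>n. d (Z n) (Z' n) \<le> a * d (X n) (X' n) + b * d (Y n) (Y' n)"
  shows "cls Z = cls Z'"
proof (rule cls_eqI)
  have "(\<lambda>n. a * d (X n) (X' n) + b * d (Y n) (Y' n)) \<longlonglongrightarrow> a * 0 + b * 0"
    using assms(3,4) by (intro tendsto_intros) (auto simp: null_rel_def)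
  then have "(\<lambda>n. a * d (X n) (X' n) + b * d (Y n) (Y' n)) \<longlonglongrightarrow> 0" by simp
  then have "(\<lambda>n. d (Z n) (Z' n)) \<longlonglongrightarrow> 0"
    by (rule Lim_null_comparison[rotated])
      (use assms in \<open>auto intro!: always_eventually simp: d_nonneg CS_closed\<close>)
  then show "(Z, Z') \<in> null_rel A N" using assms by (simp add: null_rel_def)
qed

lemma rep_of_cls: 
  assumes "X \<in> CS"
  shows "(rep_of (cls X), X) \<in> null_rel A N" and "rep_of (cls X) \<in> CS"
proof -
  have "X \<in> cls X"
    unfolding seq_class_def by (rule equiv_class_self[OF equiv_null assms])
  then have "rep_of (cls X) \<in> cls X"
    unfolding rep_of_def by (rule someI[of "\<lambda>Y. Y \<in> cls X"])
  then have "(X, rep_of (cls X)) \<in> null_rel A N"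
    by (simp add: seq_class_def)
  then show "(rep_of (cls X), X) \<in> null_rel A N" "rep_of (cls X) \<in> CS"
    using equiv_null by (auto simp: equiv_def sym_def null_rel_def)
qed

lemma carr_CA: "carr CA = cls ` CS"
  by (auto simp: completion_def quotient_def seq_class_def)

lemma cls_closed: "X \<in> CS \<Longrightarrow> cls X \<in> carr CA"
  by (simp add: carr_CA)

lemma cls_add:
  assumes "X \<in> CS" "Y \<in> CS"
  shows "vadd CA (cls X) (cls Y) = cls (\<lambda>n. vadd A (X n) (Y n))"
  unfolding completion_def cspace.simps
  by (rule cls_dominated[of _ _ "rep_of (cls X)" X "rep_of (cls Y)" Y 1 1])
    (auto simp: assms rep_of_cls CS_add CS_closed intro!: diff_add)

lemma cls_scale:
  assumes "X \<in> CS"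
  shows "vscale CA c (cls X) = cls (\<lambda>n. vscale A c (X n))"
  unfolding completion_def cspace.simps
  by (rule cls_dominated[of _ _ "rep_of (cls X)" X "rep_of (cls X)" X "cmod c" 0])
    (auto simp: assms rep_of_cls CS_scale CS_closed intro!: diff_scale)

lemma cls_star:
  assumes "X \<in> CS"
  shows "astar CA (cls X) = cls (\<lambda>n. astar A (X n))"
  unfolding completion_def star_alg.simps
  by (rule cls_dominated[of _ _ "rep_of (cls X)" X "rep_of (cls X)" X 1 0])
    (auto simp: assms rep_of_cls CS_star CS_closed intro!: diff_star)

lemma cls_mult:
  assumes "X \<in> CS" "Y \<in> CS"
  shows "amult CA (cls X) (cls Y) = cls (\<lambda>n. amult A (X n) (Y n))"
proof -
  define X' where "X' = rep_of (cls X)"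
  define Y' where "Y' = rep_of (cls Y)"
  have cs: "X' \<in> CS" "Y' \<in> CS" and nl: "(X', X) \<in> null_rel A N" "(Y', Y) \<in> null_rel A N"
    by (simp_all add: X'_def Y'_def rep_of_cls assms)
  obtain C where C: "C > 0" "\<And>n. N (X' n) \<le> C" using CS_bounded[OF cs(1)] by blast
  obtain D where D: "D > 0" "\<And>n. N (Y n) \<le> D" using CS_bounded[OF assms(2)] by blast
  note cl = CS_closed[OF assms(1)] CS_closed[OF assms(2)] CS_closed[OF cs(1)] CS_closed[OF cs(2)]
  have "cls (\<lambda>n. amult A (X' n) (Y' n)) = cls (\<lambda>n. amult A (X n) (Y n))"
  proof (rule cls_dominated[OF _ _ nl, of _ _ D C])
    fix n
    have "d (amult A (X' n) (Y' n)) (amult A (X n) (Y n))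
        \<le> N (X' n) * d (Y' n) (Y n) + d (X' n) (X n) * N (Y n)"
      by (intro diff_mult cl)
    also have "\<dots> \<le> C * d (Y' n) (Y n) + d (X' n) (X n) * D"
      using C D by (intro add_mono mult_right_mono mult_left_mono) (auto simp: d_nonneg cl)
    finally show "d (amult A (X' n) (Y' n)) (amult A (X n) (Y n))
        \<le> D * d (X' n) (X n) + C * d (Y' n) (Y n)"
      by (simp add: mult.commute)
  qed (simp_all add: CS_mult cs assms)
  then show ?thesis by (simp add: completion_def X'_def Y'_def)
qed

text \<open>This turns the recursion of \<open>half_iter\<close> into a fixed point equation for its
  class, and lets \<open>rep_approx\<close> discard an initial segment.\<close>

lemma cls_shift:
  assumes "X \<in> CS"
  shows "cls (\<lambda>n. X (n + k)) = cls X"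
proof (rule cls_eqI)
  have "(\<lambda>n. d (X (n + k)) (X n)) \<longlonglongrightarrow> 0"
  proof (rule LIMSEQ_I)
    fix r :: real assume "r > 0"
    then obtain M where "\<forall>m\<ge>M. \<forall>n\<ge>M. d (X m) (X n) < r" using CS_D[OF assms] by blast
    then show "\<exists>M. \<forall>n\<ge>M. norm (d (X (n + k)) (X n) - 0) < r"
      by (intro exI[of _ M]) (auto simp: d_nonneg CS_closed[OF assms])
  qed
  then show "((\<lambda>n. X (n + k)), X) \<in> null_rel A N"
    using assms CS_shift by (simp add: null_rel_def)
qed

text \<open>
  The Newton-type iteration \<open>B \<mapsto> (h + B\<^sup>* B) / 2\<close> converges for small \<open>h = a\<^sup>* a\<close>, and its limit \<open>b\<close>
  plays the role of \<open>1 - (1 - h)\<^bsup>1/2\<^esup>\<close>: it yields \<open>\<parallel>y\<parallel>\<^sup>2 - \<parallel>\<pi>(a) y\<parallel>\<^sup>2 = \<parallel>y - \<pi>(b) y\<parallel>\<^sup>2\<close>.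
\<close>

primrec half_iter :: "(nat \<Rightarrow> 'a) \<Rightarrow> nat \<Rightarrow> 'a" where
  "half_iter h 0 = vzero A"
| "half_iter h (Suc n) =
     vscale A (1/2) (vadd A (h n) (amult A (astar A (half_iter h n)) (half_iter h n)))"

text \<open>Step n uses \<open>h n\<close>, so a single sequence follows both the iteration and the
  approximation of its input. The ball of radius 1/2 is preserved since (1/2 + 1/4)/2 < 1/2; on it
  B* B has Lipschitz constant 1/2 + 1/2 = 1, and the halving makes the step a contraction with
  factor 1/2.\<close>

lemma half_iter:
  assumes "h \<in> CS" "\<And>n. N (h n) \<le> 1/2"
  shows "half_iter h \<in> CS"
proof -
  define B where "B = half_iter h"
  note hc = CS_closed[OF assms(1)]
  have cl: "B n \<in> carr A" for n
    unfolding B_def by (induction n) (auto simp: zero_closed scale_closed add_closed mult_closed star_closed hc)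
  have NB: "N (B n) \<le> 1/2" for n
  proof (induction n)
    case 0
    show ?case by (simp add: B_def N_zero)
  next
    case (Suc n)
    have "N (B (Suc n)) \<le> 1/2 * N (vadd A (h n) (amult A (astar A (B n)) (B n)))"
      using N_scale[of "vadd A (h n) (amult A (astar A (B n)) (B n))" "1/2"]
      by (simp add: B_def add_closed mult_closed star_closed hc cl[unfolded B_def])
    also have "\<dots> \<le> 1/2 * (N (h n) + N (astar A (B n)) * N (B n))"
      using N_add[of "h n" "amult A (astar A (B n)) (B n)"] N_mult[of "astar A (B n)" "B n"]
      by (simp add: mult_closed star_closed hc cl)
    also have "\<dots> \<le> 1/2 * (1/2 + 1/2 * (1/2))"
      using Suc assms N_star[OF cl[of n]] N_nonneg[OF cl[of n]]
      by (intro mult_left_mono add_mono mult_mono) auto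
    finally show ?case by simp
  qed
  have step: "d (B (Suc m)) (B (Suc n)) \<le> 1/2 * d (h m) (h n) + 1/2 * d (B m) (B n)" for m n
  proof -
    have "d (B (Suc m)) (B (Suc n)) \<le> 1/2 * d (vadd A (h m) (amult A (astar A (B m)) (B m)))
        (vadd A (h n) (amult A (astar A (B n)) (B n)))"
      using diff_scale[of "vadd A (h m) (amult A (astar A (B m)) (B m))"
          "vadd A (h n) (amult A (astar A (B n)) (B n))" "1/2"]
      by (simp add: B_def add_closed mult_closed star_closed hc cl[unfolded B_def])
    also have "\<dots> \<le> 1/2 * (d (h m) (h n) +
        d (amult A (astar A (B m)) (B m)) (amult A (astar A (B n)) (B n)))"
      by (intro mult_left_mono diff_add) (simp_all add: mult_closed star_closed hc cl)
    also have "\<dots> \<le> 1/2 * (d (h m) (h n) +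
        (N (astar A (B m)) * d (B m) (B n) + d (astar A (B m)) (astar A (B n)) * N (B n)))"
      by (intro mult_left_mono add_left_mono diff_mult) (simp_all add: star_closed cl)
    also have "\<dots> \<le> 1/2 * (d (h m) (h n) + (1/2 * d (B m) (B n) + d (B m) (B n) * (1/2)))"
      using NB[of n] order_trans[OF N_star[OF cl[of m]] NB[of m]]
      by (intro mult_left_mono add_left_mono add_mono mult_mono diff_star)
         (simp_all add: cl N_nonneg d_nonneg)
    finally show ?thesis by (simp add: algebra_simps)
  qed
  show "half_iter h \<in> CS"
    unfolding B_def[symmetric]
  proof (rule CS_I[OF cl])
    fix e :: real assume e: "e > 0"
    then obtain M where M: "\<And>m n. m \<ge> M \<Longrightarrow> n \<ge> M \<Longrightarrow> d (h m) (h n) < e/2"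
      using CS_D[OF assms(1), of "e/2"] by auto
    \<comment> \<open>The recursion t = (e/2)/2 + t/2 has fixed point e/2, which is the part caused
      by \<open>h\<close>; the initial distance, at most 1, is halved k times.\<close>
    have bnd: "\<forall>m\<ge>M+k. \<forall>n\<ge>M+k. d (B m) (B n) \<le> e/2 + (1/2)^k" for k
    proof (induction k)
      case 0
      have "d (B m) (B n) \<le> 1" for m n
        using d_le_N[OF cl[of m] cl[of n]] NB[of m] NB[of n] by simp
      with e have "d (B m) (B n) \<le> e/2 + (1/2)^0" for m n
        by (rule_tac order_trans[of _ 1]) auto
      then show ?case by blast
    next
      case (Suc k)
      show ?case
      proof (intro allI impI)
        fix m n assume mn: "m \<ge> M + Suc k" "n \<ge> M + Suc k"
        then obtain m' n' where m': "m = Suc m'" "n = Suc n'"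
          by (metis add_Suc_right Suc_le_D)
        then have "d (B m) (B n) \<le> 1/2 * d (h m') (h n') + 1/2 * d (B m') (B n')"
          using step by simp
        also have "\<dots> \<le> 1/2 * (e/2) + 1/2 * (e/2 + (1/2)^k)"
          using Suc m' mn by (intro add_mono mult_left_mono less_imp_le[OF M]) auto
        finally show "d (B m) (B n) \<le> e/2 + (1/2)^Suc k" by (simp add: field_simps)
      qed
    qed
    obtain k where k: "(1/2::real)^k < e/2"
      using real_arch_pow_inv[of "e/2" "1/2"] e by auto
    then show "\<exists>M. \<forall>m\<ge>M. \<forall>n\<ge>M. d (B m) (B n) < e"
      using bnd[of k] by (intro exI[of _ "M+k"]) force
  qed
qed

text \<open>Continuity of \<open>\<pi>\<close> is a conclusion here: the bound follows from
  expanding the nonnegative squared norm of y - \<open>\<pi> b y\<close>. The constant 1/2 is the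
  radius on which \<open>half_iter\<close> converges.\<close>

lemma rep_contractive:
  assumes H: "hilbert_space H" and \<pi>: "star_rep CA H \<pi>"
    and X: "X \<in> CS" "\<And>n. N (X n) \<le> 1/2" and y: "y \<in> carr H"
  shows "hnorm H (\<pi> (cls X) y) \<le> hnorm H y"
proof -
  interpret hilbert_space H by fact
  note rep = star_repD[OF \<pi>]
  define h where "h = (\<lambda>n. amult A (astar A (X n)) (X n))"
  define B where "B = half_iter h"
  have hCS: "h \<in> CS" unfolding h_def by (intro CS_mult CS_star X)
  have "N (h n) \<le> 1/2" for n
  proof -
    have "N (h n) \<le> N (astar A (X n)) * N (X n)"
      unfolding h_def by (intro N_mult star_closed CS_closed X)
    also have "\<dots> \<le> 1/2 * (1/2)"
      using X(2)[of n] N_star[OF CS_closed[OF X(1), of n]] N_nonneg[OF CS_closed[OF X(1), of n]]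
      by (intro mult_mono) auto
    finally show ?thesis by simp
  qed
  then have B: "B \<in> CS" unfolding B_def by (rule half_iter[OF hCS])
  define a b where "a = cls X" and "b = cls B"
  have ab: "a \<in> carr CA" "b \<in> carr CA" by (simp_all add: a_def b_def cls_closed X B)
  have star: "astar CA a \<in> carr CA" "astar CA b \<in> carr CA"
    by (simp_all add: a_def b_def cls_star cls_closed CS_star X B)
  have prods: "amult CA (astar CA a) a = cls h"
      "amult CA (astar CA b) b = cls (\<lambda>n. amult A (astar A (B n)) (B n))"
    by (simp_all add: a_def b_def cls_star cls_mult CS_star X B h_def)
  have mc: "amult CA (astar CA a) a \<in> carr CA" "amult CA (astar CA b) b \<in> carr CA"
    unfolding prods by (simp_all add: cls_closed hCS B CS_mult CS_star)
  have sc: "vadd CA (amult CA (astar CA a) a) (amult CA (astar CA b) b) \<in> carr CA"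
    unfolding prods by (simp add: cls_add cls_closed hCS B CS_mult CS_star CS_add)
  \<comment> \<open>The shifted sequence is the right-hand side of the recursion and has the same
    class, so 2b = a* a + b* b holds exactly.\<close>
  have "b = cls (\<lambda>n. B (n + 1))" unfolding b_def by (rule cls_shift[OF B, symmetric])
  also have "\<dots> = vscale CA (1/2) (vadd CA (amult CA (astar CA a) a) (amult CA (astar CA b) b))"
    unfolding prods by (simp add: cls_add cls_scale CS_add CS_mult CS_star hCS B)
      (simp add: B_def)
  finally have beq: "b = \<dots>" .
  note sq = star_rep_norm_sq[OF \<pi> _ _ y]
  have "ip H (\<pi> b y) y = 1/2 * (ip H (\<pi> (amult CA (astar CA a) a) y) y
      + ip H (\<pi> (amult CA (astar CA b) b) y) y)"
    by (subst beq) (simp add: rep(4)[OF sc y] rep(3)[OF mc y] ip_scale ip_add add_closed rep(2) mc y)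
  then have ipb: "ip H (\<pi> b y) y
      = 1/2 * (of_real ((hnorm H (\<pi> a y))\<^sup>2) + of_real ((hnorm H (\<pi> b y))\<^sup>2))"
    by (simp only: sq[OF ab(1) star(1)] sq[OF ab(2) star(2)])
  have Re_b: "2 * Re (ip H (\<pi> b y) y) = (hnorm H (\<pi> a y))\<^sup>2 + (hnorm H (\<pi> b y))\<^sup>2"
    by (subst ipb) (simp del: of_real_power)
  have py: "\<pi> b y \<in> carr H" using ab y rep by simp
  have "0 \<le> Re (ip H (vdiff H y (\<pi> b y)) (vdiff H y (\<pi> b y)))"
    using y py by (simp add: ip_nonneg vdiff_closed)
  also have "\<dots> = (hnorm H y)\<^sup>2 - 2 * Re (ip H (\<pi> b y) y) + (hnorm H (\<pi> b y))\<^sup>2"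
    using y py ip_commute[OF y py] by (simp add: ip_vdiff ip_vdiff_right vdiff_closed hnorm_sq)
  finally have "(hnorm H (\<pi> a y))\<^sup>2 \<le> (hnorm H y)\<^sup>2" using Re_b by simp
  then show ?thesis
    using y hnorm_nonneg power2_le_imp_le unfolding a_def by blast
qed

text \<open>Rescaling by 1/(2c) moves the sequence into the ball of radius 1/2; the factor 2 comes
  from that radius.\<close>

lemma rep_bound:
  assumes H: "hilbert_space H" and \<pi>: "star_rep CA H \<pi>"
    and X: "X \<in> CS" "\<And>n. N (X n) \<le> c" and y: "y \<in> carr H" and c: "c > 0"
  shows "hnorm H (\<pi> (cls X) y) \<le> 2 * c * hnorm H y"
proof -
  interpret hilbert_space H by fact
  note rep = star_repD[OF \<pi>]
  define r where "r = (of_real (1 / (2 * c)) :: complex)"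
  have "N (vscale A r (X n)) \<le> 1/2" for n
  proof -
    have "N (vscale A r (X n)) \<le> 1 / (2 * c) * N (X n)"
      using N_scale[OF CS_closed[OF X(1), of n], of r] c by (simp add: r_def norm_divide norm_mult)
    also have "\<dots> \<le> 1 / (2 * c) * c" using c X(2)[of n] by (intro mult_left_mono) auto
    finally show ?thesis using c by simp
  qed
  then have "hnorm H (\<pi> (vscale CA r (cls X)) y) \<le> hnorm H y"
    by (simp add: cls_scale[OF X(1)] rep_contractive[OF H \<pi> CS_scale[OF X(1)] _ y])
  then have "hnorm H (\<pi> (cls X) y) / (2 * c) \<le> hnorm H y"
    using c by (simp add: rep(4)[OF cls_closed[OF X(1)] y] hnorm_scale rep(2)[OF cls_closed[OF X(1)] y]
        r_def norm_divide norm_mult)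
  then show ?thesis using c by (simp add: field_simps)
qed

text \<open>Subtracting the constant sequence \<open>X M\<close> from a tail of X leaves a sequence
  bounded by e/2, and \<open>rep_bound\<close> doubles this to e.\<close>

lemma rep_approx:
  assumes H: "hilbert_space H" and \<pi>: "star_rep CA H \<pi>" and a: "a \<in> carr CA" and e: "e > 0"
  obtains x b where "x \<in> carr A" "b \<in> carr CA" "a = vadd CA (cls (\<lambda>n. x)) b"
    "\<And>y. y \<in> carr H \<Longrightarrow> hnorm H (\<pi> b y) \<le> e * hnorm H y"
proof -
  obtain X where X: "X \<in> CS" "a = cls X" using a by (auto simp: carr_CA)
  obtain M where M: "\<And>m n. m \<ge> M \<Longrightarrow> n \<ge> M \<Longrightarrow> d (X m) (X n) < e/2"
    using CS_D[OF X(1), of "e/2"] e by auto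
  define Y where "Y = (\<lambda>n. vdiff A (X (n + M)) (X M))"
  have Xc: "X n \<in> carr A" for n using X by (simp add: CS_closed)
  have Y: "Y \<in> CS"
    unfolding Y_def vdiff_def by (rule CS_add[OF CS_shift[OF X(1)] CS_scale[OF CS_const[OF Xc]]])
  show ?thesis
  proof (rule that[of "X M" "cls Y"])
    have "a = cls (\<lambda>n. X (n + M))" using X by (simp add: cls_shift)
    also have "\<dots> = vadd CA (cls (\<lambda>n. X M)) (cls Y)"
      by (simp add: cls_add CS_const Y Xc Y_def[THEN fun_cong] add_diff)
    finally show "a = vadd CA (cls (\<lambda>n. X M)) (cls Y)" .
    fix y assume "y \<in> carr H"
    with rep_bound[OF H \<pi> Y, of "e/2" y] show "hnorm H (\<pi> (cls Y) y) \<le> e * hnorm H y"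
      using e M by (simp add: Y_def less_imp_le)
  qed (simp_all add: Xc Y cls_closed)
qed

end

section \<open>The convolution algebra and its universal norm\<close>

lemma Zloc_of_int: "of_int a \<in> Zloc p q"
proof -
  have "(of_int a :: rat) = of_int a / of_nat (p * q) ^ 0" by simp
  then show ?thesis unfolding Zloc_def by blast
qed

lemma Zloc_uminus: "k \<in> Zloc p q \<Longrightarrow> - k \<in> Zloc p q"
proof -
  assume "k \<in> Zloc p q"
  then obtain a n where "k = of_int a / of_nat (p * q) ^ n" by (auto simp: Zloc_def)
  then have "- k = of_int (- a) / of_nat (p * q) ^ n" by simp
  then show ?thesis unfolding Zloc_def by blast
qed

locale two_bases =
  fixes p q :: nat
  assumes p: "p > 1" and q: "q > 1"
begin

abbreviation "Z \<equiv> Zloc p q"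
abbreviation "S \<equiv> solenoid p q"
abbreviation "CX \<equiv> C_solenoid p q"
abbreviation "CC \<equiv> conv_alg p q"
abbreviation "chi \<equiv> character_fun p q"

definition scal :: "int \<times> int \<Rightarrow> rat \<Rightarrow> rat" where
  "scal s k = k * of_nat p powi fst s * of_nat q powi snd s"

definition dual :: "int \<times> int \<Rightarrow> (rat \<Rightarrow> complex) \<Rightarrow> rat \<Rightarrow> complex" where
  "dual s \<xi> = (\<lambda>k\<in>Z. \<xi> (scal s k))"

lemma act_eq: "act p q s f = (\<lambda>\<xi>. if \<xi> \<in> S then f (dual s \<xi>) else 0)"
  unfolding act_def dual_def scal_def by (rule refl)

lemma Z_0: "0 \<in> Z" and Z_1: "1 \<in> Z"
  using Zloc_of_int[of 0 p q] Zloc_of_int[of 1 p q] by simp_all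

lemma Z_add:
  assumes "k \<in> Z" "l \<in> Z"
  shows "k + l \<in> Z"
proof -
  obtain a m b n where *: "k = of_int a / of_nat (p * q) ^ m" "l = of_int b / of_nat (p * q) ^ n"
    using assms by (auto simp: Zloc_def)
  have "k + l = of_int (a * int (p * q) ^ n + b * int (p * q) ^ m) / of_nat (p * q) ^ (m + n)"
    unfolding * using p q by (simp add: field_simps power_add)
  then show ?thesis unfolding Zloc_def by blast
qed

lemma Z_mult_nat:
  assumes "k \<in> Z"
  shows "k * of_nat r \<in> Z"
proof -
  obtain a m where *: "k = of_int a / of_nat (p * q) ^ m"
    using assms by (auto simp: Zloc_def)
  have "k * of_nat r = of_int (a * int r) / of_nat (p * q) ^ m"
    unfolding * by simp
  then show ?thesis unfolding Zloc_def by blast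
qed

text \<open>Division by a factor r of pq is multiplication by the cofactor r' followed by one more
  division by pq.\<close>

lemma Z_div:
  assumes "k \<in> Z" "r * r' = p * q"
  shows "k / of_nat r \<in> Z"
proof -
  obtain a m where *: "k = of_int a / of_nat (p * q) ^ m"
    using assms by (auto simp: Zloc_def)
  have r: "r \<noteq> 0" "r' \<noteq> 0" using assms(2) p q by (metis mult_eq_0_iff not_one_less_zero)+
  have "of_nat (p * q) = (of_nat r * of_nat r' :: rat)"
    unfolding assms(2)[symmetric] by simp
  then have "k / of_nat r = of_int (a * int r') / of_nat (p * q) ^ Suc m"
    unfolding * using r by (simp add: field_simps)
  then show ?thesis unfolding Zloc_def by blast
qed

lemma Z_powi:
  assumes "k \<in> Z" "r * r' = p * q"
  shows "k * of_nat r powi m \<in> Z"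
proof (cases m rule: int_cases2)
  case (nonneg n)
  have "k * of_nat (r ^ n) \<in> Z" by (rule Z_mult_nat[OF assms(1)])
  then show ?thesis using nonneg by simp
next
  case (nonpos n)
  have "k / of_nat r ^ n \<in> Z"
  proof (induction n)
    case (Suc n)
    then show ?case using Z_div[OF Suc assms(2)] by (simp add: field_simps)
  qed (simp add: assms)
  then show ?thesis using nonpos by (simp add: power_int_minus field_simps)
qed

lemma scal_closed: "k \<in> Z \<Longrightarrow> scal s k \<in> Z"
  unfolding scal_def by (intro Z_powi[of _ q p] Z_powi[of _ p q]) auto

lemma scal_add: "scal s (k + l) = scal s k + scal s l"
  by (simp add: scal_def algebra_simps)

lemma scal_zero [simp]: "scal 0 k = k"
  by (simp add: scal_def)

lemma scal_0 [simp]: "scal s 0 = 0"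
  by (simp add: scal_def)

section \<open>The solenoid as a compact space of characters\<close>

lemma sol_D:
  assumes "\<xi> \<in> S"
  shows "k \<in> Z \<Longrightarrow> cmod (\<xi> k) = 1" and "k \<notin> Z \<Longrightarrow> \<xi> k = undefined"
    and "k \<in> Z \<Longrightarrow> l \<in> Z \<Longrightarrow> \<xi> (k + l) = \<xi> k * \<xi> l"
  using assms by (auto simp: solenoid_def PiE_def Pi_def extensional_def)

lemma sol_zero: "\<xi> \<in> S \<Longrightarrow> \<xi> 0 = 1"
  using sol_D(3)[of \<xi> 0 0] sol_D(1)[of \<xi> 0] Z_0 by auto

lemma sol_uminus: 
  assumes "\<xi> \<in> S" "k \<in> Z"
  shows "\<xi> (- k) = cnj (\<xi> k)"
proof -
  have "\<xi> (- k) * \<xi> k = 1"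
    using sol_D(3)[OF assms(1) Zloc_uminus[OF assms(2)] assms(2)] sol_zero[OF assms(1)] by simp
  moreover have "\<xi> k * cnj (\<xi> k) = 1"
    using sol_D(1)[OF assms] by (simp add: complex_norm_square[symmetric])
  ultimately show ?thesis
    by (metis mult.assoc mult.commute mult.right_neutral)
qed

lemma dual_closed: "\<xi> \<in> S \<Longrightarrow> dual s \<xi> \<in> S"
  by (auto simp: solenoid_def dual_def scal_closed Z_add scal_add PiE_def Pi_def)

lemma dual_zero: "\<xi> \<in> S \<Longrightarrow> dual 0 \<xi> = \<xi>"
  by (auto simp: dual_def fun_eq_iff sol_D)

lemma dual_cont: "continuous_on S (dual s)"
proof (rule continuous_on_coordinatewise_then_product)
  fix k
  have "continuous_on S (\<lambda>\<xi>. \<xi> (scal s k))"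
    by (rule continuous_on_subset[OF continuous_on_product_coordinates]) auto
  then show "continuous_on S (\<lambda>\<xi>. dual s \<xi> k)"
    by (cases "k \<in> Z") (auto simp: dual_def)
qed

lemma compact_solenoid: "compact S"
proof -
  \<comment> \<open>Off \<open>Z\<close> the coordinates are the constant \<open>undefined\<close>,
    so a singleton is the right factor there; Tychonoff then applies in the full product, and
    multiplicativity is a closed condition.\<close>
  let ?P = "PiE UNIV (\<lambda>k. if k \<in> Z then sphere 0 1 else {undefined}) :: (rat \<Rightarrow> complex) set"
  have "compactin (product_topology (\<lambda>i. euclidean) UNIV) ?P"
    by (subst compactin_PiE) auto
  then have "compact ?P"
    by (simp add: euclidean_product_topology)
  moreover have "closed (\<Inter>k\<in>Z. \<Inter>l\<in>Z. {\<xi>. \<xi> (k + l) = \<xi> k * (\<xi> l :: complex)})"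
    by (intro closed_INT ballI closed_Collect_eq continuous_intros continuous_on_product_coordinates)
  ultimately have "compact (?P \<inter> (\<Inter>k\<in>Z. \<Inter>l\<in>Z. {\<xi>. \<xi> (k + l) = \<xi> k * \<xi> l}))"
    by (rule compact_Int_closed)
  also have "?P \<inter> (\<Inter>k\<in>Z. \<Inter>l\<in>Z. {\<xi>. \<xi> (k + l) = \<xi> k * \<xi> l}) = S"
    unfolding solenoid_def by (auto simp: PiE_def Pi_def extensional_def split: if_splits)
  finally show ?thesis .
qed

section \<open>Continuous functions on the solenoid\<close>

lemma CX_D: "f \<in> CX \<Longrightarrow> continuous_on S f" "f \<in> CX \<Longrightarrow> \<xi> \<notin> S \<Longrightarrow> f \<xi> = 0"
  by (auto simp: C_solenoid_def)

lemma CX_I: "continuous_on S f \<Longrightarrow> (\<And>\<xi>. \<xi> \<notin> S \<Longrightarrow> f \<xi> = 0) \<Longrightarrow> f \<in> CX"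
  by (auto simp: C_solenoid_def)

lemma CX_zero [simp]: "(\<lambda>\<xi>. 0) \<in> CX"
  by (rule CX_I) auto

lemma CX_add: "f \<in> CX \<Longrightarrow> g \<in> CX \<Longrightarrow> (\<lambda>\<xi>. f \<xi> + g \<xi>) \<in> CX"
  by (rule CX_I) (auto simp: CX_D intro!: continuous_intros)

lemma CX_mult: "f \<in> CX \<Longrightarrow> g \<in> CX \<Longrightarrow> (\<lambda>\<xi>. f \<xi> * g \<xi>) \<in> CX"
  by (rule CX_I) (auto simp: CX_D intro!: continuous_intros)

lemma CX_scale: "f \<in> CX \<Longrightarrow> (\<lambda>\<xi>. c * f \<xi>) \<in> CX"
  by (rule CX_I) (auto simp: CX_D intro!: continuous_intros)

lemma CX_cnj: "f \<in> CX \<Longrightarrow> (\<lambda>\<xi>. cnj (f \<xi>)) \<in> CX"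
  by (rule CX_I) (auto simp: CX_D intro!: continuous_intros)

lemma CX_sum: "(\<And>i. i \<in> I \<Longrightarrow> f i \<in> CX) \<Longrightarrow> (\<lambda>\<xi>. \<Sum>i\<in>I. f i \<xi>) \<in> CX"
  by (induction I rule: infinite_finite_induct) (auto intro!: CX_add)

lemma CX_act: "f \<in> CX \<Longrightarrow> act p q s f \<in> CX"
proof (rule CX_I)
  assume f: "f \<in> CX"
  have "continuous_on S (\<lambda>\<xi>. f (dual s \<xi>))"
    by (rule continuous_on_compose2[OF CX_D(1)[OF f] dual_cont]) (auto simp: dual_closed)
  then show "continuous_on S (act p q s f)"
    by (rule continuous_on_eq) (simp add: act_eq)
qed (simp add: act_eq)

lemma CX_chi: "chi k \<in> CX"
proof (rule CX_I)
  have "continuous_on S (\<lambda>\<xi>. \<xi> k)"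
    by (rule continuous_on_subset[OF continuous_on_product_coordinates]) auto
  then show "continuous_on S (chi k)"
    by (rule continuous_on_eq) (simp add: character_fun_def)
qed (simp add: character_fun_def)

lemma CX_bounded:
  assumes "f \<in> CX"
  obtains c where "c \<ge> 0" "\<And>\<xi>. cmod (f \<xi>) \<le> c"
proof -
  have "bounded (f ` S)"
    by (intro compact_imp_bounded compact_continuous_image CX_D(1) assms compact_solenoid)
  then obtain c where "\<And>\<xi>. \<xi> \<in> S \<Longrightarrow> cmod (f \<xi>) \<le> c"
    by (auto simp: bounded_iff)
  then have "cmod (f \<xi>) \<le> max c 0" for \<xi>
    using CX_D(2)[OF assms] by (cases "\<xi> \<in> S") (auto simp: max.coboundedI1)
  then show ?thesis using that[of "max c 0"] by auto
qed

lemma act_zero [simp]: "act p q s (\<lambda>\<xi>. 0) = (\<lambda>\<xi>. 0)"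
  by (simp add: act_eq)

lemma act_0: "f \<in> CX \<Longrightarrow> act p q 0 f = f"
  by (auto simp: act_eq fun_eq_iff dual_zero CX_D)

lemma act_chi: "k \<in> Z \<Longrightarrow> act p q s (chi k) = chi (scal s k)"
  by (rule ext) (auto simp: act_eq character_fun_def dual_closed, simp add: dual_def)

lemma chi_mult: "k \<in> Z \<Longrightarrow> l \<in> Z \<Longrightarrow> (\<lambda>\<xi>. chi k \<xi> * chi l \<xi>) = chi (k + l)"
  by (auto simp: character_fun_def sol_D)

lemma chi_cnj: "k \<in> Z \<Longrightarrow> (\<lambda>\<xi>. cnj (chi k \<xi>)) = chi (- k)"
  by (auto simp: character_fun_def sol_uminus)

lemma chi_zero_mult: "f \<in> CX \<Longrightarrow> (\<lambda>\<xi>. f \<xi> * chi 0 \<xi>) = f"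
  by (auto simp: character_fun_def sol_zero CX_D fun_eq_iff)

definition supp :: "conv_elt \<Rightarrow> (int \<times> int) set" where
  "supp F = {s. F s \<noteq> (\<lambda>\<xi>. 0)}"

text \<open>The element f u_s, supported at a single group element.\<close>

definition mono :: "int \<times> int \<Rightarrow> ((rat \<Rightarrow> complex) \<Rightarrow> complex) \<Rightarrow> conv_elt" where
  "mono s f = (\<lambda>t. if t = s then f else (\<lambda>\<xi>. 0))"

lemma CC_carr: "F \<in> carr CC \<longleftrightarrow> (\<forall>s. F s \<in> CX) \<and> finite (supp F)"
  by (simp add: conv_alg_def supp_def)

lemma CC_ops:
  "vzero CC = (\<lambda>s \<xi>. 0)"
  "vadd CC F G = (\<lambda>s \<xi>. F s \<xi> + G s \<xi>)"
  "vscale CC c F = (\<lambda>s \<xi>. c * F s \<xi>)"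
  "astar CC F = (\<lambda>s. act p q s (\<lambda>\<xi>. cnj (F (- s) \<xi>)))"
  "vdiff CC F G = (\<lambda>s \<xi>. F s \<xi> - G s \<xi>)"
  by (simp_all add: conv_alg_def vdiff_def)

text \<open>\<open>amult\<close> sums over the support of its left factor; a free finite range T
  lets products with different left factors share one sum, as in
  \<open>CC_diff_mult\<close>.\<close>

lemma CC_mult:
  assumes "finite T" "supp F \<subseteq> T"
  shows "amult CC F G = (\<lambda>s \<xi>. \<Sum>t\<in>T. F t \<xi> * act p q t (G (s - t)) \<xi>)"
proof (intro ext)
  fix s \<xi>
  have "(\<Sum>t\<in>supp F. F t \<xi> * act p q t (G (s - t)) \<xi>) = (\<Sum>t\<in>T. F t \<xi> * act p q t (G (s - t)) \<xi>)"
    using assms by (intro sum.mono_neutral_left) (auto simp: supp_def)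
  then show "amult CC F G s \<xi> = (\<Sum>t\<in>T. F t \<xi> * act p q t (G (s - t)) \<xi>)"
    by (simp add: conv_alg_def supp_def)
qed

lemma CC_I: "(\<And>s. F s \<in> CX) \<Longrightarrow> finite T \<Longrightarrow> (\<And>s. s \<notin> T \<Longrightarrow> F s = (\<lambda>\<xi>. 0)) \<Longrightarrow> F \<in> carr CC"
  unfolding CC_carr supp_def by (metis (mono_tags, lifting) finite_subset mem_Collect_eq subsetI)

lemma CC_D: "F \<in> carr CC \<Longrightarrow> F s \<in> CX" "F \<in> carr CC \<Longrightarrow> finite (supp F)"
  "s \<notin> supp F \<Longrightarrow> F s = (\<lambda>\<xi>. 0)"
  unfolding CC_carr supp_def by blast+

lemma CC_zero_closed: "vzero CC \<in> carr CC"
  by (rule CC_I[of _ "{}"]) (simp_all add: CC_ops)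

lemma CC_add_closed: "F \<in> carr CC \<Longrightarrow> G \<in> carr CC \<Longrightarrow> vadd CC F G \<in> carr CC"
  by (rule CC_I[of _ "supp F \<union> supp G"]) (simp_all add: CC_ops CC_D CX_add)

lemma CC_scale_closed: "F \<in> carr CC \<Longrightarrow> vscale CC c F \<in> carr CC"
  by (rule CC_I[of _ "supp F"]) (simp_all add: CC_ops CC_D CX_scale)

lemma CC_diff_closed: "F \<in> carr CC \<Longrightarrow> G \<in> carr CC \<Longrightarrow> vdiff CC F G \<in> carr CC"
  by (simp add: vdiff_def CC_add_closed CC_scale_closed)

lemma CC_star_closed:
  assumes "F \<in> carr CC"
  shows "astar CC F \<in> carr CC"
proof (rule CC_I[of _ "uminus ` supp F"])
  fix s assume "s \<notin> uminus ` supp F"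
  then have "- s \<notin> supp F" by (metis image_eqI minus_minus)
  then show "astar CC F s = (\<lambda>\<xi>. 0)" by (simp add: CC_ops CC_D)
qed (simp_all add: CC_ops CC_D assms CX_act CX_cnj)

lemma CC_mult_closed:
  assumes "F \<in> carr CC" "G \<in> carr CC"
  shows "amult CC F G \<in> carr CC"
proof -
  have fin: "finite (supp F)" "finite (supp G)" using assms by (auto simp: CC_carr)
  note eq = CC_mult[OF fin(1) order_refl]
  have "amult CC F G s = (\<lambda>\<xi>. 0)" if "s \<notin> (\<lambda>(t, u). t + u) ` (supp F \<times> supp G)" for s
  proof -
    have "G (s - t) = (\<lambda>\<xi>. 0)" if t: "t \<in> supp F" for t
    proof (rule ccontr)
      assume "G (s - t) \<noteq> (\<lambda>\<xi>. 0)"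
      then have "(t, s - t) \<in> supp F \<times> supp G" using t by (simp add: supp_def)
      then show False using \<open>s \<notin> _\<close> by force
    qed
    then show ?thesis by (simp add: eq)
  qed
  then have "supp (amult CC F G) \<subseteq> (\<lambda>(t, u). t + u) ` (supp F \<times> supp G)"
    by (auto simp: supp_def)
  then have "finite (supp (amult CC F G))"
    using fin by (meson finite_SigmaI finite_imageI finite_subset)
  then show ?thesis
    using assms unfolding CC_carr by (auto simp: eq intro!: CX_sum CX_mult CX_act)
qed

lemma CC_diff_mult:
  assumes "F \<in> carr CC" "F' \<in> carr CC"
  shows "vdiff CC (amult CC F G) (amult CC F' G')
    = vadd CC (amult CC F (vdiff CC G G')) (amult CC (vdiff CC F F') G')"
proof -
  let ?T = "supp F \<union> supp F'"
  have T: "finite ?T" "supp F \<subseteq> ?T" "supp F' \<subseteq> ?T" "supp (\<lambda>s \<xi>. F s \<xi> - F' s \<xi>) \<subseteq> ?T"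
    using assms by (auto simp: CC_carr supp_def)
  have act: "act p q t (\<lambda>\<xi>. G s \<xi> - G' s \<xi>) \<xi> = act p q t (G s) \<xi> - act p q t (G' s) \<xi>" for s t \<xi>
    by (simp add: act_eq)
  show ?thesis
    unfolding CC_ops CC_mult[OF T(1,2)] CC_mult[OF T(1,3)] CC_mult[OF T(1,4)]
    by (simp add: fun_eq_iff act sum.distrib[symmetric] sum_subtractf[symmetric] algebra_simps)
qed

lemma mono_closed: "f \<in> CX \<Longrightarrow> mono s f \<in> carr CC"
  by (rule CC_I[of _ "{s}"]) (auto simp: mono_def)

lemma mono_mult: "amult CC (mono s f) (mono t g) = mono (s + t) (\<lambda>\<xi>. f \<xi> * act p q s g \<xi>)"
proof -
  have "supp (mono s f) \<subseteq> {s}" by (auto simp: supp_def mono_def)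
  from CC_mult[OF _ this] show ?thesis
    by (auto simp: fun_eq_iff mono_def diff_eq_eq add.commute)
qed

lemma mono_star: "astar CC (mono s f) = mono (- s) (act p q (- s) (\<lambda>\<xi>. cnj (f \<xi>)))"
proof (rule ext)
  fix t
  show "astar CC (mono s f) t = mono (- s) (act p q (- s) (\<lambda>\<xi>. cnj (f \<xi>))) t"
    by (cases "t = - s") (auto simp: CC_ops mono_def minus_equation_iff[of t s])
qed

lemma mono_add: "vadd CC (mono s f) (mono s g) = mono s (\<lambda>\<xi>. f \<xi> + g \<xi>)"
  by (auto simp: CC_ops mono_def fun_eq_iff)

lemma mono_scale: "vscale CC c (mono s f) = mono s (\<lambda>\<xi>. c * f \<xi>)"
  by (auto simp: CC_ops mono_def fun_eq_iff)

section \<open>Norm estimates valid in every representation of the convolution algebra\<close>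

lemma CC_unit_le:
  assumes H: "hilbert_space H" and \<sigma>: "star_rep CC H \<sigma>" and y: "y \<in> carr H"
  shows "hnorm H (\<sigma> (mono 0 (chi 0)) y) \<le> hnorm H y"
    and "ip H (\<sigma> (mono 0 (chi 0)) y) y = of_real ((hnorm H (\<sigma> (mono 0 (chi 0)) y))\<^sup>2)"
proof -
  interpret hilbert_space H by fact
  let ?e = "mono 0 (chi 0)"
  \<comment> \<open>The unit is a self-adjoint idempotent, so it acts as an orthogonal projection,
    possibly not the identity.\<close>
  have e: "?e \<in> carr CC" "astar CC ?e = ?e" "amult CC ?e ?e = ?e"
    by (simp_all add: mono_closed CX_chi mono_star mono_mult chi_cnj Z_0 act_0 chi_mult)
  have ec: "\<sigma> ?e y \<in> carr H" using star_repD(2)[OF \<sigma> e(1) y] .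
  show eq: "ip H (\<sigma> ?e y) y = of_real ((hnorm H (\<sigma> ?e y))\<^sup>2)"
    using star_rep_norm_sq[OF \<sigma> e(1) _ y] by (simp add: e del: of_real_power)
  have "cmod (ip H (\<sigma> ?e y) y) \<le> hnorm H (\<sigma> ?e y) * hnorm H y"
    by (rule cauchy_schwarz[OF ec y])
  then have "(hnorm H (\<sigma> ?e y))\<^sup>2 \<le> hnorm H (\<sigma> ?e y) * hnorm H y"
    unfolding eq norm_of_real by simp
  then show "hnorm H (\<sigma> ?e y) \<le> hnorm H y"
    using hnorm_nonneg[OF ec] hnorm_nonneg[OF y]
    by (cases "hnorm H (\<sigma> ?e y) = 0") (auto simp: power2_eq_square)
qed

text \<open>With the continuous function g = sqrt (c^2 - |f|^2) one has f* f + g* g = c^2 in the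
  algebra, so the squared norms of the images of y under f and g add up to c^2 times that under the
  unit.\<close>

lemma CC_fun_le:
  assumes H: "hilbert_space H" and \<sigma>: "star_rep CC H \<sigma>" and y: "y \<in> carr H"
    and f: "f \<in> CX" "\<And>\<xi>. cmod (f \<xi>) \<le> c" and c: "c \<ge> 0"
  shows "hnorm H (\<sigma> (mono 0 f) y) \<le> c * hnorm H y"
proof -
  interpret hilbert_space H by fact
  note rep = star_repD[OF \<sigma>]
  define g :: "(rat \<Rightarrow> complex) \<Rightarrow> complex"
    where "g \<xi> = (if \<xi> \<in> S then of_real (sqrt (c\<^sup>2 - (cmod (f \<xi>))\<^sup>2)) else 0)" for \<xi>
  have "continuous_on S (\<lambda>\<xi>. complex_of_real (sqrt (c\<^sup>2 - (cmod (f \<xi>))\<^sup>2)))"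
    by (intro continuous_intros CX_D f)
  then have g: "g \<in> CX"
    by (intro CX_I) (auto simp: g_def elim: continuous_on_eq)
  have sq: "(\<lambda>\<xi>. cnj (f \<xi>) * f \<xi> + cnj (g \<xi>) * g \<xi>) = (\<lambda>\<xi>. of_real (c\<^sup>2) * chi 0 \<xi>)"
  proof
    fix \<xi>
    show "cnj (f \<xi>) * f \<xi> + cnj (g \<xi>) * g \<xi> = of_real (c\<^sup>2) * chi 0 \<xi>"
    proof (cases "\<xi> \<in> S")
      case True
      have "(cmod (f \<xi>))\<^sup>2 \<le> c\<^sup>2" using f(2) by (intro power_mono) auto
      then have "cnj (g \<xi>) * g \<xi> = of_real (c\<^sup>2 - (cmod (f \<xi>))\<^sup>2)"
        using True by (simp add: g_def of_real_mult[symmetric] del: of_real_mult)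
      moreover have "cnj (f \<xi>) * f \<xi> = of_real ((cmod (f \<xi>))\<^sup>2)"
        using complex_norm_square[of "f \<xi>"] by (simp only: mult.commute)
      ultimately show ?thesis
        using True by (simp add: character_fun_def sol_zero)
    qed (simp add: g_def character_fun_def CX_D(2)[OF f(1)])
  qed
  have star: "astar CC (mono 0 h) = mono 0 (\<lambda>\<xi>. cnj (h \<xi>))" if "h \<in> CX" for h
    using that by (simp add: mono_star act_0 CX_cnj)
  have mult: "amult CC (mono 0 (\<lambda>\<xi>. cnj (h \<xi>))) (mono 0 h) = mono 0 (\<lambda>\<xi>. cnj (h \<xi>) * h \<xi>)" if "h \<in> CX" for h
    using that by (simp add: mono_mult act_0)
  have norm: "ip H (\<sigma> (mono 0 (\<lambda>\<xi>. cnj (h \<xi>) * h \<xi>)) y) y = of_real ((hnorm H (\<sigma> (mono 0 h) y))\<^sup>2)"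
    if "h \<in> CX" for h
    using star_rep_norm_sq[OF \<sigma> mono_closed[OF that] _ y, of 0] that
    by (simp add: star mult mono_closed CX_cnj del: of_real_power)
  let ?e = "mono 0 (chi 0)"
  have cl: "mono 0 (\<lambda>\<xi>. cnj (h \<xi>) * h \<xi>) \<in> carr CC" if "h \<in> CX" for h
    using that by (intro mono_closed CX_mult CX_cnj)
  have "vadd CC (mono 0 (\<lambda>\<xi>. cnj (f \<xi>) * f \<xi>)) (mono 0 (\<lambda>\<xi>. cnj (g \<xi>) * g \<xi>))
      = vscale CC (of_real (c\<^sup>2)) ?e"
    by (simp add: mono_add mono_scale sq)
  then have "ip H (\<sigma> (vadd CC (mono 0 (\<lambda>\<xi>. cnj (f \<xi>) * f \<xi>)) (mono 0 (\<lambda>\<xi>. cnj (g \<xi>) * g \<xi>))) y) y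
      = ip H (\<sigma> (vscale CC (of_real (c\<^sup>2)) ?e) y) y" by simp
  then have "of_real ((hnorm H (\<sigma> (mono 0 f) y))\<^sup>2) + of_real ((hnorm H (\<sigma> (mono 0 g) y))\<^sup>2)
      = (of_real (c\<^sup>2) * of_real ((hnorm H (\<sigma> ?e y))\<^sup>2) :: complex)"
    using f g y CC_unit_le(2)[OF H \<sigma> y]
    by (simp add: rep(2-4) cl mono_closed CX_chi ip_add ip_scale norm del: of_real_power)
  then have "(hnorm H (\<sigma> (mono 0 f) y))\<^sup>2 + (hnorm H (\<sigma> (mono 0 g) y))\<^sup>2 = c\<^sup>2 * (hnorm H (\<sigma> ?e y))\<^sup>2"
    unfolding of_real_add[symmetric] of_real_mult[symmetric] of_real_eq_iff .
  then have "(hnorm H (\<sigma> (mono 0 f) y))\<^sup>2 \<le> c\<^sup>2 * (hnorm H (\<sigma> ?e y))\<^sup>2"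
    using zero_le_power2[of "hnorm H (\<sigma> (mono 0 g) y)"] by linarith
  also have "\<dots> \<le> c\<^sup>2 * (hnorm H y)\<^sup>2"
    using CC_unit_le(1)[OF H \<sigma> y]
    by (intro mult_left_mono power_mono) (auto simp: hnorm_nonneg rep(2) mono_closed CX_chi y)
  finally have "(hnorm H (\<sigma> (mono 0 f) y))\<^sup>2 \<le> (c * hnorm H y)\<^sup>2" by (simp add: power_mult_distrib)
  then show ?thesis
    using c y by (meson hnorm_nonneg mult_nonneg_nonneg power2_le_imp_le)
qed

lemma mono_factor: "f \<in> CX \<Longrightarrow> amult CC (mono 0 f) (mono s (chi 0)) = mono s f"
  by (simp add: mono_mult act_chi Z_0 chi_zero_mult)

text \<open>Since u_s* u_s is the unit, u_s does not increase norms; the rest is f u_s = f times u_s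
  and \<open>CC_fun_le\<close>.\<close>

lemma CC_mono_le:
  assumes H: "hilbert_space H" and \<sigma>: "star_rep CC H \<sigma>" and y: "y \<in> carr H"
    and f: "f \<in> CX" "\<And>\<xi>. cmod (f \<xi>) \<le> c" and c: "c \<ge> 0"
  shows "hnorm H (\<sigma> (mono s f) y) \<le> c * hnorm H y"
proof -
  interpret hilbert_space H by fact
  note rep = star_repD[OF \<sigma>]
  let ?u = "mono s (chi 0)"
  have u: "?u \<in> carr CC" by (simp add: mono_closed CX_chi)
  have "astar CC ?u = mono (- s) (chi 0)"
    by (simp add: mono_star chi_cnj Z_0 act_chi)
  then have "amult CC (astar CC ?u) ?u = mono 0 (chi 0)"
    by (simp add: mono_mult act_chi Z_0 chi_mult)
  then have "of_real ((hnorm H (\<sigma> ?u y))\<^sup>2) = (of_real ((hnorm H (\<sigma> (mono 0 (chi 0)) y))\<^sup>2) :: complex)"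
    using star_rep_norm_sq[OF \<sigma> u CC_star_closed[OF u] y] CC_unit_le(2)[OF H \<sigma> y] by simp
  then have "(hnorm H (\<sigma> ?u y))\<^sup>2 = (hnorm H (\<sigma> (mono 0 (chi 0)) y))\<^sup>2"
    by (simp only: of_real_eq_iff)
  then have "hnorm H (\<sigma> ?u y) = hnorm H (\<sigma> (mono 0 (chi 0)) y)"
    using y u by (simp add: hnorm_nonneg rep(2) mono_closed CX_chi)
  then have uy: "hnorm H (\<sigma> ?u y) \<le> hnorm H y"
    using CC_unit_le(1)[OF H \<sigma> y] by simp
  have "\<sigma> (mono s f) y = \<sigma> (mono 0 f) (\<sigma> ?u y)"
    using f u y by (simp add: mono_factor[symmetric, of f s] rep(5) mono_closed)
  also have "hnorm H \<dots> \<le> c * hnorm H (\<sigma> ?u y)"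
    using f u y c rep by (intro CC_fun_le[OF H \<sigma>]) auto
  also have "\<dots> \<le> c * hnorm H y" using uy c by (intro mult_left_mono)
  finally show ?thesis .
qed

lemma CC_induct [consumes 1, case_names zero add]:
  assumes "F \<in> carr CC" and "P (vzero CC)"
    and "\<And>F s f. F \<in> carr CC \<Longrightarrow> f \<in> CX \<Longrightarrow> P F \<Longrightarrow> P (vadd CC F (mono s f))"
  shows "P F"
proof -
  have "finite (supp F)" using assms by (simp add: CC_carr)
  then show ?thesis using assms(1)
  proof (induction "supp F" arbitrary: F rule: finite_induct)
    case empty
    then have "F = vzero CC" by (auto simp: supp_def CC_ops fun_eq_iff)
    then show ?case using assms(2) by simp
  next
    case (insert s T)
    define G where "G = F(s := (\<lambda>\<xi>. 0))"
    have sG: "T = supp G" using insert(2,4) by (auto simp: G_def supp_def)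
    have G: "G \<in> carr CC"
      using insert(1,5) by (simp add: CC_carr sG[symmetric]) (simp add: G_def)
    have "F = vadd CC G (mono s (F s))"
      by (auto simp: CC_ops G_def mono_def fun_eq_iff)
    then show ?case
      using assms(3)[OF G CC_D(1)[OF insert(5)] insert(3)[OF sG G], of s s] by simp
  qed
qed

text \<open>The constant is chosen before H and the representation; this uniformity makes the
  supremum in \<open>full_norm\<close> finite.\<close>

lemma CC_rep_bounded:
  assumes "F \<in> carr CC"
  shows "\<exists>C\<ge>0. \<forall>(H :: ('a, 'm) hilb_scheme) \<sigma>. hilbert_space H \<longrightarrow> star_rep CC H \<sigma> \<longrightarrow>
    (\<forall>y\<in>carr H. hnorm H (\<sigma> F y) \<le> C * hnorm H y)"
  using assms
proof (induction F rule: CC_induct)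
  case zero
  show ?case
  proof (intro exI[of _ 0] conjI allI impI ballI)
    fix H :: "('a, 'm) hilb_scheme" and \<sigma> y
    assume H: "hilbert_space H" and \<sigma>: "star_rep CC H \<sigma>" and y: "y \<in> carr H"
    interpret hilbert_space H by fact
    have "vzero CC = mono 0 (\<lambda>\<xi>. 0)" by (auto simp: CC_ops mono_def)
    then show "hnorm H (\<sigma> (vzero CC) y) \<le> 0 * hnorm H y"
      using CC_mono_le[OF H \<sigma> y, of "\<lambda>\<xi>. 0" 0 0] by simp
  qed simp
next
  case (add F s f)
  then obtain C where C: "C \<ge> 0" "\<And>(H :: ('a, 'm) hilb_scheme) \<sigma> y. hilbert_space H \<Longrightarrow> star_rep CC H \<sigma> \<Longrightarrow>
    y \<in> carr H \<Longrightarrow> hnorm H (\<sigma> F y) \<le> C * hnorm H y" by blast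
  obtain c where c: "c \<ge> 0" "\<And>\<xi>. cmod (f \<xi>) \<le> c" using CX_bounded[OF add(2)] by blast
  show ?case
  proof (intro exI[of _ "C + c"] conjI allI impI ballI)
    fix H :: "('a, 'm) hilb_scheme" and \<sigma> y
    assume H: "hilbert_space H" and \<sigma>: "star_rep CC H \<sigma>" and y: "y \<in> carr H"
    interpret hilbert_space H by fact
    note rep = star_repD[OF \<sigma>]
    have m: "mono s f \<in> carr CC" using add by (simp add: mono_closed)
    have "hnorm H (\<sigma> (vadd CC F (mono s f)) y) \<le> hnorm H (\<sigma> F y) + hnorm H (\<sigma> (mono s f) y)"
      using add(1) m y by (simp add: rep hnorm_add)
    also have "\<dots> \<le> C * hnorm H y + c * hnorm H y"
      using C(2)[OF H \<sigma> y] CC_mono_le[OF H \<sigma> y add(2) c(2,1)] by (intro add_mono)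
    finally show "hnorm H (\<sigma> (vadd CC F (mono s f)) y) \<le> (C + c) * hnorm H y"
      by (simp add: algebra_simps)
  qed (use C c in simp)
qed

section \<open>The universal norm\<close>

abbreviation "FN \<equiv> full_norm p q"

lemma full_norm_upper:
  fixes H :: "(nat \<Rightarrow> complex) hilb"
  assumes "F \<in> carr CC" "hilbert_space H" "star_rep CC H \<sigma>"
  shows "op_norm H (\<sigma> F) \<le> FN F"
proof -
  obtain C where C: "C \<ge> 0" "\<And>(H :: (nat \<Rightarrow> complex) hilb) \<sigma> y. hilbert_space H \<Longrightarrow> star_rep CC H \<sigma> \<Longrightarrow>
    y \<in> carr H \<Longrightarrow> hnorm H (\<sigma> F y) \<le> C * hnorm H y"
    using CC_rep_bounded[OF assms(1)] by blast
  show ?thesis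
    unfolding full_norm_def
  proof (rule cSup_upper)
    show "bdd_above {op_norm H (\<pi> F) |(H :: (nat \<Rightarrow> complex) hilb) \<pi>. hilbert_space H \<and> star_rep CC H \<pi>}"
      by (rule bdd_aboveI[of _ C]) (auto intro!: hilbert_space.op_norm_least C)
  qed (use assms in blast)
qed

text \<open>The zero representation makes the set under the supremum in \<open>full_norm\<close>
  nonempty and gives \<open>full_norm_nonneg\<close>.\<close>

lemma trivial_rep:
  defines "H0 \<equiv> \<lparr>carr = {\<lambda>_. 0}, vzero = (\<lambda>_. 0), vadd = (\<lambda>_ _ _. 0), vscale = (\<lambda>_ _ _. 0),
    ip = (\<lambda>_ _. 0)\<rparr> :: (nat \<Rightarrow> complex) hilb"
  shows "hilbert_space H0" "star_rep A H0 (\<lambda>_ _ _. 0)"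
proof -
  show "hilbert_space H0"
    by unfold_locales (auto simp: H0_def hnorm_def)
  show "star_rep A H0 (\<lambda>_ _ _. 0)"
    by (auto simp: H0_def star_rep_def bounded_ops_def hnorm_def)
qed

lemma full_norm_least:
  assumes "C \<ge> 0"
    and "\<And>(H :: (nat \<Rightarrow> complex) hilb) \<sigma> y. hilbert_space H \<Longrightarrow> star_rep CC H \<sigma> \<Longrightarrow>
      y \<in> carr H \<Longrightarrow> hnorm H (\<sigma> F y) \<le> C * hnorm H y"
  shows "FN F \<le> C"
  unfolding full_norm_def
  by (rule cSup_least) (use trivial_rep in blast, use assms in \<open>auto intro!: hilbert_space.op_norm_least\<close>)

lemma full_norm_rep:
  fixes H :: "(nat \<Rightarrow> complex) hilb"
  assumes "F \<in> carr CC" "hilbert_space H" "star_rep CC H \<sigma>" "y \<in> carr H"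
  shows "hnorm H (\<sigma> F y) \<le> FN F * hnorm H y"
proof -
  have "hnorm H (\<sigma> F y) \<le> op_norm H (\<sigma> F) * hnorm H y"
    using hilbert_space.op_norm_upper[OF assms(2) star_repD(1)[OF assms(3,1)] assms(4)] .
  also have "\<dots> \<le> FN F * hnorm H y"
    by (intro mult_right_mono full_norm_upper assms hilbert_space.hnorm_nonneg)
  finally show ?thesis .
qed

lemma full_norm_nonneg: "F \<in> carr CC \<Longrightarrow> 0 \<le> FN F"
  using full_norm_upper[OF _ trivial_rep(1) trivial_rep(2)[of CC], of F]
  by (simp add: op_norm_def hnorm_def cong: conj_cong)

lemma full_norm_scale: "F \<in> carr CC \<Longrightarrow> FN (vscale CC c F) \<le> cmod c * FN F"
proof (rule full_norm_least)
  fix H :: "(nat \<Rightarrow> complex) hilb" and \<sigma> y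
  assume F: "F \<in> carr CC" and H: "hilbert_space H" and \<sigma>: "star_rep CC H \<sigma>" and y: "y \<in> carr H"
  interpret hilbert_space H by fact
  show "hnorm H (\<sigma> (vscale CC c F) y) \<le> cmod c * FN F * hnorm H y"
    using full_norm_rep[OF F H \<sigma> y] F y
    by (simp add: star_repD[OF \<sigma>] hnorm_scale mult.assoc mult_left_mono)
qed (simp add: full_norm_nonneg)

lemma full_norm_add: "F \<in> carr CC \<Longrightarrow> G \<in> carr CC \<Longrightarrow> FN (vadd CC F G) \<le> FN F + FN G"
proof (rule full_norm_least)
  fix H :: "(nat \<Rightarrow> complex) hilb" and \<sigma> y
  assume F: "F \<in> carr CC" "G \<in> carr CC" and H: "hilbert_space H" and \<sigma>: "star_rep CC H \<sigma>" and y: "y \<in> carr H"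
  interpret hilbert_space H by fact
  have "hnorm H (\<sigma> (vadd CC F G) y) \<le> hnorm H (\<sigma> F y) + hnorm H (\<sigma> G y)"
    using F y by (simp add: star_repD[OF \<sigma>] hnorm_add)
  then show "hnorm H (\<sigma> (vadd CC F G) y) \<le> (FN F + FN G) * hnorm H y"
    using full_norm_rep[OF F(1) H \<sigma> y] full_norm_rep[OF F(2) H \<sigma> y] by (simp add: algebra_simps)
qed (simp add: full_norm_nonneg)

lemma full_norm_mult: "F \<in> carr CC \<Longrightarrow> G \<in> carr CC \<Longrightarrow> FN (amult CC F G) \<le> FN F * FN G"
proof (rule full_norm_least)
  fix H :: "(nat \<Rightarrow> complex) hilb" and \<sigma> y
  assume F: "F \<in> carr CC" "G \<in> carr CC" and H: "hilbert_space H" and \<sigma>: "star_rep CC H \<sigma>" and y: "y \<in> carr H"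
  have "hnorm H (\<sigma> (amult CC F G) y) \<le> FN F * hnorm H (\<sigma> G y)"
    using F y full_norm_rep[OF F(1) H \<sigma>] by (simp add: star_repD[OF \<sigma>])
  also have "\<dots> \<le> FN F * (FN G * hnorm H y)"
    using full_norm_rep[OF F(2) H \<sigma> y] by (simp add: mult_left_mono full_norm_nonneg F)
  finally show "hnorm H (\<sigma> (amult CC F G) y) \<le> FN F * FN G * hnorm H y"
    by (simp add: algebra_simps)
qed (simp add: full_norm_nonneg)

text \<open>For the image z of y under the adjoint, the squared norm of z is the inner product of F
  z with y; Cauchy-Schwarz and cancelling one factor \<open>hnorm H z\<close> give the
  bound.\<close>

lemma full_norm_star: "F \<in> carr CC \<Longrightarrow> FN (astar CC F) \<le> FN F"
proof (rule full_norm_least)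
  fix H :: "(nat \<Rightarrow> complex) hilb" and \<sigma> y
  assume F: "F \<in> carr CC" and H: "hilbert_space H" and \<sigma>: "star_rep CC H \<sigma>" and y: "y \<in> carr H"
  interpret hilbert_space H by fact
  define z where "z = \<sigma> (astar CC F) y"
  have z: "z \<in> carr H" using F y by (simp add: z_def star_repD[OF \<sigma>] CC_star_closed)
  have Fz: "\<sigma> F z \<in> carr H" using F z by (simp add: star_repD[OF \<sigma>])
  have "of_real ((hnorm H z)\<^sup>2) = ip H (\<sigma> F z) y"
    using star_repD(6)[OF \<sigma> F z y] ip_self[OF z] by (simp add: z_def)
  then have "(hnorm H z)\<^sup>2 = cmod (ip H (\<sigma> F z) y)"
    by (metis abs_of_nonneg norm_of_real zero_le_power2)
  also have "\<dots> \<le> hnorm H (\<sigma> F z) * hnorm H y"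
    by (rule cauchy_schwarz[OF Fz y])
  also have "\<dots> \<le> FN F * hnorm H z * hnorm H y"
    using full_norm_rep[OF F H \<sigma> z] hnorm_nonneg[OF y] by (rule mult_right_mono)
  finally have "hnorm H z * hnorm H z \<le> hnorm H z * (FN F * hnorm H y)"
    by (simp add: power2_eq_square algebra_simps)
  then show "hnorm H (\<sigma> (astar CC F) y) \<le> FN F * hnorm H y"
    using hnorm_nonneg[OF z] hnorm_nonneg[OF y] full_norm_nonneg[OF F] unfolding z_def[symmetric]
    by (cases "hnorm H z = 0") auto
qed (simp add: full_norm_nonneg)

sublocale conv: seminormed_star_alg CC FN
proof
  show zero: "FN (vzero CC) = 0"
    using full_norm_scale[OF CC_zero_closed, of 0] full_norm_nonneg[OF CC_zero_closed]
    by (simp add: CC_ops)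
  fix F G assume F: "F \<in> carr CC" "G \<in> carr CC"
  show "vadd CC G (vdiff CC F G) = F" by (simp add: CC_ops)
  show "vdiff CC F F = vzero CC" by (simp add: CC_ops)
  have sym: "FN (vdiff CC F G) \<le> FN (vdiff CC G F)" if "F \<in> carr CC" "G \<in> carr CC" for F G
  proof -
    have "vdiff CC F G = vscale CC (-1) (vdiff CC G F)" by (simp add: CC_ops)
    then show ?thesis using full_norm_scale[OF CC_diff_closed[OF that(2,1)], of "-1"] by simp
  qed
  show "FN (vdiff CC F G) = FN (vdiff CC G F)"
    using sym F by (simp add: order_antisym)
  have "vdiff CC (vscale CC c F) (vscale CC c G) = vscale CC c (vdiff CC F G)" for c
    by (simp add: CC_ops algebra_simps)
  then show "FN (vdiff CC (vscale CC c F) (vscale CC c G)) \<le> cmod c * FN (vdiff CC F G)" for c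
    using full_norm_scale F by (simp add: CC_diff_closed)
  have "vdiff CC (astar CC F) (astar CC G) = astar CC (vdiff CC F G)"
    by (simp add: CC_ops act_eq fun_eq_iff)
  then show "FN (vdiff CC (astar CC F) (astar CC G)) \<le> FN (vdiff CC F G)"
    using F by (simp add: full_norm_star CC_diff_closed)
  fix F' assume F': "F' \<in> carr CC"
  have "vdiff CC F F' = vadd CC (vdiff CC F G) (vdiff CC G F')" by (simp add: CC_ops)
  then show "FN (vdiff CC F F') \<le> FN (vdiff CC F G) + FN (vdiff CC G F')"
    using F F' by (simp add: full_norm_add CC_diff_closed)
  fix G' assume G': "G' \<in> carr CC"
  have "vdiff CC (vadd CC F G) (vadd CC F' G') = vadd CC (vdiff CC F F') (vdiff CC G G')"
    by (simp add: CC_ops fun_eq_iff)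
  then show "FN (vdiff CC (vadd CC F G) (vadd CC F' G')) \<le> FN (vdiff CC F F') + FN (vdiff CC G G')"
    using F F' G' by (simp add: full_norm_add CC_diff_closed)
  have "FN (vdiff CC (amult CC F G) (amult CC F' G'))
      \<le> FN (amult CC F (vdiff CC G G')) + FN (amult CC (vdiff CC F F') G')"
    using F F' G' by (simp add: CC_diff_mult full_norm_add CC_diff_closed CC_mult_closed)
  also have "\<dots> \<le> FN F * FN (vdiff CC G G') + FN (vdiff CC F F') * FN G'"
    using F F' G' by (intro add_mono full_norm_mult CC_diff_closed)
  finally show "FN (vdiff CC (amult CC F G) (amult CC F' G'))
      \<le> FN F * FN (vdiff CC G G') + FN (vdiff CC F F') * FN G'" .
qed (simp_all add: CC_zero_closed CC_add_closed CC_scale_closed CC_mult_closed CC_star_closed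
    full_norm_nonneg full_norm_add full_norm_scale full_norm_mult full_norm_star)

end

section \<open>Representations of the crossed product\<close>

context two_bases
begin

abbreviation "CP \<equiv> crossed_product p q"
abbreviation "emb \<equiv> conv_embed p q"

lemma emb_closed: "F \<in> carr CC \<Longrightarrow> emb F \<in> carr CP"
  by (simp add: conv_embed_def crossed_product_def conv.cls_closed conv.CS_const)

lemma emb_add: "F \<in> carr CC \<Longrightarrow> G \<in> carr CC \<Longrightarrow> vadd CP (emb F) (emb G) = emb (vadd CC F G)"
  by (simp add: conv_embed_def crossed_product_def conv.cls_add conv.CS_const)

lemma emb_scale: "F \<in> carr CC \<Longrightarrow> vscale CP c (emb F) = emb (vscale CC c F)"
  by (simp add: conv_embed_def crossed_product_def conv.cls_scale conv.CS_const)

lemma emb_mult: "F \<in> carr CC \<Longrightarrow> G \<in> carr CC \<Longrightarrow> amult CP (emb F) (emb G) = emb (amult CC F G)"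
  by (simp add: conv_embed_def crossed_product_def conv.cls_mult conv.CS_const)

lemma emb_star: "F \<in> carr CC \<Longrightarrow> astar CP (emb F) = emb (astar CC F)"
  by (simp add: conv_embed_def crossed_product_def conv.cls_star conv.CS_const)

lemma CP_star_closed: "a \<in> carr CP \<Longrightarrow> astar CP a \<in> carr CP"
  unfolding crossed_product_def by (auto simp: conv.carr_CA conv.cls_star conv.CS_star)

lemma zpow_eq: "zpow p q k = emb (mono 0 (chi k))"
  by (simp add: zpow_def mono_def)

lemma ucan_eq: "ucan p q s = emb (mono s (chi 0))"
  by (simp add: ucan_def mono_def)

lemma zpow_closed: "zpow p q k \<in> carr CP" and ucan_closed: "ucan p q s \<in> carr CP"
  by (simp_all add: zpow_eq ucan_eq emb_closed mono_closed CX_chi)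

lemma zpow_0: "zpow p q 0 = ucan p q 0"
  by (simp add: zpow_eq ucan_eq)

lemma zpow_mult: "k \<in> Z \<Longrightarrow> l \<in> Z \<Longrightarrow> amult CP (zpow p q k) (zpow p q l) = zpow p q (k + l)"
  by (simp add: zpow_eq emb_mult mono_closed CX_chi mono_mult act_chi chi_mult)

lemma ucan_mult: "amult CP (ucan p q s) (ucan p q t) = ucan p q (s + t)"
  using chi_mult[OF Z_0 Z_0] by (simp add: ucan_eq emb_mult mono_closed CX_chi mono_mult act_chi Z_0)

lemma ucan_zpow:
  assumes "k \<in> Z"
  shows "amult CP (ucan p q s) (zpow p q k) = amult CP (zpow p q (scal s k)) (ucan p q s)"
  using assms chi_mult[OF Z_0 scal_closed[OF assms, of s]] chi_mult[OF scal_closed[OF assms, of s] Z_0]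
  by (simp add: ucan_eq zpow_eq emb_mult mono_closed CX_chi mono_mult act_chi Z_0)

lemma zpow_star: "k \<in> Z \<Longrightarrow> astar CP (zpow p q k) = zpow p q (- k)"
  by (simp add: zpow_eq emb_star mono_closed CX_chi mono_star chi_cnj act_chi Zloc_uminus)

lemma ucan_star: "astar CP (ucan p q s) = ucan p q (- s)"
  using chi_cnj[OF Z_0] by (simp add: ucan_eq emb_star mono_closed CX_chi mono_star act_chi Z_0)

text \<open>Restriction to the convolution algebra makes the sup norm estimate
  \<open>CC_fun_le\<close> available on the completion.\<close>

lemma CC_rep_of_CP_rep:
  assumes "star_rep CP H \<pi>"
  shows "star_rep CC H (\<lambda>F. \<pi> (emb F))"
proof -
  note rep = star_repD[OF assms]
  show ?thesis
    unfolding star_rep_def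
    by (auto simp: rep emb_closed emb_add[symmetric] emb_scale[symmetric] emb_mult[symmetric]
        emb_star[symmetric])
qed

end

locale crossed_rep = two_bases p q + hilbert_space H
  for p q :: nat and H :: "('h, 'm) hilb_scheme" +
  fixes \<pi> :: "crossed_elt \<Rightarrow> 'h \<Rightarrow> 'h"
  assumes star_rep: "star_rep (crossed_product p q) H \<pi>"
begin

abbreviation "U s \<equiv> \<pi> (ucan p q s)"
abbreviation "E k \<equiv> \<pi> (zpow p q k)"

lemmas rep = star_repD[OF star_rep]

lemma U_closed: "x \<in> carr H \<Longrightarrow> U s x \<in> carr H" and E_closed: "x \<in> carr H \<Longrightarrow> E k x \<in> carr H"
  by (simp_all add: rep(2) ucan_closed zpow_closed)

lemma U_U: "x \<in> carr H \<Longrightarrow> U s (U t x) = U (s + t) x"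
  by (simp add: rep(5)[symmetric] ucan_closed ucan_mult)

lemma E_E: "x \<in> carr H \<Longrightarrow> k \<in> Z \<Longrightarrow> l \<in> Z \<Longrightarrow> E k (E l x) = E (k + l) x"
  by (simp add: rep(5)[symmetric] zpow_closed zpow_mult)

lemma U_E: "x \<in> carr H \<Longrightarrow> k \<in> Z \<Longrightarrow> U s (E k x) = E (scal s k) (U s x)"
  by (simp add: rep(5)[symmetric] zpow_closed ucan_closed ucan_zpow)

lemma E_0: "E 0 = U 0"
  by (simp add: zpow_0)

lemma U_adj: "x \<in> carr H \<Longrightarrow> y \<in> carr H \<Longrightarrow> ip H (U s x) y = ip H x (U (- s) y)"
  using rep(6)[OF ucan_closed] by (simp add: ucan_star)

lemma E_adj: "x \<in> carr H \<Longrightarrow> y \<in> carr H \<Longrightarrow> k \<in> Z \<Longrightarrow> ip H (E k x) y = ip H x (E (- k) y)"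
  using rep(6)[OF zpow_closed] by (simp add: zpow_star)

lemma E_linear: "x \<in> carr H \<Longrightarrow> y \<in> carr H \<Longrightarrow> E k (vadd H x y) = vadd H (E k x) (E k y)"
  "x \<in> carr H \<Longrightarrow> E k (vscale H c x) = vscale H c (E k x)"
  using bounded_opsD(2,3)[OF rep(1)[OF zpow_closed]] by auto

lemma U_linear: "x \<in> carr H \<Longrightarrow> y \<in> carr H \<Longrightarrow> U s (vadd H x y) = vadd H (U s x) (U s y)"
  "x \<in> carr H \<Longrightarrow> U s (vscale H c x) = vscale H c (U s x)"
  using bounded_opsD(2,3)[OF rep(1)[OF ucan_closed]] by auto

section \<open>The elements commuting with a given operator\<close>

definition commutes :: "('h \<Rightarrow> 'h) \<Rightarrow> crossed_elt \<Rightarrow> bool" where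
  "commutes T a \<longleftrightarrow> (\<forall>x\<in>carr H. T (\<pi> a x) = \<pi> a (T x))"

lemma commutes_add:
  assumes "T \<in> bounded_ops H" "a \<in> carr CP" "b \<in> carr CP" "commutes T a" "commutes T b"
  shows "commutes T (vadd CP a b)"
  using assms by (simp add: commutes_def rep bounded_opsD)

lemma commutes_scale:
  assumes "T \<in> bounded_ops H" "a \<in> carr CP" "commutes T a"
  shows "commutes T (vscale CP c a)"
  using assms by (simp add: commutes_def rep bounded_opsD)

lemma commutes_mult:
  assumes "T \<in> bounded_ops H" "a \<in> carr CP" "b \<in> carr CP" "commutes T a" "commutes T b"
  shows "commutes T (amult CP a b)"
  using assms by (simp add: commutes_def rep bounded_opsD)

text \<open>Smallness of the error \<open>e\<close> is measured by its action on H, not by a norm on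
  the algebra, so the lemma applies both to uniform approximation of functions and to
  \<open>rep_approx\<close>.\<close>

lemma commutes_limit:
  assumes T: "T \<in> bounded_ops H" and a: "a \<in> carr CP"
    and approx: "\<And>\<epsilon>. \<epsilon> > 0 \<Longrightarrow> \<exists>b e. b \<in> carr CP \<and> e \<in> carr CP \<and> a = vadd CP b e \<and> commutes T b \<and>
      (\<forall>y\<in>carr H. hnorm H (\<pi> e y) \<le> \<epsilon> * hnorm H y)"
  shows "commutes T a"
  unfolding commutes_def
proof
  fix x assume x: "x \<in> carr H"
  obtain K where K: "K \<ge> 0" "\<And>x. x \<in> carr H \<Longrightarrow> hnorm H (T x) \<le> K * hnorm H x"
    using bounded_ops_bound[OF T] by blast
  note Tc = bounded_opsD[OF T]
  show "T (\<pi> a x) = \<pi> a (T x)"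
  proof (rule vec_eqI)
    fix v assume v: "v \<in> carr H"
    \<comment> \<open>The error enters once inside and once outside T, hence 2K; the summand 1 keeps
      \<open>M\<close> positive.\<close>
    define M where "M = 2 * K * hnorm H x * hnorm H v + 1"
    have M: "M > 0" using K by (simp add: M_def hnorm_nonneg x v add_nonneg_pos)
    have "cmod (ip H (T (\<pi> a x)) v - ip H (\<pi> a (T x)) v) \<le> \<delta>" if \<delta>: "\<delta> > 0" for \<delta>
    proof -
      define \<epsilon> where "\<epsilon> = \<delta> / M"
      have \<epsilon>: "\<epsilon> > 0" using \<delta> M by (simp add: \<epsilon>_def)
      obtain b e where be: "b \<in> carr CP" "e \<in> carr CP" "a = vadd CP b e" "commutes T b"
        and e: "\<And>y. y \<in> carr H \<Longrightarrow> hnorm H (\<pi> e y) \<le> \<epsilon> * hnorm H y"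
        using approx[OF \<epsilon>] by blast
      have "T (\<pi> b x) = \<pi> b (T x)" using be(4) x by (simp add: commutes_def)
      then have "ip H (T (\<pi> a x)) v - ip H (\<pi> a (T x)) v = ip H (T (\<pi> e x)) v - ip H (\<pi> e (T x)) v"
        using be x v by (simp add: rep Tc ip_add)
      also have "cmod \<dots> \<le> cmod (ip H (T (\<pi> e x)) v) + cmod (ip H (\<pi> e (T x)) v)"
        by (rule norm_triangle_ineq4)
      also have "\<dots> \<le> hnorm H (T (\<pi> e x)) * hnorm H v + hnorm H (\<pi> e (T x)) * hnorm H v"
        using be x v by (intro add_mono cauchy_schwarz) (simp_all add: rep Tc)
      also have "\<dots> \<le> K * (\<epsilon> * hnorm H x) * hnorm H v + \<epsilon> * (K * hnorm H x) * hnorm H v"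
      proof (intro add_mono mult_right_mono)
        show "hnorm H (T (\<pi> e x)) \<le> K * (\<epsilon> * hnorm H x)"
          using K(2)[of "\<pi> e x"] mult_left_mono[OF e[OF x] K(1)] be x by (simp add: rep)
        show "hnorm H (\<pi> e (T x)) \<le> \<epsilon> * (K * hnorm H x)"
          using \<epsilon> by (intro order_trans[OF e[OF Tc(1)[OF x]]] mult_left_mono K(2) x) simp
      qed (simp_all add: hnorm_nonneg v)
      also have "\<dots> \<le> \<epsilon> * M" using \<epsilon> by (simp add: M_def algebra_simps)
      also have "\<dots> = \<delta>" using M by (simp add: \<epsilon>_def)
      finally show ?thesis .
    qed
    then have "cmod (ip H (T (\<pi> a x)) v - ip H (\<pi> a (T x)) v) \<le> 0"
      by (rule field_le_epsilon[of _ 0, simplified])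
    then show "ip H (T (\<pi> a x)) v = ip H (\<pi> a (T x)) v" by simp
  qed (use a x in \<open>simp_all add: rep Tc\<close>)
qed

text \<open>Stone-Weierstrass is applied to a ring \<open>R\<close> of real functions. The real and
  imaginary parts of a coordinate are combinations of the characters k and -k, and coordinates
  separate points. Uniformly small remainders act by small operators because of
  \<open>CC_fun_le\<close>.\<close>

lemma commutes_function:
  assumes T: "T \<in> bounded_ops H" and E: "\<And>k. k \<in> Z \<Longrightarrow> commutes T (zpow p q k)" and f: "f \<in> CX"
  shows "commutes T (emb (mono 0 f))"
proof -
  define ext :: "((rat \<Rightarrow> complex) \<Rightarrow> real) \<Rightarrow> (rat \<Rightarrow> complex) \<Rightarrow> complex"
    where "ext r = (\<lambda>\<xi>. if \<xi> \<in> S then of_real (r \<xi>) else 0)" for r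
  define R where "R = {r. continuous_on S r \<and> commutes T (emb (mono 0 (ext r)))}"
  have ext: "ext r \<in> CX" if "continuous_on S r" for r
  proof (rule CX_I)
    have "continuous_on S (\<lambda>\<xi>. complex_of_real (r \<xi>))" using that by (intro continuous_intros)
    then show "continuous_on S (ext r)" by (rule continuous_on_eq) (simp add: ext_def)
  qed (simp add: ext_def)
  have C_add: "commutes T (emb (mono 0 (\<lambda>\<xi>. g \<xi> + h \<xi>)))"
    if "g \<in> CX" "h \<in> CX" "commutes T (emb (mono 0 g))" "commutes T (emb (mono 0 h))" for g h
    using commutes_add[OF T _ _ that(3,4)] that by (simp add: emb_add mono_closed emb_closed mono_add)
  have C_scale: "commutes T (emb (mono 0 (\<lambda>\<xi>. c * g \<xi>)))"
    if "g \<in> CX" "commutes T (emb (mono 0 g))" for g c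
    using commutes_scale[OF T _ that(2)] that by (simp add: emb_scale mono_closed emb_closed mono_scale)
  have C_mult: "commutes T (emb (mono 0 (\<lambda>\<xi>. g \<xi> * h \<xi>)))"
    if "g \<in> CX" "h \<in> CX" "commutes T (emb (mono 0 g))" "commutes T (emb (mono 0 h))" for g h
    using commutes_mult[OF T _ _ that(3,4)] that
    by (simp add: emb_mult mono_closed emb_closed mono_mult act_0)
  have C_chi: "commutes T (emb (mono 0 (chi k)))" if "k \<in> Z" for k
    using E[OF that] by (simp add: zpow_eq)
  have R_I: "r \<in> R" if "continuous_on S r" "k \<in> Z" "ext r = (\<lambda>\<xi>. c * chi k \<xi> + c' * chi (- k) \<xi>)"
    for r k c c'
    using that by (auto simp: R_def intro!: C_add C_scale C_chi CX_chi CX_scale Zloc_uminus)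
  have coord: "(\<lambda>\<xi>. Re (\<xi> k)) \<in> R" "(\<lambda>\<xi>. Im (\<xi> k)) \<in> R" if k: "k \<in> Z" for k
  proof -
    have cont: "continuous_on S (\<lambda>\<xi>. \<xi> k)"
      by (rule continuous_on_subset[OF continuous_on_product_coordinates]) auto
    have "ext (\<lambda>\<xi>. Re (\<xi> k)) = (\<lambda>\<xi>. (1/2) * chi k \<xi> + (1/2) * chi (- k) \<xi>)"
      using k by (auto simp: ext_def character_fun_def sol_uminus fun_eq_iff complex_eq_iff)
    with k show "(\<lambda>\<xi>. Re (\<xi> k)) \<in> R"
      by (intro R_I continuous_intros cont)
    have "ext (\<lambda>\<xi>. Im (\<xi> k)) = (\<lambda>\<xi>. (- \<i>/2) * chi k \<xi> + (\<i>/2) * chi (- k) \<xi>)"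
      using k by (auto simp: ext_def character_fun_def sol_uminus fun_eq_iff complex_eq_iff)
    with k show "(\<lambda>\<xi>. Im (\<xi> k)) \<in> R"
      by (intro R_I continuous_intros cont)
  qed
  interpret R: function_ring_on R S
  proof
    show "compact S" by (rule compact_solenoid)
    show "continuous_on S r" if "r \<in> R" for r using that by (simp add: R_def)
    fix r r' assume r: "r \<in> R" "r' \<in> R"
    have "ext (\<lambda>\<xi>. r \<xi> + r' \<xi>) = (\<lambda>\<xi>. ext r \<xi> + ext r' \<xi>)" by (auto simp: ext_def)
    with r show "(\<lambda>\<xi>. r \<xi> + r' \<xi>) \<in> R"
      by (auto simp: R_def intro!: C_add ext continuous_intros)
    have "ext (\<lambda>\<xi>. r \<xi> * r' \<xi>) = (\<lambda>\<xi>. ext r \<xi> * ext r' \<xi>)" by (auto simp: ext_def)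
    with r show "(\<lambda>\<xi>. r \<xi> * r' \<xi>) \<in> R"
      by (auto simp: R_def intro!: C_mult ext continuous_intros)
  next
    fix c :: real
    have "ext (\<lambda>_. c) = (\<lambda>\<xi>. of_real c * chi 0 \<xi>)" by (auto simp: ext_def character_fun_def sol_zero)
    then show "(\<lambda>_. c) \<in> R"
      by (auto simp: R_def intro!: C_scale C_chi CX_chi Z_0)
  next
    fix \<xi> \<eta> assume *: "\<xi> \<in> S" "\<eta> \<in> S" "\<xi> \<noteq> \<eta>"
    then obtain k where k: "\<xi> k \<noteq> \<eta> k" by auto
    \<comment> \<open>Outside \<open>Z\<close> both characters take the value
      \<open>undefined\<close>, so they can only differ on \<open>Z\<close>.\<close>
    then have "k \<in> Z" using * sol_D(2) by metis
    moreover have "Re (\<xi> k) \<noteq> Re (\<eta> k) \<or> Im (\<xi> k) \<noteq> Im (\<eta> k)"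
      using k by (auto simp: complex_eq_iff)
    ultimately show "\<exists>r\<in>R. r \<xi> \<noteq> r \<eta>"
      using bexI[of "\<lambda>r. r \<xi> \<noteq> r \<eta>", OF _ coord(1)[of k]]
        bexI[of "\<lambda>r. r \<xi> \<noteq> r \<eta>", OF _ coord(2)[of k]]
      by blast
  qed
  have dense: "\<exists>r\<in>R. \<forall>\<xi>\<in>S. \<bar>r0 \<xi> - r \<xi>\<bar> < \<epsilon>" if "continuous_on S r0" "\<epsilon> > 0" for r0 \<epsilon>
    using R.Stone_Weierstrass_basic[OF that] .
  show ?thesis
  proof (rule commutes_limit[OF T emb_closed[OF mono_closed[OF f]]])
    fix \<epsilon> :: real assume \<epsilon>: "\<epsilon> > 0"
    have fc: "continuous_on S (\<lambda>\<xi>. Re (f \<xi>))" "continuous_on S (\<lambda>\<xi>. Im (f \<xi>))"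
      by (intro continuous_intros CX_D f)+
    obtain r1 where r1: "r1 \<in> R" "\<And>\<xi>. \<xi> \<in> S \<Longrightarrow> \<bar>Re (f \<xi>) - r1 \<xi>\<bar> < \<epsilon>/2"
      using dense[OF fc(1), of "\<epsilon>/2"] \<epsilon> by auto
    obtain r2 where r2: "r2 \<in> R" "\<And>\<xi>. \<xi> \<in> S \<Longrightarrow> \<bar>Im (f \<xi>) - r2 \<xi>\<bar> < \<epsilon>/2"
      using dense[OF fc(2), of "\<epsilon>/2"] \<epsilon> by auto
    define g where "g = (\<lambda>\<xi>. ext r1 \<xi> + \<i> * ext r2 \<xi>)"
    define h where "h = (\<lambda>\<xi>. f \<xi> + (-1) * g \<xi>)"
    have g: "g \<in> CX" "commutes T (emb (mono 0 g))"
      using r1 r2 unfolding g_def R_def by (auto intro!: CX_add CX_scale C_add C_scale ext)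
    have h: "h \<in> CX" unfolding h_def by (intro CX_add CX_scale f g)
    have "cmod (h \<xi>) \<le> \<epsilon>" for \<xi>
    proof (cases "\<xi> \<in> S")
      case True
      have "cmod (h \<xi>) \<le> \<bar>Re (h \<xi>)\<bar> + \<bar>Im (h \<xi>)\<bar>" by (rule cmod_le)
      also have "\<dots> \<le> \<epsilon>/2 + \<epsilon>/2"
        using r1(2)[OF True] r2(2)[OF True] True by (simp add: h_def g_def ext_def)
      finally show ?thesis by simp
    qed (use \<epsilon> CX_D(2)[OF h] in simp)
    then have "\<forall>y\<in>carr H. hnorm H (\<pi> (emb (mono 0 h)) y) \<le> \<epsilon> * hnorm H y"
      using CC_fun_le[OF hilbert_space_axioms CC_rep_of_CP_rep[OF star_rep] _ h] \<epsilon> by auto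
    moreover have "emb (mono 0 f) = vadd CP (emb (mono 0 g)) (emb (mono 0 h))"
      by (simp add: emb_add mono_closed g h mono_add) (simp add: h_def)
    ultimately show "\<exists>b e. b \<in> carr CP \<and> e \<in> carr CP \<and> emb (mono 0 f) = vadd CP b e \<and> commutes T b \<and>
      (\<forall>y\<in>carr H. hnorm H (\<pi> e y) \<le> \<epsilon> * hnorm H y)"
      using g h by (intro exI[of _ "emb (mono 0 g)"] exI[of _ "emb (mono 0 h)"])
        (simp add: emb_closed mono_closed)
  qed
qed

lemma commutes_conv:
  assumes T: "T \<in> bounded_ops H" and E: "\<And>k. k \<in> Z \<Longrightarrow> commutes T (zpow p q k)"
    and U: "\<And>s. commutes T (ucan p q s)" and F: "F \<in> carr CC"
  shows "commutes T (emb F)"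
  using F
proof (induction F rule: CC_induct)
  case zero
  have "vzero CC = mono 0 (\<lambda>\<xi>. 0)" by (auto simp: CC_ops mono_def)
  then show ?case using commutes_function[OF T E CX_zero] by simp
next
  case (add F s f)
  have "emb (mono s f) = amult CP (emb (mono 0 f)) (ucan p q s)"
    by (simp add: ucan_eq emb_mult mono_closed CX_chi add mono_factor)
  then have "commutes T (emb (mono s f))"
    using commutes_mult[OF T _ ucan_closed commutes_function[OF T E add(2)] U]
    by (simp add: emb_closed mono_closed add)
  then show ?case
    using commutes_add[OF T _ _ add(3)] add by (simp add: emb_add[symmetric] emb_closed mono_closed)
qed

text \<open>The generators reach the dense convolution algebra, and \<open>rep_approx\<close> makes
  the remainder small as an operator.\<close>

theorem commutantI:
  assumes T: "T \<in> bounded_ops H"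
    and E: "\<And>k x. k \<in> Z \<Longrightarrow> x \<in> carr H \<Longrightarrow> T (E k x) = E k (T x)"
    and U: "\<And>s x. x \<in> carr H \<Longrightarrow> T (U s x) = U s (T x)"
  shows "T \<in> commutant CP H \<pi>"
proof -
  have "commutes T a" if a: "a \<in> carr CP" for a
  proof (rule commutes_limit[OF T a])
    fix \<epsilon> :: real assume \<epsilon>: "\<epsilon> > 0"
    obtain F b where "F \<in> carr CC" "b \<in> carr CP" "a = vadd CP (emb F) b"
      "\<And>y. y \<in> carr H \<Longrightarrow> hnorm H (\<pi> b y) \<le> \<epsilon> * hnorm H y"
      using conv.rep_approx[OF hilbert_space_axioms star_rep[unfolded crossed_product_def]
          a[unfolded crossed_product_def] \<epsilon>]
      unfolding crossed_product_def[symmetric] conv_embed_def[symmetric] by blast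
    moreover have "commutes T (emb F)" if "F \<in> carr CC" for F
      using commutes_conv[OF T _ _ that] E U by (simp add: commutes_def)
    ultimately show "\<exists>b e. b \<in> carr CP \<and> e \<in> carr CP \<and> a = vadd CP b e \<and> commutes T b \<and>
      (\<forall>y\<in>carr H. hnorm H (\<pi> e y) \<le> \<epsilon> * hnorm H y)"
      by (intro exI[of _ "emb F"] exI[of _ b]) (auto simp: emb_closed)
  qed
  then show ?thesis using T by (simp add: commutant_def commutes_def)
qed

end

section \<open>Finitely supported measures on the circle\<close>

text \<open>X is the set of atoms. It is instantiated by \<open>msupport \<mu>\<close> for a given
  measure and by \<open>spec\<close> for the constructed one.\<close>

locale finite_circle_measure =
  fixes \<mu> :: "complex measure" and X :: "complex set"
  assumes prob: "circle_prob \<mu>" and fin: "finite X" and sub: "X \<subseteq> sphere 0 1"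
    and conc: "AE z in \<mu>. z \<in> X" and pos: "z \<in> X \<Longrightarrow> measure \<mu> {z} > 0"
begin

sublocale prob_space \<mu>
  using prob by (simp add: circle_prob_def)

lemma sets_eq: "sets \<mu> = sets (restrict_space borel (sphere 0 1))"
  using prob by (simp add: circle_prob_def)

lemma space_eq: "space \<mu> = sphere 0 1"
  using sets_eq_imp_space_eq[OF sets_eq] by (simp add: space_restrict_space)

lemma finite_sets: "B \<subseteq> X \<Longrightarrow> B \<in> sets \<mu>"
  unfolding sets_eq sets_restrict_space using finite_subset[OF _ fin, of B] sub
  by (auto intro!: image_eqI[of _ _ B] borel_closed finite_imp_closed)

lemma measurable_borel: "f \<in> borel_measurable borel \<Longrightarrow> f \<in> borel_measurable \<mu>"
  using measurable_restrict_space1[of f borel borel "sphere 0 1"] measurable_cong_sets[OF sets_eq refl]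
  by blast

lemma power_measurable: "(\<lambda>z. z ^ r) \<in> measurable \<mu> \<mu>"
proof -
  have "(\<lambda>z::complex. z ^ r) \<in> measurable (restrict_space borel (sphere 0 1)) (restrict_space borel (sphere 0 1))"
    by (intro measurable_restrict_space3) (auto simp: norm_power)
  then show ?thesis using measurable_cong_sets[OF sets_eq sets_eq] by blast
qed

lemma power_comp_measurable: "f \<in> borel_measurable \<mu> \<Longrightarrow> (\<lambda>z. f (z ^ r)) \<in> borel_measurable \<mu>"
  using measurable_comp[OF power_measurable] by (simp add: comp_def)

lemma ident_measurable: "(\<lambda>z. z) \<in> borel_measurable \<mu>"
  by (rule measurable_borel) simp

lemma emeasure_pos: "z \<in> X \<Longrightarrow> emeasure \<mu> {z} > 0"
  using pos[of z] by (simp add: emeasure_eq_measure)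

text \<open>Points of X have positive mass and the complement of X has none. Thus a class in
  \<open>L2 \<mu>\<close> is determined by the values on X.\<close>

lemma AE_iff: "(AE z in \<mu>. P z) \<longleftrightarrow> (\<forall>z\<in>X. P z)"
proof
  assume P: "AE z in \<mu>. P z"
  then obtain N where N: "{z \<in> space \<mu>. \<not> P z} \<subseteq> N" "emeasure \<mu> N = 0" "N \<in> sets \<mu>"
    by (auto elim: AE_E)
  show "\<forall>z\<in>X. P z"
  proof (rule ballI, rule ccontr)
    fix z assume z: "z \<in> X" "\<not> P z"
    then have "z \<in> space \<mu>" using sub space_eq by blast
    then have "{z} \<subseteq> N" using N(1) z by blast
    from emeasure_mono[OF this N(3)] show False using emeasure_pos[OF z(1)] N(2) by simp
  qed
next
  assume "\<forall>z\<in>X. P z"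
  with conc show "AE z in \<mu>. P z" by (auto elim: eventually_mono)
qed

lemma X_nonempty: "X \<noteq> {}"
  using AE_iff[of "\<lambda>_. False"] by simp

lemma integral_eq:
  fixes f :: "complex \<Rightarrow> complex"
  assumes "f \<in> borel_measurable \<mu>"
  shows "integral\<^sup>L \<mu> f = (\<Sum>z\<in>X. of_real (measure \<mu> {z}) * f z)"
proof -
  have m: "{z} \<in> sets \<mu>" if "z \<in> X" for z using that by (intro finite_sets) auto
  have "integral\<^sup>L \<mu> f = integral\<^sup>L \<mu> (\<lambda>z. \<Sum>a\<in>X. indicator {a} z *\<^sub>R f a)"
  proof (rule integral_cong_AE)
    show "AE z in \<mu>. f z = (\<Sum>a\<in>X. indicator {a} z *\<^sub>R f a)"
      unfolding AE_iff
    proof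
      fix z assume "z \<in> X"
      moreover have "(\<Sum>a\<in>X. indicator {a} z *\<^sub>R f a) = (\<Sum>a\<in>X. if z = a then f a else 0)"
        by (intro sum.cong) auto
      ultimately show "f z = (\<Sum>a\<in>X. indicator {a} z *\<^sub>R f a)" by (simp add: fin)
    qed
    show "(\<lambda>z. \<Sum>a\<in>X. indicator {a} z *\<^sub>R f a) \<in> borel_measurable \<mu>"
      by (intro borel_measurable_sum borel_measurable_scaleR borel_measurable_indicator m) auto
  qed (rule assms)
  also have "\<dots> = (\<Sum>a\<in>X. integral\<^sup>L \<mu> (\<lambda>z. indicator {a} z *\<^sub>R f a))"
    by (rule Bochner_Integration.integral_sum)
      (auto intro!: integrable_scaleR_left integrable_real_indicator m simp: emeasure_eq_measure)
  also have "\<dots> = (\<Sum>a\<in>X. of_real (measure \<mu> {a}) * f a)"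
    using m by (intro sum.cong refl)
      (simp add: integral_scaleR_left integrable_real_indicator emeasure_eq_measure scaleR_conv_of_real
        Int_absorb2 sets.sets_into_space)
  finally show ?thesis .
qed

lemma l2_eq: "l2_funs \<mu> = borel_measurable \<mu>"
proof -
  have "integrable \<mu> (\<lambda>z. (cmod (f z))\<^sup>2)" if f: "f \<in> borel_measurable \<mu>" for f :: "complex \<Rightarrow> complex"
  proof (rule integrable_const_bound)
    show "AE z in \<mu>. norm ((cmod (f z))\<^sup>2) \<le> (\<Sum>z\<in>X. (cmod (f z))\<^sup>2)"
      unfolding AE_iff by (auto intro!: member_le_sum fin)
  qed (use f in measurable)
  then show ?thesis by (auto simp: l2_funs_def)
qed

text \<open>A measurable representative with arbitrarily prescribed values on X.\<close>

definition cut :: "(complex \<Rightarrow> complex) \<Rightarrow> complex \<Rightarrow> complex" where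
  "cut f = (\<lambda>z. if z \<in> X then f z else 0)"

lemma cut_measurable: "cut f \<in> borel_measurable \<mu>"
proof -
  have "cut f = (\<lambda>z. \<Sum>a\<in>X. indicator {a} z * f a)"
  proof
    fix z
    have "(\<Sum>a\<in>X. indicator {a} z * f a) = (\<Sum>a\<in>X. if z = a then f a else 0)"
      by (intro sum.cong) auto
    then show "cut f z = (\<Sum>a\<in>X. indicator {a} z * f a)" by (simp add: fin cut_def)
  qed
  moreover have "(\<lambda>z. \<Sum>a\<in>X. indicator {a} z * f a) \<in> borel_measurable \<mu>"
    by (intro borel_measurable_sum borel_measurable_times borel_measurable_indicator finite_sets) auto
  ultimately show ?thesis by simp
qed

lemma ae_rel_iff: "(f, g) \<in> ae_rel \<mu> \<longleftrightarrow> f \<in> borel_measurable \<mu> \<and> g \<in> borel_measurable \<mu> \<and> (\<forall>z\<in>X. f z = g z)"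
  by (simp add: ae_rel_def l2_eq AE_iff)

lemma equiv_ae_rel: "equiv (borel_measurable \<mu>) (ae_rel \<mu>)"
  by (rule equivI) (auto simp: refl_on_def sym_def trans_def ae_rel_iff)

lemma ae_class_eq:
  "f \<in> borel_measurable \<mu> \<Longrightarrow> g \<in> borel_measurable \<mu> \<Longrightarrow> ae_class \<mu> f = ae_class \<mu> g \<longleftrightarrow> (\<forall>z\<in>X. f z = g z)"
  unfolding ae_class_def by (subst eq_equiv_class_iff[OF equiv_ae_rel]) (auto simp: ae_rel_iff)

lemma rep_of_ae_class:
  assumes "f \<in> borel_measurable \<mu>"
  shows "rep_of (ae_class \<mu> f) \<in> borel_measurable \<mu>" and "z \<in> X \<Longrightarrow> rep_of (ae_class \<mu> f) z = f z"
proof -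
  have "f \<in> ae_class \<mu> f" using assms by (simp add: ae_class_def ae_rel_iff)
  then have "rep_of (ae_class \<mu> f) \<in> ae_class \<mu> f"
    unfolding rep_of_def by (rule someI[of "\<lambda>g. g \<in> ae_class \<mu> f"])
  then have "(f, rep_of (ae_class \<mu> f)) \<in> ae_rel \<mu>" by (simp add: ae_class_def)
  then show "rep_of (ae_class \<mu> f) \<in> borel_measurable \<mu>" "z \<in> X \<Longrightarrow> rep_of (ae_class \<mu> f) z = f z"
    by (auto simp: ae_rel_iff)
qed

lemma carr_L2: "carr (L2 \<mu>) = ae_class \<mu> ` borel_measurable \<mu>"
  by (auto simp: L2_def quotient_def ae_class_def l2_eq)

lemma L2_ops:
  assumes "f \<in> borel_measurable \<mu>" "g \<in> borel_measurable \<mu>"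
  shows "vadd (L2 \<mu>) (ae_class \<mu> f) (ae_class \<mu> g) = ae_class \<mu> (\<lambda>z. f z + g z)"
    and "vscale (L2 \<mu>) c (ae_class \<mu> f) = ae_class \<mu> (\<lambda>z. c * f z)"
    and "ip (L2 \<mu>) (ae_class \<mu> f) (ae_class \<mu> g) = (\<Sum>z\<in>X. of_real (measure \<mu> {z}) * (f z * cnj (g z)))"
proof -
  note r = rep_of_ae_class[OF assms(1)] rep_of_ae_class[OF assms(2)]
  show "vadd (L2 \<mu>) (ae_class \<mu> f) (ae_class \<mu> g) = ae_class \<mu> (\<lambda>z. f z + g z)"
    using assms r by (simp add: L2_def ae_class_eq)
  show "vscale (L2 \<mu>) c (ae_class \<mu> f) = ae_class \<mu> (\<lambda>z. c * f z)"
    using assms r by (simp add: L2_def ae_class_eq)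
  have "(\<lambda>z. rep_of (ae_class \<mu> f) z * cnj (rep_of (ae_class \<mu> g) z)) \<in> borel_measurable \<mu>"
    using r borel_measurable_continuous_on[of cnj, OF _ r(3)]
    by (intro borel_measurable_times) (auto intro: continuous_intros)
  then show "ip (L2 \<mu>) (ae_class \<mu> f) (ae_class \<mu> g) = (\<Sum>z\<in>X. of_real (measure \<mu> {z}) * (f z * cnj (g z)))"
    using r by (simp add: L2_def integral_eq)
qed

text \<open>The preimage of {z^r} contains z, so by invariance z^r has positive mass, and points
  outside X have none.\<close>

lemma invariant_power_closed:
  assumes "times_invariant r \<mu>" "z \<in> X"
  shows "z ^ r \<in> X"
proof -
  have w: "z ^ r \<in> space \<mu>" using assms sub by (auto simp: space_eq norm_power)
  then have s: "{z ^ r} \<in> sets \<mu>"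
    unfolding sets_eq space_eq sets_restrict_space by (auto intro!: image_eqI[of _ _ "{z ^ r}"])
  have "{z} \<subseteq> {x \<in> space \<mu>. x ^ r \<in> {z ^ r}}" using assms sub space_eq by auto
  moreover have "{x \<in> space \<mu>. x ^ r \<in> {z ^ r}} \<in> sets \<mu>"
    using measurable_sets[OF power_measurable s, of r] by (simp add: vimage_def Int_def conj_commute)
  ultimately have "emeasure \<mu> {z} \<le> emeasure \<mu> {x \<in> space \<mu>. x ^ r \<in> {z ^ r}}"
    by (rule emeasure_mono)
  also have "\<dots> = emeasure \<mu> {z ^ r}"
    using assms(1) s unfolding times_invariant_def by blast
  finally have "emeasure \<mu> {z ^ r} > 0" using emeasure_pos[OF assms(2)] by simp
  moreover have "emeasure \<mu> {z ^ r} = 0" if "z ^ r \<notin> X"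
  proof -
    have "AE x in \<mu>. x \<notin> {z ^ r}" unfolding AE_iff using that by auto
    then have "{z ^ r} \<in> null_sets \<mu>" using AE_iff_null_sets[OF s] by blast
    then show ?thesis by (simp add: null_sets_def)
  qed
  ultimately show ?thesis by (metis less_irrefl)
qed

text \<open>Ergodicity concerns Borel subsets of the circle with exact invariance, whereas a level
  set of g is invariant only inside X. It is therefore saturated before ergodicity is
  applied.\<close>

lemma ergodic_constant:
  assumes "times_invariant p \<mu>" "times_invariant q \<mu>" "times_ergodic p q \<mu>"
    and g: "\<And>z. z \<in> X \<Longrightarrow> g (z ^ p) = g z" "\<And>z. z \<in> X \<Longrightarrow> g (z ^ q) = g z"
  obtains c where "\<And>z. z \<in> X \<Longrightarrow> g z = c"
proof -
  obtain z0 where z0: "z0 \<in> X" using X_nonempty by auto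
  define A where "A = {z \<in> X. g z = g z0}"
  \<comment> \<open>All points of the circle whose forward orbit meets \<open>A\<close>. Since
    \<open>A\<close> is forward closed, \<open>E\<close> equals its preimages under both
    maps.\<close>
  define E where "E = {z \<in> space \<mu>. \<exists>m n. z ^ (p ^ m * q ^ n) \<in> A}"
  have A: "A \<in> sets \<mu>" by (intro finite_sets) (auto simp: A_def)
  have "E = (\<Union>m. \<Union>n. (\<lambda>z. z ^ (p ^ m * q ^ n)) -` A \<inter> space \<mu>)" by (auto simp: E_def)
  also have "\<dots> \<in> sets \<mu>"
    by (intro sets.countable_UN image_subsetI measurable_sets[OF power_measurable A])
  finally have E: "E \<in> sets \<mu>" .
  have clA: "z ^ p \<in> A" "z ^ q \<in> A" if "z \<in> A" for z
    using that invariant_power_closed[OF assms(1)] invariant_power_closed[OF assms(2)] g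
    by (auto simp: A_def)
  have sp: "z ^ r \<in> space \<mu>" if "z \<in> space \<mu>" for z r
    using that by (auto simp: space_eq norm_power)
  have "{z \<in> space \<mu>. z ^ p \<in> E} = E"
  proof (intro set_eqI iffI)
    fix z assume "z \<in> {z \<in> space \<mu>. z ^ p \<in> E}"
    then obtain m n where z: "z \<in> space \<mu>" "(z ^ p) ^ (p ^ m * q ^ n) \<in> A" by (auto simp: E_def)
    have "z ^ (p ^ Suc m * q ^ n) \<in> A" using z(2) by (simp add: power_mult[symmetric] mult.assoc)
    then show "z \<in> E" using z unfolding E_def by blast
  next
    fix z assume "z \<in> E"
    then obtain m n where z: "z \<in> space \<mu>" "z ^ (p ^ m * q ^ n) \<in> A" by (auto simp: E_def)
    have "(z ^ p) ^ (p ^ m * q ^ n) \<in> A"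
      using clA(1)[OF z(2)] by (simp add: power_mult[symmetric] mult.commute)
    then show "z \<in> {z \<in> space \<mu>. z ^ p \<in> E}" using z sp unfolding E_def by blast
  qed
  moreover have "{z \<in> space \<mu>. z ^ q \<in> E} = E"
  proof (intro set_eqI iffI)
    fix z assume "z \<in> {z \<in> space \<mu>. z ^ q \<in> E}"
    then obtain m n where z: "z \<in> space \<mu>" "(z ^ q) ^ (p ^ m * q ^ n) \<in> A" by (auto simp: E_def)
    have "z ^ (p ^ m * q ^ Suc n) \<in> A" using z(2) by (simp add: power_mult[symmetric] ac_simps)
    then show "z \<in> E" using z unfolding E_def by blast
  next
    fix z assume "z \<in> E"
    then obtain m n where z: "z \<in> space \<mu>" "z ^ (p ^ m * q ^ n) \<in> A" by (auto simp: E_def)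
    have "(z ^ q) ^ (p ^ m * q ^ n) \<in> A"
      using clA(2)[OF z(2)] by (simp add: power_mult[symmetric] mult.commute)
    then show "z \<in> {z \<in> space \<mu>. z ^ q \<in> E}" using z sp unfolding E_def by blast
  qed
  ultimately have "measure \<mu> E \<in> {0, 1}" using assms(3) E unfolding times_ergodic_def by blast
  moreover have "measure \<mu> E > 0"
  proof -
    have "z0 \<in> space \<mu>" using z0 sub space_eq by auto
    moreover have "z0 ^ (p ^ 0 * q ^ 0) \<in> A" using z0 by (simp add: A_def)
    ultimately have "z0 \<in> E" unfolding E_def by blast
    then have "measure \<mu> {z0} \<le> measure \<mu> E" using E by (intro finite_measure_mono) auto
    then show ?thesis using pos[OF z0] by simp
  qed
  ultimately have "prob E = 1" by auto
  then have inE: "\<forall>z\<in>X. z \<in> E" using prob_eq_1[OF E] by (simp add: AE_iff)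
  have it: "z ^ (p ^ m * q ^ n) \<in> X \<and> g (z ^ (p ^ m * q ^ n)) = g z" if "z \<in> X" for z m n
  proof (induction m)
    case 0
    show ?case
    proof (induction n)
      case (Suc n)
      have eq: "z ^ (p ^ 0 * q ^ Suc n) = (z ^ (p ^ 0 * q ^ n)) ^ q"
        by (simp only: power_mult[symmetric] power_Suc ac_simps)
      from Suc show ?case
        unfolding eq using g(2) invariant_power_closed[OF assms(2)] by metis
    qed (use that in simp)
  next
    case (Suc m)
    have eq: "z ^ (p ^ Suc m * q ^ n) = (z ^ (p ^ m * q ^ n)) ^ p"
      by (simp only: power_mult[symmetric] power_Suc ac_simps)
    from Suc show ?case
      unfolding eq using g(1) invariant_power_closed[OF assms(1)] by metis
  qed
  have "g z = g z0" if z: "z \<in> X" for z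
  proof -
    obtain m n where "z ^ (p ^ m * q ^ n) \<in> A" using inE z by (auto simp: E_def)
    then show ?thesis using it[OF z, of m n] by (simp add: A_def)
  qed
  then show ?thesis by (rule that)
qed

text \<open>The forward orbit of z under the r-th power stays in the finite set X, so z^(r^i) =
  z^(r^j) for some i < j. The product of the individual orders serves all of X.\<close>

lemma roots_of_unity:
  assumes "times_invariant r \<mu>" "r > 1"
  obtains n where "n > 0" "\<And>z. z \<in> X \<Longrightarrow> z ^ n = 1"
proof -
  have "\<exists>n>0. z ^ n = 1" if z: "z \<in> X" for z
  proof -
    have it: "z ^ (r ^ k) \<in> X" for k
    proof (induction k)
      case (Suc k)
      then show ?case
        using invariant_power_closed[OF assms(1), of "z ^ r ^ k"] by (simp add: power_mult[symmetric] mult.commute)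
    qed (use z in simp)
    then have "finite (range (\<lambda>k. z ^ (r ^ k)))" using fin by (auto intro: finite_subset)
    then have "\<not> inj (\<lambda>k. z ^ (r ^ k))" using finite_imageD infinite_UNIV_nat by blast
    then obtain i j where ij: "i < j" "z ^ (r ^ i) = z ^ (r ^ j)"
      unfolding inj_def by (metis linorder_neqE_nat)
    then have lt: "r ^ i < r ^ j" using assms by simp
    have "z ^ (r ^ i) * z ^ (r ^ j - r ^ i) = z ^ (r ^ j)"
      using lt by (simp add: power_add[symmetric])
    then have "z ^ (r ^ i) * z ^ (r ^ j - r ^ i) = z ^ (r ^ i) * 1"
      using ij by simp
    moreover have "z ^ (r ^ i) \<noteq> 0" using z sub by auto
    ultimately show ?thesis using lt by (intro exI[of _ "r ^ j - r ^ i"]) auto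
  qed
  then obtain n where n: "\<And>z. z \<in> X \<Longrightarrow> n z > 0 \<and> z ^ n z = 1" by metis
  have "z ^ (\<Prod>a\<in>X. n a) = 1" if "z \<in> X" for z
    using n[OF that] that fin by (simp add: prod.remove[of X z] power_mult)
  moreover have "(\<Prod>a\<in>X. n a) > 0" using n by (simp add: prod_pos)
  ultimately show ?thesis using that by blast
qed

end

text \<open>The complement of the support is null because, by Lindelof, countably many null open
  sets cover it. Finiteness isolates each support point, whose neighbourhood mass is then its own
  mass.\<close>

lemma finite_msupport:
  assumes "circle_prob \<mu>" "finite (msupport \<mu>)"
  shows "finite_circle_measure \<mu> (msupport \<mu>)"
proof -
  interpret prob_space \<mu> using assms by (simp add: circle_prob_def)
  have sets_eq: "sets \<mu> = sets (restrict_space borel (sphere 0 1))"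
    using assms by (simp add: circle_prob_def)
  have space_eq: "space \<mu> = sphere 0 1"
    using sets_eq_imp_space_eq[OF sets_eq] by (simp add: space_restrict_space)
  have open_sets: "U \<inter> space \<mu> \<in> sets \<mu>" if "open U" for U
    unfolding sets_eq space_eq sets_restrict_space using that by (auto simp: Int_commute)
  define \<U> where "\<U> = {U. open U \<and> emeasure \<mu> (U \<inter> space \<mu>) = 0}"
  obtain \<U>' where \<U>': "\<U>' \<subseteq> \<U>" "countable \<U>'" "\<Union>\<U>' = \<Union>\<U>"
    using Lindelof[of \<U>] unfolding \<U>_def by blast
  have "(\<Union>U\<in>\<U>'. U \<inter> space \<mu>) \<in> null_sets \<mu>"
    using \<U>' open_sets by (intro null_sets_UN') (auto simp: \<U>_def null_sets_def)
  moreover have "{z \<in> space \<mu>. z \<notin> msupport \<mu>} \<subseteq> (\<Union>U\<in>\<U>'. U \<inter> space \<mu>)"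
  proof
    fix z assume "z \<in> {z \<in> space \<mu>. z \<notin> msupport \<mu>}"
    then obtain U where "z \<in> space \<mu>" "open U" "z \<in> U" "emeasure \<mu> (U \<inter> space \<mu>) = 0"
      by (auto simp: msupport_def)
    then have "z \<in> \<Union>\<U>" "z \<in> space \<mu>" by (auto simp: \<U>_def)
    then show "z \<in> (\<Union>U\<in>\<U>'. U \<inter> space \<mu>)" using \<U>'(3) by auto
  qed
  ultimately have ae: "AE z in \<mu>. z \<in> msupport \<mu>" by (rule AE_I')
  have "measure \<mu> {z} > 0" if z: "z \<in> msupport \<mu>" for z
  proof -
    define U where "U = - (msupport \<mu> - {z})"
    have U: "open U" "z \<in> U"
      using assms unfolding U_def by (auto simp del: Compl_Diff_eq intro!: open_Compl finite_imp_closed)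
    then have "0 < emeasure \<mu> (U \<inter> space \<mu>)" using z by (auto simp: msupport_def)
    also have "emeasure \<mu> (U \<inter> space \<mu>) = emeasure \<mu> {z}"
    proof (rule emeasure_eq_AE)
      show "AE x in \<mu>. (x \<in> U \<inter> space \<mu>) = (x \<in> {z})"
        using ae AE_space by eventually_elim (use U z in \<open>auto simp: U_def msupport_def\<close>)
      have "z \<in> space \<mu>" using z by (simp add: msupport_def)
      then show "{z} \<in> sets \<mu>"
        unfolding sets_eq space_eq sets_restrict_space by (auto intro!: image_eqI[of _ _ "{z}"])
    qed (rule open_sets[OF U(1)])
    finally show ?thesis by (simp add: emeasure_eq_measure)
  qed
  then show ?thesis
    using assms ae by unfold_locales (auto simp: msupport_def space_eq)
qed

section \<open>Representations induced by a measure\<close>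

context crossed_rep
begin

lemma U_fixed_generators:
  assumes x: "x \<in> carr H" and "U (1, 0) x = x" "U (0, 1) x = x"
  shows "U s x = x"
proof -
  \<comment> \<open>\<open>U 0\<close> need not be the identity on H, but it fixes x because it
    fixes everything in the range of \<open>U (1, 0)\<close>.\<close>
  have U0: "U 0 x = x"
    using U_U[OF x, of 0 "(1, 0)"] assms by simp
  have add: "U (s + t) x = x" if "U s x = x" "U t x = x" for s t
    using U_U[OF x, of s t] that by simp
  have minus: "U (- s) x = x" if "U s x = x" for s
    using U_U[OF x, of "- s" s] that U0 by simp
  have nat1: "U (int m, 0) x = x" for m
    by (induction m) (use U0 add[of "(1, 0)"] assms in \<open>auto simp: zero_prod_def\<close>)
  have nat2: "U (0, int n) x = x" for n
    by (induction n) (use U0 add[of "(0, 1)"] assms in \<open>auto simp: zero_prod_def\<close>)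
  have "U (m, 0) x = x" for m
    using nat1[of "nat \<bar>m\<bar>"] minus[OF nat1[of "nat \<bar>m\<bar>"]] by (cases "m \<ge> 0") auto
  moreover have "U (0, n) x = x" for n
    using nat2[of "nat \<bar>n\<bar>"] minus[OF nat2[of "nat \<bar>n\<bar>"]] by (cases "n \<ge> 0") auto
  ultimately show ?thesis using add[of "(fst s, 0)" "(0, snd s)"] by simp
qed

lemma induced_necessary:
  assumes "circle_prob \<mu>" and inv: "times_invariant p \<mu>" "times_invariant q \<mu>"
    and erg: "times_ergodic p q \<mu>" and "finite (msupport \<mu>)" and ind: "induced_by p q H \<pi> \<mu>"
  shows "irreducible_rep CP H \<pi>" and "fixed_vectors p q H \<pi> \<noteq> {vzero H}"
    and "\<exists>N::int. N \<noteq> 0 \<and> (\<forall>x\<in>fixed_vectors p q H \<pi>. E (of_int N) x = x)"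
proof -
  define X where "X = msupport \<mu>"
  interpret M: finite_circle_measure \<mu> X
    unfolding X_def by (rule finite_msupport) fact+
  let ?B = "borel_measurable \<mu>"
  obtain \<rho> W where \<rho>: "measure_rep p q \<mu> \<rho>" and W: "unitary_map H (L2 \<mu>) W"
    and WI: "\<And>a x. a \<in> carr CP \<Longrightarrow> x \<in> carr H \<Longrightarrow> W (\<pi> a x) = \<rho> a (W x)"
    using ind unfolding induced_by_def unitarily_equivalent_def by blast
  have bij: "bij_betw W (carr H) (carr (L2 \<mu>))"
    and W_add: "\<And>x y. x \<in> carr H \<Longrightarrow> y \<in> carr H \<Longrightarrow> W (vadd H x y) = vadd (L2 \<mu>) (W x) (W y)"
    and W_scale: "\<And>c x. x \<in> carr H \<Longrightarrow> W (vscale H c x) = vscale (L2 \<mu>) c (W x)"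
    and W_ip: "\<And>x y. x \<in> carr H \<Longrightarrow> y \<in> carr H \<Longrightarrow> ip (L2 \<mu>) (W x) (W y) = ip H x y"
    using W by (auto simp: unitary_map_def)
  \<comment> \<open>\<open>w\<close> lets functions serve as names for vectors of H, so the action
    on H can be computed by the formulas on \<open>L2 \<mu>\<close>.\<close>
  define w where "w f = inv_into (carr H) W (ae_class \<mu> f)" for f
  have w: "w f \<in> carr H" "W (w f) = ae_class \<mu> f" if "f \<in> ?B" for f
  proof -
    have "ae_class \<mu> f \<in> W ` carr H" using bij that by (auto simp: bij_betw_def M.carr_L2)
    then show "w f \<in> carr H" "W (w f) = ae_class \<mu> f"
      unfolding w_def by (rule inv_into_into, rule f_inv_into_f)
  qed
  have w_eqI: "x = w f" if "x \<in> carr H" "f \<in> ?B" "W x = ae_class \<mu> f" for x f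
    unfolding w_def using bij_betw_inv_into_left[OF bij that(1)] that(3) by simp
  have w_surj: "\<exists>f\<in>?B. x = w f" if "x \<in> carr H" for x
  proof -
    have "W x \<in> ae_class \<mu> ` ?B" using bij that by (auto simp: bij_betw_def M.carr_L2)
    then show ?thesis using w_eqI that by auto
  qed
  have w_cong: "w f = w g" if "f \<in> ?B" "g \<in> ?B" "\<And>z. z \<in> X \<Longrightarrow> f z = g z" for f g
    using M.ae_class_eq[OF that(1,2)] that(3) unfolding w_def by simp
  have w_inj: "f z = g z" if "f \<in> ?B" "g \<in> ?B" "w f = w g" "z \<in> X" for f g z
    using M.ae_class_eq[OF that(1,2)] w(2)[OF that(1)] w(2)[OF that(2)] that(3,4) by simp
  have w_add: "vadd H (w f) (w g) = w (\<lambda>z. f z + g z)" if "f \<in> ?B" "g \<in> ?B" for f g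
    using that by (intro w_eqI) (simp_all add: w add_closed W_add M.L2_ops(1))
  have w_scale: "vscale H c (w f) = w (\<lambda>z. c * f z)" if "f \<in> ?B" for f c
    using that by (intro w_eqI) (simp_all add: w scale_closed W_scale M.L2_ops(2)[OF that that])
  have gen: "\<rho> (ucan p q (1, 0)) (ae_class \<mu> f) = ae_class \<mu> (\<lambda>z. f (z ^ p))"
    "\<rho> (ucan p q (0, 1)) (ae_class \<mu> f) = ae_class \<mu> (\<lambda>z. f (z ^ q))"
    "\<rho> (zpow p q 1) (ae_class \<mu> f) = ae_class \<mu> (\<lambda>z. z * f z)" if "f \<in> ?B" for f
    using \<rho> that by (auto simp: measure_rep_def M.l2_eq)
  have zm: "(\<lambda>z. z * f z) \<in> ?B" if "f \<in> ?B" for f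
    using that M.ident_measurable by simp
  have Up: "U (1, 0) (w f) = w (\<lambda>z. f (z ^ p))" if "f \<in> ?B" for f
    using that by (intro w_eqI) (simp_all add: U_closed w WI ucan_closed gen M.power_comp_measurable)
  have Uq: "U (0, 1) (w f) = w (\<lambda>z. f (z ^ q))" if "f \<in> ?B" for f
    using that by (intro w_eqI) (simp_all add: U_closed w WI ucan_closed gen M.power_comp_measurable)
  have E1: "E 1 (w f) = w (\<lambda>z. z * f z)" if "f \<in> ?B" for f
    using that by (intro w_eqI) (simp_all add: E_closed w WI zpow_closed gen zm)
  define e where "e = w (\<lambda>z. 1)"
  have e: "e \<in> carr H" by (simp add: e_def w)
  have e_fixed: "U s e = e" for s
    by (rule U_fixed_generators[OF e]) (simp_all add: e_def Up Uq)
  have scale_e: "vscale H c e = w (\<lambda>z. c)" for c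
    unfolding e_def by (subst w_scale) simp_all
  have fixed: "\<exists>c. y = vscale H c e" if y: "y \<in> carr H" "U (1, 0) y = y" "U (0, 1) y = y" for y
  proof -
    obtain g where g: "g \<in> ?B" "y = w g" using w_surj y by blast
    have "g (z ^ p) = g z" "g (z ^ q) = g z" if "z \<in> X" for z
      using w_inj[OF M.power_comp_measurable g(1) _ that, of g p] w_inj[OF M.power_comp_measurable g(1) _ that, of g q]
        g y Up Uq by auto
    then obtain c where "\<And>z. z \<in> X \<Longrightarrow> g z = c"
      using M.ergodic_constant[OF inv erg] by metis
    then have "y = w (\<lambda>z. c)" unfolding g using g(1) by (intro w_cong) auto
    then show ?thesis by (auto simp: scale_e)
  qed
  have fixed_vec: "fixed_vectors p q H \<pi> = {x \<in> carr H. \<forall>s. U s x = x}"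
    by (simp add: fixed_vectors_def)
  show "irreducible_rep CP H \<pi>"
    unfolding irreducible_rep_def
  proof
    fix T assume "T \<in> commutant CP H \<pi>"
    then have T: "T \<in> bounded_ops H"
      and TU: "\<And>s x. x \<in> carr H \<Longrightarrow> T (U s x) = U s (T x)"
      and TE: "\<And>k x. x \<in> carr H \<Longrightarrow> T (E k x) = E k (T x)"
      by (auto simp: commutant_def ucan_closed zpow_closed)
    have "T e \<in> carr H" using bounded_opsD(1)[OF T e] .
    moreover have "U s (T e) = T e" for s using TU[OF e, of s] e_fixed by simp
    ultimately obtain c where c: "T e = vscale H c e" using fixed by blast
    \<comment> \<open>The functions on which T already acts as the scalar \<open>c\<close>; closure
      under multiplication by z brings in all polynomials.\<close>
    define P where "P = {f \<in> ?B. T (w f) = vscale H c (w f)}"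
    have P1: "(\<lambda>z. 1) \<in> P" using c by (simp add: P_def e_def)
    have Pz: "(\<lambda>z. z * f z) \<in> P" if "f \<in> P" for f
      using that zm[of f] TE[of "w f" 1] E_linear(2)[of "w f" 1 c] by (auto simp: P_def w E1)
    have P_scale: "(\<lambda>z. a * f z) \<in> P" if "f \<in> P" for f a
      using that by (auto simp: P_def w w_scale[symmetric] bounded_opsD[OF T] scale_scale mult.commute)
    have P_add: "(\<lambda>z. f z + g z) \<in> P" if "f \<in> P" "g \<in> P" for f g
      using that by (auto simp: P_def w w_add[symmetric] bounded_opsD[OF T] scale_add_right)
    have P_lin: "(\<lambda>z. (z - a) * f z) \<in> P" if "f \<in> P" for f a
      using P_add[OF Pz[OF that] P_scale[OF that, of "- a"]] by (simp add: algebra_simps)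
    have P_prod: "(\<lambda>z. \<Prod>a\<in>A. z - a) \<in> P" if "finite A" for A
      using that by (induction A rule: finite_induct) (simp_all add: P1 P_lin)
    have P_sum: "(\<lambda>z. \<Sum>b\<in>A. f b z) \<in> P" if "finite A" "\<And>b. b \<in> A \<Longrightarrow> f b \<in> P" for A f
      using that
      by (induction A rule: finite_induct) (use P_scale[OF P1, of 0] in \<open>simp_all add: P_add\<close>)
    have "T x = vscale H c x" if x: "x \<in> carr H" for x
    proof -
      obtain f where f: "f \<in> ?B" "x = w f" using w_surj x by blast
      \<comment> \<open>Lagrange interpolation: \<open>l\<close> is a polynomial that agrees with f
        on X, hence represents the same vector.\<close>
      define l where "l z = (\<Sum>b\<in>X. (f b / (\<Prod>a\<in>X - {b}. b - a)) * (\<Prod>a\<in>X - {b}. z - a))" for z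
      have "l \<in> P"
        unfolding l_def by (intro P_sum P_scale P_prod) (auto simp: M.fin)
      moreover have "l z = f z" if z: "z \<in> X" for z
      proof -
        have "(f b / (\<Prod>a\<in>X - {b}. b - a)) * (\<Prod>a\<in>X - {b}. z - a) = (if b = z then f z else 0)" for b
          using z M.fin by (auto simp: prod_zero_iff)
        then show ?thesis unfolding l_def using z M.fin by simp
      qed
      ultimately have "w f = w l" using f by (intro w_cong) (auto simp: P_def)
      then show ?thesis using f \<open>l \<in> P\<close> by (simp add: P_def)
    qed
    then show "\<exists>c. \<forall>x\<in>carr H. T x = vscale H c x" by blast
  qed
  have "e \<in> fixed_vectors p q H \<pi>" using e e_fixed by (simp add: fixed_vec)
  moreover have "e \<noteq> vzero H"
  proof
    assume "e = vzero H"
    then have "ip (L2 \<mu>) (W e) (W e) = 0" using W_ip[OF e e] ip_zero[OF e] by simp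
    then have "(\<Sum>z\<in>X. complex_of_real (measure \<mu> {z})) = 0"
      unfolding e_def by (simp add: w M.L2_ops(3))
    then have "(\<Sum>z\<in>X. measure \<mu> {z}) = 0"
      by (simp only: of_real_sum[symmetric] of_real_eq_0_iff)
    moreover have "(\<Sum>z\<in>X. measure \<mu> {z}) > 0"
      using M.X_nonempty M.fin M.pos by (intro sum_pos) auto
    ultimately show False by simp
  qed
  ultimately show "fixed_vectors p q H \<pi> \<noteq> {vzero H}" by auto
  obtain n where n: "n > 0" "\<And>z. z \<in> X \<Longrightarrow> z ^ n = 1"
    using M.roots_of_unity[OF inv(1) p] by blast
  have pw: "(\<lambda>z. z ^ k) \<in> ?B" for k using M.ident_measurable by (rule borel_measurable_power)
  have Ek: "E (of_nat k) e = w (\<lambda>z. z ^ k)" for k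
  proof (induction k)
    case 0
    show ?case using e_fixed by (simp add: E_0 e_def)
  next
    case (Suc k)
    have "E (of_nat (Suc k)) e = E 1 (E (of_nat k) e)"
      using E_E[OF e, of 1 "of_nat k"] Zloc_of_int[of "int k" p q] by (simp add: Z_1)
    then show ?case using Suc by (simp add: E1 pw)
  qed
  have "w (\<lambda>z. z ^ n) = e"
    unfolding e_def using n pw by (intro w_cong) auto
  then have En: "E (of_nat n) e = e" by (simp add: Ek)
  have "E (of_int (int n)) x = x" if x: "x \<in> fixed_vectors p q H \<pi>" for x
  proof -
    obtain c where "x = vscale H c e" using fixed[of x] x by (auto simp: fixed_vec)
    then show ?thesis using En e by (simp add: E_linear)
  qed
  then show "\<exists>N::int. N \<noteq> 0 \<and> (\<forall>x\<in>fixed_vectors p q H \<pi>. E (of_int N) x = x)"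
    using n by (intro exI[of _ "int n"]) auto
qed

end

section \<open>Spectral decomposition of an invariant vector\<close>

context crossed_rep
begin

text \<open>Taking adjoints in T \<open>\<pi> a\<close> = \<open>\<pi> a\<close> T gives a
  commutation relation for the same T because T is self-adjoint.\<close>

lemma commutes_star:
  assumes T: "T \<in> bounded_ops H" and a: "a \<in> carr CP" "astar CP a \<in> carr CP" "commutes T a"
    and adj: "\<And>u v. u \<in> carr H \<Longrightarrow> v \<in> carr H \<Longrightarrow> ip H (T u) v = ip H u (T v)"
  shows "commutes T (astar CP a)"
  unfolding commutes_def
proof
  fix u assume u: "u \<in> carr H"
  note Tc = bounded_opsD(1)[OF T]
  have star: "ip H (\<pi> (astar CP a) u) v = ip H u (\<pi> a v)" if "u \<in> carr H" "v \<in> carr H" for u v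
    using rep(6)[OF a(1) that(2,1)] that
    by (metis a ip_commute rep(2))
  show "T (\<pi> (astar CP a) u) = \<pi> (astar CP a) (T u)"
  proof (rule vec_eqI)
    fix v assume v: "v \<in> carr H"
    have "ip H (T (\<pi> (astar CP a) u)) v = ip H u (\<pi> a (T v))"
      using u v a by (simp add: adj star rep(2) Tc)
    also have "\<dots> = ip H u (T (\<pi> a v))" using a v by (simp add: commutes_def)
    also have "\<dots> = ip H (\<pi> (astar CP a) (T u)) v"
      using u v a by (simp add: adj[symmetric] star rep(2) Tc)
    finally show "ip H (T (\<pi> (astar CP a) u)) v = ip H (\<pi> (astar CP a) (T u)) v" .
  qed (use u a in \<open>simp_all add: rep Tc\<close>)
qed

text \<open>Adjoints provide the inverses of the three generators, products the integer exponents.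
  For k = a/(pq)^m the unitary of z^k is conjugated to that of z^a by u_(m,m).\<close>

lemma commutant_selfadjointI:
  assumes T: "T \<in> bounded_ops H"
    and adj: "\<And>u v. u \<in> carr H \<Longrightarrow> v \<in> carr H \<Longrightarrow> ip H (T u) v = ip H u (T v)"
    and E1: "commutes T (zpow p q 1)"
    and U1: "commutes T (ucan p q (1, 0))" and U2: "commutes T (ucan p q (0, 1))"
  shows "T \<in> commutant CP H \<pi>"
proof -
  have U_star: "commutes T (ucan p q (- s))" if "commutes T (ucan p q s)" for s
    using commutes_star[OF T ucan_closed _ that adj] by (simp add: ucan_star ucan_closed)
  have U_add: "commutes T (ucan p q (s + t))" if "commutes T (ucan p q s)" "commutes T (ucan p q t)" for s t
    using commutes_mult[OF T ucan_closed ucan_closed that] by (simp add: ucan_mult)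
  have E_star: "commutes T (zpow p q (- k))" if "commutes T (zpow p q k)" "k \<in> Z" for k
    using commutes_star[OF T zpow_closed _ that(1) adj] that(2) by (simp add: zpow_star zpow_closed)
  have E_add: "commutes T (zpow p q (k + l))" if "commutes T (zpow p q k)" "commutes T (zpow p q l)" "k \<in> Z" "l \<in> Z" for k l
    using commutes_mult[OF T zpow_closed zpow_closed that(1,2)] that(3,4) by (simp add: zpow_mult)
  have U0: "commutes T (ucan p q 0)"
    using U_add[OF U1 U_star[OF U1]] by (simp add: zero_prod_def)
  have nat1: "commutes T (ucan p q (int m, 0))" for m
  proof (induction m)
    case (Suc m)
    then show ?case using U_add[OF U1 Suc] by simp
  qed (use U0 in \<open>simp flip: zero_prod_def\<close>)
  have nat2: "commutes T (ucan p q (0, int m))" for m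
  proof (induction m)
    case (Suc m)
    then show ?case using U_add[OF U2 Suc] by simp
  qed (use U0 in \<open>simp flip: zero_prod_def\<close>)
  have "commutes T (ucan p q (m, 0))" for m
    using nat1[of "nat \<bar>m\<bar>"] U_star[OF nat1[of "nat \<bar>m\<bar>"]] by (cases "m \<ge> 0") auto
  moreover have "commutes T (ucan p q (0, m))" for m
    using nat2[of "nat \<bar>m\<bar>"] U_star[OF nat2[of "nat \<bar>m\<bar>"]] by (cases "m \<ge> 0") auto
  ultimately have U: "commutes T (ucan p q s)" for s
    using U_add[of "(fst s, 0)" "(0, snd s)"] by simp
  have natE: "commutes T (zpow p q (of_nat m))" for m
  proof (induction m)
    case (Suc m)
    then show ?case
      using E_add[OF E1 Suc Z_1] Zloc_of_int[of "int m" p q] by simp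
  qed (use U0 in \<open>simp add: zpow_0\<close>)
  have intE: "commutes T (zpow p q (of_int m))" for m
    using natE[of "nat \<bar>m\<bar>"] E_star[OF natE[of "nat \<bar>m\<bar>"]] Zloc_of_int[of "int (nat \<bar>m\<bar>)" p q]
    by (cases "m \<ge> 0") (auto simp: abs_if)
  show ?thesis
  proof (rule commutantI[OF T])
    fix k u assume k: "k \<in> Z" and u: "u \<in> carr H"
    then obtain a m where km: "k = of_int a / of_nat (p * q) ^ m" by (auto simp: Zloc_def)
    define s where "s = (int m, int m)"
    have sk: "scal s k = of_int a"
      using p q by (simp add: scal_def s_def km power_mult_distrib)
    \<comment> \<open>\<open>U (- s)\<close> composed with \<open>U s\<close> is only
      \<open>U 0\<close>, which equals \<open>E 0\<close> and is absorbed by \<open>E k\<close>; no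
      unitality is assumed.\<close>
    have conj: "E k v = U (- s) (E (of_int a) (U s v))" if v: "v \<in> carr H" for v
      using v k by (simp add: sk[symmetric] U_E[symmetric] U_U E_closed)
        (simp add: E_0[symmetric] E_E Z_0)
    show "T (E k u) = E k (T u)"
      using u U intE bounded_opsD(1)[OF T] by (simp add: conj commutes_def U_closed E_closed)
  qed (use U in \<open>simp add: commutes_def\<close>)
qed

end

section \<open>Roots of unity and character sums\<close>

definition roots :: "nat \<Rightarrow> complex set" where
  "roots n = {z. z ^ n = 1}"

lemma finite_roots: "n > 0 \<Longrightarrow> finite (roots n)"
  unfolding roots_def by (rule finite_roots_unity) simp

lemma norm_roots: "z \<in> roots n \<Longrightarrow> n > 0 \<Longrightarrow> cmod z = 1"
  unfolding roots_def using power_eq_1_iff[of z n] by auto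

lemma cnj_roots: "z \<in> roots n \<Longrightarrow> n > 0 \<Longrightarrow> cnj z * z = 1"
  using norm_roots[of z n] complex_norm_square[of z] by (simp add: mult.commute)

lemma power_roots: "z \<in> roots n \<Longrightarrow> z ^ k \<in> roots n"
  by (simp add: roots_def power_commutes[symmetric] power_mult[symmetric] mult.commute[of k])
    (simp add: power_mult)

lemma sum_powers_root:
  assumes "z \<in> roots n" "n > 0"
  shows "(\<Sum>j<n. z ^ j) = (if z = 1 then of_nat n else 0)"
  using assms geometric_sum[of z n] by (auto simp: roots_def)

text \<open>Writing the roots as c_0, ..., c_(n-1), one has c_m^k = c_k^m, so the sum is geometric
  with ratio c_k, which is 1 only for k = 0.\<close>

lemma sum_roots_power:
  assumes "k < n"
  shows "(\<Sum>z\<in>roots n. z ^ k) = (if k = 0 then of_nat n else 0)"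
proof -
  let ?c = "\<lambda>m. cis (2 * pi * real m / real n)"
  have bij: "bij_betw ?c {..<n} (roots n)"
    unfolding roots_def using Complex.bij_betw_roots_unity[of n] assms by simp
  have "(\<Sum>z\<in>roots n. z ^ k) = (\<Sum>m<n. ?c m ^ k)"
    by (rule sum.reindex_bij_betw[OF bij, symmetric])
  also have "\<dots> = (\<Sum>m<n. ?c k ^ m)"
    by (intro sum.cong refl) (simp only: Complex.DeMoivre mult_ac times_divide_eq_right)
  also have "\<dots> = (if ?c k = 1 then of_nat n else 0)"
    using assms bij by (intro sum_powers_root) (auto simp: bij_betw_def)
  also have "?c k = 1 \<longleftrightarrow> k = 0"
    using bij_betw_imp_inj_on[OF bij] assms inj_on_eq_iff[of ?c "{..<n}" k 0] by simp
  finally show ?thesis .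
qed

text \<open>The unit norm of x makes the masses sum to 1. \<open>unital\<close> is derived from
  irreducibility in \<open>induced_sufficient\<close>.\<close>

locale fixed_vector_rep = crossed_rep p q H \<pi>
  for p q :: nat and H :: "('h, 'm) hilb_scheme" and \<pi> +
  fixes x :: 'h and n :: nat
  assumes x: "x \<in> carr H" and x_norm: "ip H x x = 1" and U_x: "\<And>s. U s x = x"
    and n: "n > 0" and E_n: "E (of_nat n) x = x"
    and unital: "\<And>v. v \<in> carr H \<Longrightarrow> U 0 v = v"
begin

abbreviation "R \<equiv> roots n"

lemma U_isom: "u \<in> carr H \<Longrightarrow> v \<in> carr H \<Longrightarrow> ip H (U s u) (U s v) = ip H u v"
  by (simp add: U_adj U_closed U_U unital)

lemma E1_isom: "u \<in> carr H \<Longrightarrow> v \<in> carr H \<Longrightarrow> ip H (E 1 u) (E 1 v) = ip H u v"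
  by (simp add: E_adj E_closed E_E Z_1 Zloc_uminus E_0 unital)

definition a :: "nat \<Rightarrow> 'h" where "a j = E (of_nat j) x"

lemma a_closed: "a j \<in> carr H"
  by (simp add: a_def E_closed x)

lemma Z_nat: "of_nat j \<in> Z"
  using Zloc_of_int[of "int j" p q] by simp

lemma a_0: "a 0 = x"
  by (simp add: a_def E_0 U_x)

lemma a_add_n: "a (j + n) = a j"
  using E_E[OF x Z_nat Z_nat, of j n] by (simp add: a_def E_n)

lemma E1_a: "E 1 (a j) = a (Suc j)"
  using E_E[OF x Z_1 Z_nat] by (simp add: a_def)

text \<open>Up to normalisation, the spectral projection of \<open>x\<close> for the eigenvalue \<open>z\<close> of \<open>\<pi>(z\<^sup>1)\<close>.\<close>

definition y :: "complex \<Rightarrow> 'h" where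
  "y z = vscale H (1 / of_nat n) (vsum (\<lambda>j. vscale H (cnj z ^ j) (a j)) {..<n})"

lemma y_closed: "y z \<in> carr H"
  by (simp add: y_def scale_closed vsum a_closed)

lemma ip_y: "v \<in> carr H \<Longrightarrow> ip H (y z) v = (1 / of_nat n) * (\<Sum>j<n. cnj z ^ j * ip H (a j) v)"
  by (simp add: y_def ip_scale scale_closed vsum a_closed)

text \<open>\<open>E 1\<close> shifts the index j of the Fourier sum by one, which costs the factor
  z; the sum closes up because the terms are n-periodic.\<close>

lemma E1_y:
  assumes z: "z \<in> R"
  shows "E 1 (y z) = vscale H z (y z)"
proof (rule vec_eqI)
  fix v assume v: "v \<in> carr H"
  define g where "g j = cnj z ^ j * ip H (a j) v" for j
  have "cnj z ^ n = 1" using z by (simp add: roots_def flip: complex_cnj_power)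
  then have g: "g n = g 0" using a_add_n[of 0] by (simp add: g_def)
  have "ip H (E 1 (y z)) v = (1 / of_nat n) * (\<Sum>j<n. cnj z ^ j * ip H (a (Suc j)) v)"
    using v by (simp add: E_adj y_closed Z_1 ip_y E_closed) (simp add: E_adj[symmetric] a_closed Z_1 E1_a)
  also have "(\<Sum>j<n. cnj z ^ j * ip H (a (Suc j)) v) = (\<Sum>j<n. z * g (Suc j))"
  proof (intro sum.cong refl)
    fix j
    have "z * g (Suc j) = (cnj z * z) * (cnj z ^ j * ip H (a (Suc j)) v)" by (simp add: g_def)
    then show "cnj z ^ j * ip H (a (Suc j)) v = z * g (Suc j)"
      by (simp only: cnj_roots[OF z n] mult_1)
  qed
  also have "\<dots> = z * (\<Sum>j<n. g (Suc j))" by (simp add: sum_distrib_left)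
  also have "(\<Sum>j<n. g (Suc j)) = (\<Sum>j<n. g j)"
    using sum.lessThan_Suc_shift[of g n] sum.lessThan_Suc[of g n] g by simp
  also have "(1 / of_nat n) * (z * (\<Sum>j<n. g j)) = ip H (vscale H z (y z)) v"
    using v by (simp add: ip_scale y_closed ip_y g_def)
  finally show "ip H (E 1 (y z)) v = ip H (vscale H z (y z)) v" .
qed (simp_all add: E_closed scale_closed y_closed)

text \<open>Fourier inversion at index 0: summing over the roots kills every j except j = 0.\<close>

lemma ip_x_expand: 
  assumes v: "v \<in> carr H"
  shows "ip H x v = (\<Sum>z\<in>R. ip H (y z) v)"
proof -
  have "(\<Sum>z\<in>R. ip H (y z) v) = (\<Sum>z\<in>R. \<Sum>j<n. (1 / of_nat n) * (cnj z ^ j * ip H (a j) v))"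
    using v by (simp only: ip_y sum_distrib_left)
  also have "\<dots> = (\<Sum>j<n. \<Sum>z\<in>R. (1 / of_nat n) * (cnj z ^ j * ip H (a j) v))"
    by (rule sum.swap)
  also have "\<dots> = (1 / of_nat n) * (\<Sum>j<n. (\<Sum>z\<in>R. cnj z ^ j) * ip H (a j) v)"
    by (simp only: sum_distrib_left sum_distrib_right)
  also have "(\<Sum>j<n. (\<Sum>z\<in>R. cnj z ^ j) * ip H (a j) v)
      = (\<Sum>j<n. if j = 0 then of_nat n * ip H x v else 0)"
  proof (intro sum.cong refl)
    fix j assume "j \<in> {..<n}"
    then have "cnj (\<Sum>z\<in>R. z ^ j) = (if j = 0 then of_nat n else 0)"
      by (subst sum_roots_power) auto
    then show "(\<Sum>z\<in>R. cnj z ^ j) * ip H (a j) v = (if j = 0 then of_nat n * ip H x v else 0)"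
      by (auto simp: a_0)
  qed
  finally show ?thesis using n by simp
qed

lemma ip_a_expand:
  assumes v: "v \<in> carr H"
  shows "ip H (a k) v = (\<Sum>z\<in>R. z ^ k * ip H (y z) v)"
  using v
proof (induction k arbitrary: v)
  case 0
  then show ?case by (simp add: a_0 ip_x_expand)
next
  case (Suc k)
  have "ip H (a (Suc k)) v = ip H (a k) (E (- 1) v)"
    using Suc by (simp add: E1_a[symmetric] E_adj a_closed Z_1)
  also have "\<dots> = (\<Sum>z\<in>R. z ^ k * ip H (y z) (E (- 1) v))"
    using Suc by (simp add: E_closed)
  also have "\<dots> = (\<Sum>z\<in>R. z ^ Suc k * ip H (y z) v)"
    using Suc by (intro sum.cong refl)
      (simp add: E_adj[symmetric] y_closed Z_1 E1_y ip_scale)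
  finally show ?case .
qed

text \<open>Eigenvectors of an isometry: z \<open>cnj w\<close> = 1 would force z = w as w has
  modulus 1.\<close>

lemma y_orthogonal:
  assumes "z \<in> R" "w \<in> R" "z \<noteq> w"
  shows "ip H (y z) (y w) = 0"
proof -
  have "ip H (y z) (y w) = ip H (E 1 (y z)) (E 1 (y w))"
    by (simp add: E1_isom y_closed)
  also have "\<dots> = z * cnj w * ip H (y z) (y w)"
    using assms by (simp add: E1_y ip_scale ip_scale_right y_closed scale_closed)
  finally have "(z * cnj w - 1) * ip H (y z) (y w) = 0" by (simp add: algebra_simps)
  moreover have "z * cnj w \<noteq> 1"
  proof
    assume "z * cnj w = 1"
    then have "z * (cnj w * w) = w" by (simp add: mult.assoc[symmetric])
    then show False using cnj_roots[OF assms(2) n] assms(3) by simp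
  qed
  ultimately show ?thesis by simp
qed

definition mass :: "complex \<Rightarrow> real" where "mass z = (hnorm H (y z))\<^sup>2"

lemma ip_y_y: "z \<in> R \<Longrightarrow> w \<in> R \<Longrightarrow> ip H (y z) (y w) = (if z = w then of_real (mass z) else 0)"
  using y_orthogonal by (auto simp: mass_def ip_self y_closed)

lemma mass_nonneg: "mass z \<ge> 0"
  by (simp add: mass_def)

lemma mass_zero: "mass z = 0 \<longleftrightarrow> y z = vzero H"
  by (simp add: mass_def hnorm_eq_zero y_closed)

definition spec :: "complex set" where "spec = {z \<in> R. mass z > 0}"

lemma spec_R: "spec \<subseteq> R" and finite_spec: "finite spec"
  using finite_subset[of spec R] finite_roots[OF n] by (auto simp: spec_def)

lemma R_not_spec: "z \<in> R \<Longrightarrow> z \<notin> spec \<Longrightarrow> mass z = 0"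
  using mass_nonneg[of z] by (simp add: spec_def)

lemma sum_mass: "(\<Sum>z\<in>spec. mass z) = 1"
proof -
  have fin: "finite R" by (rule finite_roots[OF n])
  have "ip H x (y z) = of_real (mass z)" if "z \<in> R" for z
    using that by (simp add: ip_x_expand y_closed ip_y_y fin)
  then have xy: "ip H (y z) x = of_real (mass z)" if "z \<in> R" for z
    using that ip_commute[OF x y_closed[of z]] by simp
  have "1 = (\<Sum>z\<in>R. ip H (y z) x)" using ip_x_expand[OF x] x_norm by simp
  also have "\<dots> = of_real (\<Sum>z\<in>R. mass z)" by (simp add: xy)
  also have "(\<Sum>z\<in>R. mass z) = (\<Sum>z\<in>spec. mass z)"
    by (rule sum.mono_neutral_right) (auto simp: fin spec_R R_not_spec subsetD[OF spec_R])
  finally show ?thesis by (metis of_real_eq_1_iff)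
qed

lemma spec_nonempty: "spec \<noteq> {}"
  using sum_mass by auto

end

text \<open>Treats both power maps at once: r = p with s = (1, 0), and r = q with s = (0,
  1).\<close>

locale fixed_vector_power = fixed_vector_rep p q H \<pi> x n
  for p q :: nat and H :: "('h, 'm) hilb_scheme" and \<pi> x n +
  fixes r :: nat and s :: "int \<times> int"
  assumes scal_s: "\<And>k. scal s k = k * of_nat r"
begin

lemma U_a: "U s (a j) = a (r * j)"
  using U_E[OF x Z_nat, of s j] by (simp add: a_def U_x scal_s mult.commute)

text \<open>\<open>U s\<close> takes \<open>a j\<close> to \<open>a (r * j)\<close>. Expanding the
  latter in eigenvectors w leaves the sum over j of (\<open>cnj z\<close> w^r)^j, which selects w^r
  = z.\<close>

lemma ip_U_y:
  assumes z: "z \<in> R" and v: "v \<in> carr H"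
  shows "ip H (U s (y z)) v = (\<Sum>w | w \<in> R \<and> w ^ r = z. ip H (y w) v)"
proof -
  have fin: "finite R" by (rule finite_roots[OF n])
  have "ip H (U s (y z)) v = (1 / of_nat n) * (\<Sum>j<n. cnj z ^ j * ip H (a (r * j)) v)"
    using v by (simp add: U_adj y_closed ip_y U_closed) (simp add: U_adj[symmetric] a_closed U_a)
  also have "(\<Sum>j<n. cnj z ^ j * ip H (a (r * j)) v)
      = (\<Sum>j<n. \<Sum>w\<in>R. (cnj z * w ^ r) ^ j * ip H (y w) v)"
    using v by (simp add: ip_a_expand sum_distrib_left power_mult power_mult_distrib mult.assoc)
  also have "\<dots> = (\<Sum>w\<in>R. (\<Sum>j<n. (cnj z * w ^ r) ^ j) * ip H (y w) v)"
    by (subst sum.swap) (simp add: sum_distrib_right)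
  also have "\<dots> = (\<Sum>w\<in>R. if w ^ r = z then of_nat n * ip H (y w) v else 0)"
  proof (intro sum.cong refl)
    fix w assume w: "w \<in> R"
    have "cnj z ^ n = 1" using z by (simp add: roots_def flip: complex_cnj_power)
    then have "cnj z * w ^ r \<in> R"
      using power_roots[OF w, of r] by (simp add: roots_def power_mult_distrib)
    moreover have "cnj z * w ^ r = 1 \<longleftrightarrow> w ^ r = z"
    proof
      assume "cnj z * w ^ r = 1"
      then have "(cnj z * z) * w ^ r = z" by (simp add: mult_ac)
      then show "w ^ r = z" by (simp add: cnj_roots[OF z n])
    qed (simp add: cnj_roots[OF z n])
    ultimately show "(\<Sum>j<n. (cnj z * w ^ r) ^ j) * ip H (y w) v
        = (if w ^ r = z then of_nat n * ip H (y w) v else 0)"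
      by (simp add: sum_powers_root n)
  qed
  also have "\<dots> = of_nat n * (\<Sum>w | w \<in> R \<and> w ^ r = z. ip H (y w) v)"
    by (simp add: sum.If_cases[OF fin] sum_distrib_left Int_def)
  finally show ?thesis using n by simp
qed

text \<open>\<open>U s\<close> preserves the norm of \<open>y z\<close>, and the eigenvectors over
  the fibre are orthogonal. This is invariance of the measure, read at the atom z.\<close>

lemma mass_fibre:
  assumes z: "z \<in> R"
  shows "mass z = (\<Sum>w | w \<in> R \<and> w ^ r = z. mass w)"
proof -
  have fin: "finite {w. w \<in> R \<and> w ^ r = z}" using finite_roots[OF n] by auto
  have *: "ip H (y w) (U s (y z)) = of_real (mass w)" if "w \<in> R" "w ^ r = z" for w
  proof -
    have "ip H (U s (y z)) (y w) = of_real (mass w)"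
      using that fin by (simp add: ip_U_y z y_closed ip_y_y) 
    then show ?thesis using ip_commute[of "U s (y z)" "y w"] by (simp add: U_closed y_closed)
  qed
  have "of_real (mass z) = ip H (U s (y z)) (U s (y z))"
    using z by (simp add: U_isom y_closed ip_y_y)
  also have "\<dots> = of_real (\<Sum>w | w \<in> R \<and> w ^ r = z. mass w)"
    by (simp add: ip_U_y[OF z] U_closed y_closed *)
  finally show ?thesis by (simp only: of_real_eq_iff)
qed

lemma spec_power_image: "(\<lambda>z. z ^ r) ` spec = spec"
proof (intro set_eqI iffI)
  fix z assume "z \<in> (\<lambda>z. z ^ r) ` spec"
  then obtain w where w: "w \<in> spec" "z = w ^ r" by auto
  then have wR: "w \<in> R" and z: "z \<in> R" using spec_R power_roots by auto
  have fin: "finite {w. w \<in> R \<and> w ^ r = z}" using finite_roots[OF n] by auto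
  have "mass w \<le> (\<Sum>w | w \<in> R \<and> w ^ r = z. mass w)"
    using fin wR w by (intro member_le_sum) (auto simp: mass_nonneg)
  then show "z \<in> spec" using w z mass_fibre[OF z] by (simp add: spec_def)
next
  fix z assume z: "z \<in> spec"
  then have "(\<Sum>w | w \<in> R \<and> w ^ r = z. mass w) > 0"
    using mass_fibre[of z] by (simp add: spec_def)
  then obtain w where "w \<in> R" "w ^ r = z" "mass w \<noteq> 0"
    by (metis (mono_tags, lifting) less_irrefl mem_Collect_eq sum.neutral)
  then show "z \<in> (\<lambda>z. z ^ r) ` spec" using R_not_spec by auto
qed

text \<open>A surjection of a finite set onto itself is injective. Each fibre thus contains one
  point of positive mass, which collapses the fibre sums.\<close>

lemma spec_power_inj: "inj_on (\<lambda>z. z ^ r) spec"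
  using spec_power_image finite_spec by (simp add: eq_card_imp_inj_on)

lemma fibre_sum:
  assumes z: "z \<in> spec" and f: "\<And>w. w \<in> R \<Longrightarrow> w \<notin> spec \<Longrightarrow> f w = (0 :: 'b :: comm_monoid_add)"
  shows "(\<Sum>w | w \<in> R \<and> w ^ r = z ^ r. f w) = f z"
proof -
  have "(\<Sum>w | w \<in> R \<and> w ^ r = z ^ r. f w) = (\<Sum>w\<in>{z}. f w)"
  proof (rule sum.mono_neutral_right)
    show "finite {w. w \<in> R \<and> w ^ r = z ^ r}" using finite_roots[OF n] by auto
    show "{z} \<subseteq> {w. w \<in> R \<and> w ^ r = z ^ r}" using z spec_R by auto
    show "\<forall>i\<in>{w. w \<in> R \<and> w ^ r = z ^ r} - {z}. f i = 0"
      using f inj_onD[OF spec_power_inj _ _ z] by blast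
  qed
  then show ?thesis by simp
qed

lemma mass_power: "z \<in> spec \<Longrightarrow> mass (z ^ r) = mass z"
  using mass_fibre[of "z ^ r"] fibre_sum[of z mass] power_roots[of z n r] spec_R R_not_spec by auto

text \<open>The direction matches composition with the power map, which takes the indicator of z^r
  to that of z on \<open>spec\<close>.\<close>

lemma U_y_power:
  assumes z: "z \<in> spec"
  shows "U s (y (z ^ r)) = y z"
proof (rule vec_eqI)
  fix v assume v: "v \<in> carr H"
  have "z ^ r \<in> R" using z spec_R power_roots by auto
  then have "ip H (U s (y (z ^ r))) v = (\<Sum>w | w \<in> R \<and> w ^ r = z ^ r. ip H (y w) v)"
    using v by (simp add: ip_U_y)
  also have "\<dots> = ip H (y z) v"
    using v z by (intro fibre_sum) (auto simp: ip_zero dest!: R_not_spec simp: mass_zero)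
  finally show "ip H (U s (y (z ^ r))) v = ip H (y z) v" .
qed (simp_all add: U_closed y_closed)

end

section \<open>The measure of an invariant vector\<close>

context fixed_vector_rep
begin

lemma ip_E1_y:
  assumes "z \<in> R" "v \<in> carr H"
  shows "ip H (E 1 v) (y z) = z * ip H v (y z)"
proof -
  have "cnj z * ip H (E 1 v) (y z) = ip H (E 1 v) (E 1 (y z))"
    using assms by (simp add: E1_y ip_scale_right y_closed E_closed)
  also have "\<dots> = ip H v (y z)" using assms by (simp add: E1_isom y_closed)
  finally have "(cnj z * z) * ip H (E 1 v) (y z) = z * ip H v (y z)" by (simp add: mult_ac)
  then show ?thesis by (simp only: cnj_roots[OF assms(1) n] mult_1)
qed

text \<open>For B inside \<open>spec\<close>, the orthogonal projection onto the span of the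
  \<open>y z\<close> with z in B; \<open>mass z\<close> is the squared norm of
  \<open>y z\<close>.\<close>

definition proj :: "complex set \<Rightarrow> 'h \<Rightarrow> 'h" where
  "proj B v = vsum (\<lambda>z. vscale H (ip H v (y z) / of_real (mass z)) (y z)) B"

context
  fixes B assumes B: "B \<subseteq> spec"
begin

lemma finite_B: "finite B"
  using B finite_spec finite_subset by blast

lemma proj_closed: "v \<in> carr H \<Longrightarrow> proj B v \<in> carr H"
  by (simp add: proj_def vsum finite_B scale_closed y_closed)

lemma ip_proj: "v \<in> carr H \<Longrightarrow> u \<in> carr H \<Longrightarrow>
    ip H (proj B v) u = (\<Sum>z\<in>B. ip H v (y z) * ip H (y z) u / of_real (mass z))"
  by (simp add: proj_def vsum finite_B scale_closed y_closed ip_scale)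

lemma proj_adj:
  assumes "u \<in> carr H" "v \<in> carr H"
  shows "ip H (proj B u) v = ip H u (proj B v)"
proof -
  have "ip H u (proj B v) = cnj (ip H (proj B v) u)"
    using assms ip_commute proj_closed by blast
  also have "\<dots> = (\<Sum>z\<in>B. ip H u (y z) * ip H (y z) v / of_real (mass z))"
    using assms by (simp add: ip_proj ip_commute[of v] ip_commute[of _ u] y_closed mult.commute)
  finally show ?thesis using assms by (simp add: ip_proj)
qed

lemma mass_pos: "z \<in> B \<Longrightarrow> mass z > 0"
  using B by (auto simp: spec_def)

lemma proj_bounded: "proj B \<in> bounded_ops H"
proof -
  \<comment> \<open>A crude bound, one application of Cauchy-Schwarz to each z in B; any finite
    constant will do.\<close>
  have bound: "hnorm H (proj B v) \<le> real (card B) * hnorm H v" if v: "v \<in> carr H" for v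
  proof -
    note pc = proj_closed[OF v]
    have "(hnorm H (proj B v))\<^sup>2 = cmod (ip H (proj B v) (proj B v))"
      using pc by (simp add: ip_self norm_power hnorm_nonneg)
    also have "\<dots> \<le> (\<Sum>z\<in>B. cmod (ip H v (y z) * ip H (y z) (proj B v) / of_real (mass z)))"
      using v pc by (simp only: ip_proj) (rule norm_sum)
    also have "\<dots> \<le> (\<Sum>z\<in>B. hnorm H v * hnorm H (proj B v))"
    proof (rule sum_mono)
      fix z assume z: "z \<in> B"
      have "cmod (ip H v (y z)) * cmod (ip H (y z) (proj B v))
          \<le> (hnorm H v * hnorm H (y z)) * (hnorm H (y z) * hnorm H (proj B v))"
        using v pc by (intro mult_mono cauchy_schwarz) (auto simp: y_closed hnorm_nonneg)
      also have "\<dots> = hnorm H v * hnorm H (proj B v) * mass z"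
        by (simp add: mass_def power2_eq_square)
      finally show "cmod (ip H v (y z) * ip H (y z) (proj B v) / of_real (mass z))
          \<le> hnorm H v * hnorm H (proj B v)"
        using mass_pos[OF z] by (simp add: norm_mult norm_divide field_simps)
    qed
    also have "\<dots> = hnorm H (proj B v) * (real (card B) * hnorm H v)" by simp
    finally have "hnorm H (proj B v) * hnorm H (proj B v) \<le> hnorm H (proj B v) * (real (card B) * hnorm H v)"
      by (simp add: power2_eq_square)
    then show ?thesis
      using hnorm_nonneg[OF pc] hnorm_nonneg[OF v] by (cases "hnorm H (proj B v) = 0") auto
  qed
  have "proj B (vadd H u v) = vadd H (proj B u) (proj B v)" if "u \<in> carr H" "v \<in> carr H" for u v
    using that
    by (intro vec_eqI) (simp_all add: ip_proj proj_closed add_closed ip_add y_closed algebra_simps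
        add_divide_distrib sum.distrib)
  moreover have "proj B (vscale H c u) = vscale H c (proj B u)" if "u \<in> carr H" for c u
    using that
    by (intro vec_eqI) (simp_all add: ip_proj proj_closed scale_closed ip_scale y_closed
        sum_distrib_left mult.assoc)
  ultimately show ?thesis
    using bound exI[of "\<lambda>K. \<forall>v\<in>carr H. hnorm H (proj B v) \<le> K * hnorm H v" "real (card B)"]
    by (simp add: bounded_ops_def proj_closed)
qed

lemma proj_y:
  assumes z: "z \<in> spec"
  shows "proj B (y z) = (if z \<in> B then y z else vzero H)"
proof (rule vec_eqI)
  fix u assume u: "u \<in> carr H"
  have "ip H (proj B (y z)) u = (\<Sum>w\<in>B. if z = w then ip H (y z) u else 0)"
    unfolding ip_proj[OF y_closed u]
  proof (intro sum.cong refl)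
    fix w assume w: "w \<in> B"
    then have "z \<in> R" "w \<in> R" using z B spec_R by auto
    then show "ip H (y z) (y w) * ip H (y w) u / of_real (mass w) = (if z = w then ip H (y z) u else 0)"
      using mass_pos[OF w] by (simp add: ip_y_y)
  qed
  then show "ip H (proj B (y z)) u = ip H (if z \<in> B then y z else vzero H) u"
    using u by (simp add: finite_B ip_zero)
qed (simp_all add: proj_closed y_closed zero_closed)

lemma proj_E1: "commutes (proj B) (zpow p q 1)"
  unfolding commutes_def
proof
  fix v assume v: "v \<in> carr H"
  show "proj B (E 1 v) = E 1 (proj B v)"
  proof (rule vec_eqI)
    fix u assume u: "u \<in> carr H"
    have "ip H (E 1 (proj B v)) u = ip H (proj B v) (E (- 1) u)"
      using u v by (simp add: E_adj proj_closed Z_1)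
    also have "\<dots> = (\<Sum>z\<in>B. ip H v (y z) * ip H (E 1 (y z)) u / of_real (mass z))"
      using u v by (simp add: ip_proj E_closed E_adj Z_1 y_closed)
    also have "\<dots> = (\<Sum>z\<in>B. ip H (E 1 v) (y z) * ip H (y z) u / of_real (mass z))"
    proof (intro sum.cong refl)
      fix z assume "z \<in> B"
      then have "z \<in> R" using B spec_R by auto
      then show "ip H v (y z) * ip H (E 1 (y z)) u / of_real (mass z)
          = ip H (E 1 v) (y z) * ip H (y z) u / of_real (mass z)"
        using u v by (simp add: E1_y ip_scale y_closed ip_E1_y)
    qed
    finally show "ip H (proj B (E 1 v)) u = ip H (E 1 (proj B v)) u"
      using u v by (simp add: ip_proj E_closed)
  qed (use v in \<open>simp_all add: proj_closed E_closed\<close>)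
qed

end

end

context fixed_vector_power
begin

text \<open>The condition on B makes z to z^r a permutation of B, and \<open>U s\<close> carries
  \<open>y (z ^ r)\<close> to \<open>y z\<close> with the same mass, so the terms of the projection
  are only permuted.\<close>

lemma proj_U:
  assumes B: "B \<subseteq> spec" and inv: "\<And>z. z \<in> spec \<Longrightarrow> z \<in> B \<longleftrightarrow> z ^ r \<in> B"
  shows "commutes (proj B) (ucan p q s)"
  unfolding commutes_def
proof
  have bij: "bij_betw (\<lambda>z. z ^ r) B B"
  proof (rule bij_betwI')
    fix z w assume "z \<in> B" "w \<in> B"
    then show "z ^ r = w ^ r \<longleftrightarrow> z = w" using inj_on_eq_iff[OF spec_power_inj] B by blast
  next
    fix z assume "z \<in> B"
    then show "z ^ r \<in> B" using inv B by blast
  next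
    fix w assume w: "w \<in> B"
    then obtain z where "z \<in> spec" "w = z ^ r" using spec_power_image B by blast
    then show "\<exists>z\<in>B. w = z ^ r" using inv w by blast
  qed
  fix v assume v: "v \<in> carr H"
  show "proj B (U s v) = U s (proj B v)"
  proof (rule vec_eqI)
    fix u assume u: "u \<in> carr H"
    have "ip H (U s (proj B v)) u = ip H (proj B v) (U (- s) u)"
      using u v by (simp add: U_adj proj_closed[OF B])
    also have "\<dots> = (\<Sum>z\<in>B. ip H v (y z) * ip H (U s (y z)) u / of_real (mass z))"
      using u v by (simp add: ip_proj[OF B] U_closed U_adj y_closed)
    also have "\<dots> = (\<Sum>z\<in>B. ip H v (y (z ^ r)) * ip H (U s (y (z ^ r))) u / of_real (mass (z ^ r)))"
      by (rule sum.reindex_bij_betw[OF bij, symmetric])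
    also have "\<dots> = (\<Sum>z\<in>B. ip H (U s v) (y z) * ip H (y z) u / of_real (mass z))"
    proof (intro sum.cong refl)
      fix z assume "z \<in> B"
      then have z: "z \<in> spec" using B by auto
      have "ip H (U s v) (y z) = ip H (U s v) (U s (y (z ^ r)))" by (simp add: U_y_power[OF z])
      also have "\<dots> = ip H v (y (z ^ r))" using v by (simp add: U_isom y_closed)
      finally show "ip H v (y (z ^ r)) * ip H (U s (y (z ^ r))) u / of_real (mass (z ^ r))
          = ip H (U s v) (y z) * ip H (y z) u / of_real (mass z)"
        by (simp add: U_y_power[OF z] mass_power[OF z])
    qed
    finally show "ip H (proj B (U s v)) u = ip H (U s (proj B v)) u"
      using u v by (simp add: ip_proj[OF B] U_closed)
  qed (use v in \<open>simp_all add: proj_closed[OF B] U_closed\<close>)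
qed

end

lemma (in hilbert_space) star_rep_transport:
  assumes rep: "star_rep A H \<pi>" and star: "\<And>a. a \<in> carr A \<Longrightarrow> astar A a \<in> carr A"
    and W: "unitary_map H K W"
  shows "star_rep A K (\<lambda>a C. W (\<pi> a (inv_into (carr H) W C)))"
proof -
  have bij: "bij_betw W (carr H) (carr K)"
    and W_add: "\<And>x y. x \<in> carr H \<Longrightarrow> y \<in> carr H \<Longrightarrow> vadd K (W x) (W y) = W (vadd H x y)"
    and W_scale: "\<And>c x. x \<in> carr H \<Longrightarrow> vscale K c (W x) = W (vscale H c x)"
    and W_ip: "\<And>x y. x \<in> carr H \<Longrightarrow> y \<in> carr H \<Longrightarrow> ip K (W x) (W y) = ip H x y"
    using W by (auto simp: unitary_map_def)
  have inv: "inv_into (carr H) W (W x) = x" if "x \<in> carr H" for x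
    using bij_betw_inv_into_left[OF bij that] .
  have K: "carr K = W ` carr H" using bij by (simp add: bij_betw_def)
  have norm: "hnorm K (W x) = hnorm H x" if "x \<in> carr H" for x
    using that by (simp add: hnorm_def W_ip)
  note R = star_repD[OF rep]
  have "(\<lambda>C. W (\<pi> a (inv_into (carr H) W C))) \<in> bounded_ops K" if a: "a \<in> carr A" for a
  proof -
    obtain c where c: "\<And>x. x \<in> carr H \<Longrightarrow> hnorm H (\<pi> a x) \<le> c * hnorm H x"
      using bounded_ops_bound[OF R(1)[OF a]] by blast
    show ?thesis
      unfolding bounded_ops_def K using c bounded_opsD[OF R(1)[OF a]]
      by (auto simp: inv W_add W_scale norm add_closed scale_closed)
  qed
  then show ?thesis
    unfolding star_rep_def K by (auto simp: inv R star W_add W_scale W_ip)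
qed

section \<open>Consequences of irreducibility: ergodicity and the identification with L2\<close>

locale irreducible_fixed_vector_rep = fixed_vector_rep p q H \<pi> x n
  for p q :: nat and H :: "('h, 'm) hilb_scheme" and \<pi> x n +
  assumes irr: "irreducible_rep CP H \<pi>"
begin

interpretation Pp: fixed_vector_power p q H \<pi> x n p "(1, 0)"
  by unfold_locales (simp add: scal_def)

interpretation Pq: fixed_vector_power p q H \<pi> x n q "(0, 1)"
  by unfold_locales (simp add: scal_def)

text \<open>The projection is a scalar, and that scalar is 1 because it fixes \<open>y z\<close> for
  z in B. Taking B = \<open>spec\<close> gives \<open>parseval\<close>; taking the atoms in an
  invariant Borel set gives ergodicity.\<close>

lemma invariant_subset:
  assumes B: "B \<subseteq> spec" and inv: "\<And>z. z \<in> spec \<Longrightarrow> z \<in> B \<longleftrightarrow> z ^ p \<in> B"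
    "\<And>z. z \<in> spec \<Longrightarrow> z \<in> B \<longleftrightarrow> z ^ q \<in> B" and ne: "B \<noteq> {}"
  shows "B = spec" and "v \<in> carr H \<Longrightarrow> proj B v = v"
proof -
  have "proj B \<in> commutant CP H \<pi>"
    by (intro commutant_selfadjointI proj_bounded proj_adj proj_E1 Pp.proj_U Pq.proj_U B inv)
  then obtain c where c: "\<And>v. v \<in> carr H \<Longrightarrow> proj B v = vscale H c v"
    using irr unfolding irreducible_rep_def by blast
  obtain z where z: "z \<in> B" using ne by blast
  then have zs: "z \<in> spec" using B by auto
  have "ip H (vscale H c (y z)) (y z) = ip H (y z) (y z)"
    using c[OF y_closed[of z]] proj_y[OF B zs] z by simp
  then have "c * ip H (y z) (y z) = ip H (y z) (y z)" by (simp add: ip_scale y_closed)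
  moreover have "ip H (y z) (y z) \<noteq> 0" using zs by (auto simp: ip_y_y spec_def)
  ultimately have "c = 1" by simp
  then show pv: "proj B v = v" if "v \<in> carr H" for v using c that by (simp add: scale_one)
  show "B = spec"
  proof (rule ccontr)
    assume "B \<noteq> spec"
    then obtain w where w: "w \<in> spec" "w \<notin> B" using B by auto
    then have "y w = vzero H" using proj_y[OF B w(1)] pv[OF y_closed] by simp
    then have "mass w = 0" by (simp add: mass_zero)
    then show False using w by (simp add: spec_def)
  qed
qed

lemma spec_power: "z \<in> spec \<Longrightarrow> z ^ p \<in> spec" "z \<in> spec \<Longrightarrow> z ^ q \<in> spec"
  using Pp.spec_power_image Pq.spec_power_image by blast+

lemma parseval:
  "u \<in> carr H \<Longrightarrow> v \<in> carr H \<Longrightarrow> ip H u v = (\<Sum>z\<in>spec. ip H u (y z) * ip H (y z) v / of_real (mass z))"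
  using ip_proj[OF order_refl, of u v] invariant_subset(2)[OF order_refl _ _ spec_nonempty, of u] spec_power
  by auto

text \<open>The point measure is pushed along the inclusion only to equip it with the Borel
  sigma-algebra of the circle.\<close>

definition \<nu> :: "complex measure" where
  "\<nu> = distr (point_measure spec (\<lambda>z. ennreal (mass z))) (restrict_space borel (sphere 0 1)) (\<lambda>z. z)"

lemma spec_sphere: "spec \<subseteq> sphere 0 1"
  using norm_roots[OF _ n] spec_R by auto

lemma sets_\<nu>: "sets \<nu> = sets (restrict_space borel (sphere 0 1))"
  by (simp add: \<nu>_def)

lemma space_\<nu>: "space \<nu> = sphere 0 1"
  by (simp add: \<nu>_def space_restrict_space)

lemma emeasure_\<nu>:
  assumes "A \<in> sets \<nu>"
  shows "emeasure \<nu> A = ennreal (\<Sum>z\<in>spec \<inter> A. mass z)"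
proof -
  have "(\<lambda>z. z) \<in> measurable (point_measure spec (\<lambda>z. ennreal (mass z))) (restrict_space borel (sphere 0 1))"
    using spec_sphere by (auto simp: space_restrict_space)
  then have "emeasure \<nu> A = emeasure (point_measure spec (\<lambda>z. ennreal (mass z))) (A \<inter> spec)"
    using assms unfolding \<nu>_def by (subst emeasure_distr) (simp_all add: space_point_measure vimage_def Int_def)
  also have "\<dots> = (\<Sum>z\<in>A \<inter> spec. ennreal (mass z))"
    using finite_spec by (intro emeasure_point_measure_finite2) auto
  also have "\<dots> = ennreal (\<Sum>z\<in>spec \<inter> A. mass z)"
    by (simp add: sum_ennreal mass_nonneg Int_commute)
  finally show ?thesis .
qed

lemma singleton_\<nu>: "z \<in> sphere 0 1 \<Longrightarrow> {z} \<in> sets \<nu>"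
  unfolding sets_\<nu> sets_restrict_space by (auto intro!: image_eqI[of _ _ "{z}"])

lemma measure_\<nu>: "z \<in> spec \<Longrightarrow> measure \<nu> {z} = mass z"
  using emeasure_\<nu>[OF singleton_\<nu>[of z]] spec_sphere
  by (auto simp: measure_def mass_nonneg)

lemma circle_prob_\<nu>: "circle_prob \<nu>"
proof -
  have "spec \<inter> space \<nu> = spec" using spec_sphere by (auto simp: space_\<nu>)
  then have "emeasure \<nu> (space \<nu>) = 1"
    by (simp add: emeasure_\<nu> sum_mass)
  then show ?thesis by (simp add: circle_prob_def sets_\<nu> prob_spaceI)
qed

sublocale N: finite_circle_measure \<nu> spec
proof
  have "spec \<in> sets \<nu>"
    unfolding sets_\<nu> sets_restrict_space using spec_sphere finite_spec
    by (auto intro!: image_eqI[of _ _ spec] borel_closed finite_imp_closed)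
  then have "space \<nu> - spec \<in> sets \<nu>" by auto
  then have "space \<nu> - spec \<in> null_sets \<nu>" by (simp add: null_sets_def emeasure_\<nu>)
  then show "AE z in \<nu>. z \<in> spec" by (rule AE_I') auto
  show "measure \<nu> {z} > 0" if "z \<in> spec" for z
    using that by (simp add: measure_\<nu>) (simp add: spec_def)
qed (rule circle_prob_\<nu> finite_spec spec_sphere)+

lemma finite_msupport_\<nu>: "finite (msupport \<nu>)"
proof (rule finite_subset[OF _ finite_spec])
  show "msupport \<nu> \<subseteq> spec"
  proof
    fix z assume z: "z \<in> msupport \<nu>"
    show "z \<in> spec"
    proof (rule ccontr)
      assume "z \<notin> spec"
      moreover have op: "open (- spec)" using finite_spec by (simp add: finite_imp_closed open_Compl)
      ultimately have "emeasure \<nu> (- spec \<inter> space \<nu>) > 0" using z by (auto simp: msupport_def)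
      moreover have "- spec \<inter> space \<nu> \<in> sets \<nu>"
        unfolding sets_\<nu> sets_restrict_space space_\<nu> using op by (auto simp: Int_commute)
      ultimately show False by (simp add: emeasure_\<nu> Int_assoc[symmetric])
    qed
  qed
qed

lemma times_invariant_aux:
  assumes img: "(\<lambda>z. z ^ r) ` spec = spec" "inj_on (\<lambda>z. z ^ r) spec"
    and m: "\<And>z. z \<in> spec \<Longrightarrow> mass (z ^ r) = mass z"
  shows "times_invariant r \<nu>"
  unfolding times_invariant_def
proof
  fix A assume A: "A \<in> sets \<nu>"
  have "{z \<in> space \<nu>. z ^ r \<in> A} = (\<lambda>z. z ^ r) -` A \<inter> space \<nu>" by auto
  also have "\<dots> \<in> sets \<nu>" by (rule measurable_sets[OF N.power_measurable A])
  finally have "emeasure \<nu> {z \<in> space \<nu>. z ^ r \<in> A}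
      = ennreal (\<Sum>z\<in>spec \<inter> {z \<in> space \<nu>. z ^ r \<in> A}. mass z)"
    by (rule emeasure_\<nu>)
  also have "(\<Sum>z\<in>spec \<inter> {z \<in> space \<nu>. z ^ r \<in> A}. mass z)
      = (\<Sum>z\<in>spec \<inter> {z \<in> space \<nu>. z ^ r \<in> A}. mass (z ^ r))"
    by (intro sum.cong refl) (simp add: m)
  also have "\<dots> = (\<Sum>z\<in>spec \<inter> A. mass z)"
  proof (rule sum.reindex_bij_betw)
    have "(\<lambda>z. z ^ r) ` (spec \<inter> {z \<in> space \<nu>. z ^ r \<in> A}) = spec \<inter> A"
    proof (intro set_eqI iffI)
      fix w assume "w \<in> spec \<inter> A"
      then obtain z where "z \<in> spec" "w = z ^ r" "w \<in> A" using img(1) by blast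
      then show "w \<in> (\<lambda>z. z ^ r) ` (spec \<inter> {z \<in> space \<nu>. z ^ r \<in> A})"
        using spec_sphere space_\<nu> by blast
    qed (use img(1) in blast)
    then show "bij_betw (\<lambda>z. z ^ r) (spec \<inter> {z \<in> space \<nu>. z ^ r \<in> A}) (spec \<inter> A)"
      using inj_on_subset[OF img(2)] by (simp add: bij_betw_def)
  qed
  finally show "emeasure \<nu> {z \<in> space \<nu>. z ^ r \<in> A} = emeasure \<nu> A"
    by (simp add: emeasure_\<nu>[OF A])
qed

lemma times_invariant_\<nu>: "times_invariant p \<nu>" "times_invariant q \<nu>"
  using times_invariant_aux[OF Pp.spec_power_image Pp.spec_power_inj Pp.mass_power]
    times_invariant_aux[OF Pq.spec_power_image Pq.spec_power_inj Pq.mass_power] by blast+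

lemma times_ergodic_\<nu>: "times_ergodic p q \<nu>"
  unfolding times_ergodic_def
proof (intro ballI impI)
  fix A assume A: "A \<in> sets \<nu>" "{z \<in> space \<nu>. z ^ p \<in> A} = A \<and> {z \<in> space \<nu>. z ^ q \<in> A} = A"
  have sp: "spec \<subseteq> space \<nu>" using spec_sphere space_\<nu> by simp
  have "spec \<inter> A = {} \<or> spec \<inter> A = spec"
  proof (cases "spec \<inter> A = {}")
    case False
    then have "spec \<inter> A = spec"
      using A(2) sp spec_power by (intro invariant_subset(1)) blast+
    then show ?thesis ..
  qed simp
  then show "measure \<nu> A \<in> {0, 1}"
    by (auto simp: measure_def emeasure_\<nu>[OF A(1)] sum_mass)
qed

text \<open>Coordinates in the orthogonal basis: \<open>y z\<close> goes to the class of the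
  indicator of z, and both have squared norm \<open>mass z\<close>.\<close>

definition W :: "'h \<Rightarrow> (complex \<Rightarrow> complex) set" where
  "W v = ae_class \<nu> (N.cut (\<lambda>z. ip H v (y z) / of_real (mass z)))"

lemma mass_spec: "z \<in> spec \<Longrightarrow> mass z \<noteq> 0"
  by (simp add: spec_def)

lemma W_eq_iff:
  assumes "f \<in> borel_measurable \<nu>"
  shows "W v = ae_class \<nu> f \<longleftrightarrow> (\<forall>z\<in>spec. ip H v (y z) = f z * of_real (mass z))"
  using mass_spec unfolding W_def
  by (subst N.ae_class_eq[OF N.cut_measurable assms]) (auto simp: N.cut_def field_simps)

lemma W_surj:
  assumes "f \<in> borel_measurable \<nu>"
  obtains v where "v \<in> carr H" "W v = ae_class \<nu> f"
proof -
  define v where "v = vsum (\<lambda>z. vscale H (f z) (y z)) spec"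
  have v: "v \<in> carr H" by (simp add: v_def vsum finite_spec scale_closed y_closed)
  moreover have "ip H v (y z) = f z * of_real (mass z)" if "z \<in> spec" for z
  proof -
    have "ip H v (y z) = (\<Sum>w\<in>spec. if w = z then f z * of_real (mass z) else 0)"
      unfolding v_def vsum(2)[OF finite_spec scale_closed[OF y_closed] y_closed]
      using that by (intro sum.cong refl) (simp add: ip_scale y_closed ip_y_y subsetD[OF spec_R])
    then show ?thesis using that by (simp add: finite_spec)
  qed
  ultimately show ?thesis using that by (simp add: W_eq_iff[OF assms])
qed

lemma W_unitary: "unitary_map H (L2 \<nu>) W"
  unfolding unitary_map_def
proof (intro conjI ballI allI)
  have cut_m: "N.cut f \<in> borel_measurable \<nu>" for f by (rule N.cut_measurable)
  show "bij_betw W (carr H) (carr (L2 \<nu>))"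
  proof (rule bij_betwI')
    fix u v assume uv: "u \<in> carr H" "v \<in> carr H"
    have "u = v" if "W u = W v"
    proof (rule vec_eqI[OF uv])
      fix t assume t: "t \<in> carr H"
      have "\<forall>z\<in>spec. ip H u (y z) = N.cut (\<lambda>z. ip H v (y z) / of_real (mass z)) z * of_real (mass z)"
        using that W_eq_iff[OF cut_m] W_def by metis
      then have "\<forall>z\<in>spec. ip H u (y z) = ip H v (y z)"
        by (simp add: N.cut_def mass_spec)
      then show "ip H u t = ip H v t" using uv t by (simp add: parseval)
    qed
    then show "W u = W v \<longleftrightarrow> u = v" by auto
  next
    fix v assume "v \<in> carr H"
    then show "W v \<in> carr (L2 \<nu>)" by (simp add: W_def N.carr_L2 cut_m)
  next
    fix C assume "C \<in> carr (L2 \<nu>)"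
    then obtain f where f: "f \<in> borel_measurable \<nu>" "C = ae_class \<nu> f" by (auto simp: N.carr_L2)
    then show "\<exists>v\<in>carr H. C = W v" using W_surj by metis
  qed
  fix u v c assume u: "u \<in> carr H"
  show "W (vscale H c u) = vscale (L2 \<nu>) c (W u)"
    unfolding W_def[of u] N.L2_ops(2)[OF cut_m cut_m]
    by (subst W_eq_iff[OF borel_measurable_times[OF borel_measurable_const cut_m]])
      (use u in \<open>simp add: N.cut_def mass_spec ip_scale y_closed\<close>)
  assume v: "v \<in> carr H"
  show "W (vadd H u v) = vadd (L2 \<nu>) (W u) (W v)"
    unfolding W_def[of u] W_def[of v] N.L2_ops(1)[OF cut_m cut_m]
    by (subst W_eq_iff[OF borel_measurable_add[OF cut_m cut_m]])
      (use u v in \<open>simp add: N.cut_def mass_spec ip_add y_closed field_simps\<close>)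
  have "ip (L2 \<nu>) (W u) (W v) = (\<Sum>z\<in>spec. ip H u (y z) * cnj (ip H v (y z)) / of_real (mass z))"
    unfolding W_def N.L2_ops(3)[OF cut_m cut_m]
    by (intro sum.cong refl) (simp add: N.cut_def measure_\<nu> mass_spec field_simps)
  also have "\<dots> = ip H u v"
    using u v by (simp add: parseval[OF u v] ip_commute[symmetric] y_closed)
  finally show "ip (L2 \<nu>) (W u) (W v) = ip H u v" .
qed

lemma induced_by_\<nu>: "induced_by p q H \<pi> \<nu>"
proof -
  define \<rho> where "\<rho> = (\<lambda>a C. W (\<pi> a (inv_into (carr H) W C)))"
  have star: "star_rep CP (L2 \<nu>) \<rho>"
    unfolding \<rho>_def by (rule star_rep_transport[OF star_rep CP_star_closed W_unitary])
  have bij: "bij_betw W (carr H) (carr (L2 \<nu>))" using W_unitary by (simp add: unitary_map_def)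
  have \<rho>W: "\<rho> a (W v) = W (\<pi> a v)" if "v \<in> carr H" for a v
    unfolding \<rho>_def using bij_betw_inv_into_left[OF bij that] by simp
  have "\<rho> (ucan p q (1, 0)) (ae_class \<nu> f) = ae_class \<nu> (\<lambda>z. f (z ^ p)) \<and>
      \<rho> (ucan p q (0, 1)) (ae_class \<nu> f) = ae_class \<nu> (\<lambda>z. f (z ^ q)) \<and>
      \<rho> (zpow p q 1) (ae_class \<nu> f) = ae_class \<nu> (\<lambda>z. z * f z)" if f: "f \<in> borel_measurable \<nu>" for f
  proof -
    obtain v where v: "v \<in> carr H" "W v = ae_class \<nu> f" using W_surj[OF f] by blast
    then have fv: "ip H v (y z) = f z * of_real (mass z)" if "z \<in> spec" for z
      using W_eq_iff[OF f] that by blast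
    \<comment> \<open>Writing \<open>y z\<close> as \<open>U (1, 0) (y (z ^ p))\<close> removes the
      unitary from both sides, leaving the coefficient of v at z^p with the unchanged mass.\<close>
    have Up: "ip H (U (1, 0) v) (y z) = f (z ^ p) * of_real (mass z)" if z: "z \<in> spec" for z
    proof -
      have "ip H (U (1, 0) v) (y z) = ip H (U (1, 0) v) (U (1, 0) (y (z ^ p)))"
        by (simp add: Pp.U_y_power[OF z])
      then show ?thesis using v z by (simp add: U_isom y_closed fv spec_power Pp.mass_power)
    qed
    have Uq: "ip H (U (0, 1) v) (y z) = f (z ^ q) * of_real (mass z)" if z: "z \<in> spec" for z
    proof -
      have "ip H (U (0, 1) v) (y z) = ip H (U (0, 1) v) (U (0, 1) (y (z ^ q)))"
        by (simp add: Pq.U_y_power[OF z])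
      then show ?thesis using v z by (simp add: U_isom y_closed fv spec_power Pq.mass_power)
    qed
    have Ez: "ip H (E 1 v) (y z) = z * f z * of_real (mass z)" if z: "z \<in> spec" for z
      using v z spec_R ip_E1_y[of z v] by (auto simp: fv)
    show ?thesis
      unfolding v(2)[symmetric] \<rho>W[OF v(1)]
      using Up Uq Ez N.power_comp_measurable[OF f] borel_measurable_times[OF N.ident_measurable f]
      by (simp add: W_eq_iff)
  qed
  then have "measure_rep p q \<nu> \<rho>"
    using star by (simp add: measure_rep_def N.l2_eq)
  moreover have "unitarily_equivalent CP H \<pi> (L2 \<nu>) \<rho>"
    unfolding unitarily_equivalent_def using W_unitary \<rho>W by metis
  ultimately show ?thesis unfolding induced_by_def by blast
qed

end

lemma (in crossed_rep) induced_sufficient: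
  fixes N :: int
  assumes irr: "irreducible_rep CP H \<pi>" and fixed: "fixed_vectors p q H \<pi> \<noteq> {vzero H}"
    and N: "N \<noteq> 0" "\<And>x. x \<in> fixed_vectors p q H \<pi> \<Longrightarrow> E (of_int N) x = x"
  shows "\<exists>\<mu>. circle_prob \<mu> \<and> times_invariant p \<mu> \<and> times_invariant q \<mu> \<and>
    times_ergodic p q \<mu> \<and> finite (msupport \<mu>) \<and> induced_by p q H \<pi> \<mu>"
proof -
  have fixed_vec: "fixed_vectors p q H \<pi> = {x \<in> carr H. \<forall>s. U s x = x}"
    by (simp add: fixed_vectors_def)
  have "U s (vzero H) = vzero H" for s
    using U_linear(2)[OF zero_closed, of s 0] by (simp add: scale_zero zero_closed U_closed)
  then have "vzero H \<in> fixed_vectors p q H \<pi>" by (simp add: fixed_vec zero_closed)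
  then obtain x0 where x0: "x0 \<in> fixed_vectors p q H \<pi>" "x0 \<noteq> vzero H" using fixed by blast
  then have x0c: "x0 \<in> carr H" and x0U: "\<And>s. U s x0 = x0" unfolding fixed_vec by blast+
  have nx0: "hnorm H x0 \<noteq> 0" using x0(2) x0c by (simp add: hnorm_eq_zero)
  define x where "x = vscale H (of_real (1 / hnorm H x0)) x0"
  have x: "x \<in> carr H" using x0c by (simp add: x_def scale_closed)
  have Ux: "U s x = x" for s using x0c x0U by (simp add: x_def U_linear)
  have "hnorm H x = 1"
    using nx0 hnorm_nonneg[OF x0c] by (simp add: x_def hnorm_scale x0c norm_divide)
  then have x1: "ip H x x = 1" using ip_self[OF x] by simp
  have xf: "x \<in> fixed_vectors p q H \<pi>" using x Ux by (simp add: fixed_vec)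
  \<comment> \<open>The unit of the algebra commutes with everything, so it acts as a scalar; fixing
    the unit vector x forces that scalar to be 1.\<close>
  have U0_comm: "U 0 \<in> commutant CP H \<pi>"
  proof (rule commutantI)
    show "U 0 \<in> bounded_ops H" by (rule rep(1)[OF ucan_closed])
  qed (simp_all add: E_0[symmetric] E_E Z_0, simp add: E_0 U_U)
  then obtain c where c: "\<And>v. v \<in> carr H \<Longrightarrow> U 0 v = vscale H c v"
    using irr unfolding irreducible_rep_def by blast
  have "ip H (vscale H c x) x = 1" using c[OF x] Ux x1 by simp
  then have "c = 1" using x x1 by (simp add: ip_scale)
  then have unital: "U 0 v = v" if "v \<in> carr H" for v using c that by (simp add: scale_one)
  define n where "n = nat \<bar>N\<bar>"
  have "E (of_nat n) x = x"
  proof (cases "N \<ge> 0")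
    case True
    then show ?thesis using N(2)[OF xf] by (simp add: n_def)
  next
    case False
    \<comment> \<open>For negative N, the inverse \<open>E (- of_int N)\<close> is applied to
      \<open>E (of_int N) x\<close> = x.\<close>
    then have "(of_nat n :: rat) = - of_int N" by (simp add: n_def)
    then have "E (of_nat n) x = E (- of_int N) (E (of_int N) x)" using N(2)[OF xf] by simp
    also have "\<dots> = x"
      using x by (simp add: E_E Zloc_of_int Zloc_uminus E_0 Ux)
    finally show ?thesis .
  qed
  then interpret F: irreducible_fixed_vector_rep p q H \<pi> x n
    using x x1 Ux N(1) unital irr by unfold_locales (auto simp: n_def)
  show ?thesis
    using F.circle_prob_\<nu> F.times_invariant_\<nu> F.times_ergodic_\<nu> F.finite_msupport_\<nu> F.induced_by_\<nu>
    by blast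
qed

theorem theorem4p2:
  fixes p q :: nat
    and H :: "'h hilb"
    and \<pi> :: "crossed_elt \<Rightarrow> 'h \<Rightarrow> 'h"
  assumes "p > 1" and "q > 1"
    and "ln (real p) / ln (real q) \<notin> \<rat>"
    and "hilbert_space H"
    and "star_rep (crossed_product p q) H \<pi>"
  shows "(\<exists>\<mu>. circle_prob \<mu> \<and> times_invariant p \<mu> \<and> times_invariant q \<mu> \<and>
              times_ergodic p q \<mu> \<and> finite (msupport \<mu>) \<and> induced_by p q H \<pi> \<mu>)
     \<longleftrightarrow>
         (irreducible_rep (crossed_product p q) H \<pi> \<and>
          fixed_vectors p q H \<pi> \<noteq> {vzero H} \<and>
          (\<exists>N::int. N \<noteq> 0 \<and>
             (\<forall>x\<in>fixed_vectors p q H \<pi>. \<pi> (zpow p q (of_int N)) x = x)))"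
proof -
  interpret crossed_rep p q H \<pi>
    using assms by (simp add: crossed_rep_def two_bases_def crossed_rep_axioms_def)
  show ?thesis
  proof
    assume "\<exists>\<mu>. circle_prob \<mu> \<and> times_invariant p \<mu> \<and> times_invariant q \<mu> \<and>
      times_ergodic p q \<mu> \<and> finite (msupport \<mu>) \<and> induced_by p q H \<pi> \<mu>"
    then show "irreducible_rep CP H \<pi> \<and> fixed_vectors p q H \<pi> \<noteq> {vzero H} \<and>
      (\<exists>N::int. N \<noteq> 0 \<and> (\<forall>x\<in>fixed_vectors p q H \<pi>. \<pi> (zpow p q (of_int N)) x = x))"
      using induced_necessary by blast
  next
    assume "irreducible_rep CP H \<pi> \<and> fixed_vectors p q H \<pi> \<noteq> {vzero H} \<and>
      (\<exists>N::int. N \<noteq> 0 \<and> (\<forall>x\<in>fixed_vectors p q H \<pi>. \<pi> (zpow p q (of_int N)) x = x))"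
    then show "\<exists>\<mu>. circle_prob \<mu> \<and> times_invariant p \<mu> \<and> times_invariant q \<mu> \<and>
      times_ergodic p q \<mu> \<and> finite (msupport \<mu>) \<and> induced_by p q H \<pi> \<mu>"
      using induced_sufficient by blast
  qed
qed

end
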